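(* Let $\gamma>0$ and let $U\in C(\mathbb{R}^3;\mathbb{R}^3)$ be axisymmetric, with $\mathrm{div}\,U=0$ in $\mathcal{D}'(\mathbb{R}^3)$, $U(0)=0$, $|U(y)|/|y|\to0$ as $|y|\to\infty$, and $$\int_{\mathbb{R}^3}\Big((1-4\gamma)\,U\cdot\Xi-\gamma\,(y\otimes U):\nabla\Xi-(U\otimes U):\nabla\Xi\Big)\,dy=0$$ for all $\Xi\in C_0^\infty(\mathbb{R}^3;\mathbb{R}^3)$ with $\mathrm{div}\,\Xi=0$. Let $U=b_U+U_\theta e_\theta$, with $b_U=U_re_r+U_ze_z$, be the decomposition of $U$ in the cylindrical frame of the variable $y$, where $r=|y'|$. Assume that $\mathrm{curl}\,b_U=\omega_\theta e_\theta$ in $\mathcal{D}'(\mathbb{R}^3)$, where $\omega_\theta$ is an axisymmetric scalar which vanishes on the axis and belongs to $C^{0,\alpha}_{\mathrm{loc}}(\mathbb{R}^3)$ for some $\alpha\in(0,1]$. Also assume that the potential vorticity $\omega_\theta/r$ is bounded on $B(\rho)\cap\{r>0\}$ for every $\rho>0$; this is automatic when $\alpha=1$. If $U\not\equiv0$, then $\gamma\ge\frac12$. If $U_\theta\equiv0$, then $U\equiv0$ for every $\gamma>0$.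
   Context: $B(\rho)=\{y\in\mathbb{R}^3:|y|<\rho\}$. We write $y=(y',z)\in\mathbb{R}^2\times\mathbb{R}$, $r=|y'|$, with cylindrical frame $(e_r,e_\theta,e_z)$; the axis is $\{y'=0\}$. A vector field is axisymmetric if its cylindrical components are functions of $(r,z)$ only (equivalently, it is equivariant under rotations about the $z$-axis); a scalar is axisymmetric if it is invariant under these rotations. Tensor convention: $(y\otimes U):\nabla\Xi=\sum_{i,j}y_iU_j\,\partial_i\Xi_j$ and $(U\otimes U):\nabla\Xi=\sum_{i,j}U_iU_j\,\partial_i\Xi_j$. The integral identity is the pressure-free weak form of the self-similar Euler equation $(1-\gamma)U+\gamma\,y\cdot\nabla U+U\cdot\nabla U+\nabla P=0$. *)

theory Defs
  imports "HOL-Analysis.Analysis"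
begin

text \<open>Throughout, \<open>y $ 1\<close>, \<open>y $ 2\<close>, \<open>y $ 3\<close> are the Cartesian coordinates; the third one is \<open>z\<close>.\<close>

definition partial :: "3 \<Rightarrow> (real^3 \<Rightarrow> 'b::real_normed_vector) \<Rightarrow> real^3 \<Rightarrow> 'b" where
  "partial i f y = frechet_derivative f (at y) (axis i 1)"

fun C_k :: "nat \<Rightarrow> (real^3 \<Rightarrow> 'b::real_normed_vector) \<Rightarrow> bool" where
  "C_k 0 f \<longleftrightarrow> continuous_on UNIV f"
| "C_k (Suc k) f \<longleftrightarrow> f differentiable_on UNIV \<and> (\<forall>i. C_k k (partial i f))"

definition test_function :: "(real^3 \<Rightarrow> 'b::real_normed_vector) \<Rightarrow> bool" where
  "test_function f \<longleftrightarrow> (\<forall>k. C_k k f) \<and> compact (closure (support_on UNIV f))"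

definition grad :: "(real^3 \<Rightarrow> real) \<Rightarrow> real^3 \<Rightarrow> real^3" where
  "grad f y = (\<chi> i. partial i f y)"

definition divergence :: "(real^3 \<Rightarrow> real^3) \<Rightarrow> real^3 \<Rightarrow> real" where
  "divergence F y = (\<Sum>i\<in>UNIV. partial i F y $ i)"

definition curl :: "(real^3 \<Rightarrow> real^3) \<Rightarrow> real^3 \<Rightarrow> real^3" where
  "curl F y = vector
     [partial 2 F y $ 3 - partial 3 F y $ 2,
      partial 3 F y $ 1 - partial 1 F y $ 3,
      partial 1 F y $ 2 - partial 2 F y $ 1]"

definition tensor_grad ::
    "real^3 \<Rightarrow> real^3 \<Rightarrow> (real^3 \<Rightarrow> real^3) \<Rightarrow> real^3 \<Rightarrow> real" where
  \<comment> \<open>\<open>(v \<otimes> w) : \<nabla>\<Xi>\<close>, evaluated at \<open>y\<close>; the first factor carries the derivative index\<close>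
  "tensor_grad v w \<Xi> y = (\<Sum>i\<in>UNIV. \<Sum>j\<in>UNIV. v $ i * w $ j * partial i \<Xi> y $ j)"

definition distr_div_free :: "(real^3 \<Rightarrow> real^3) \<Rightarrow> bool" where
  "distr_div_free F \<longleftrightarrow>
     (\<forall>\<phi>. test_function \<phi> \<longrightarrow> integral\<^sup>L lborel (\<lambda>y. F y \<bullet> grad \<phi> y) = 0)"

text \<open>The curl is formally self-adjoint, so no sign appears.\<close>

definition distr_curl_eq :: "(real^3 \<Rightarrow> real^3) \<Rightarrow> (real^3 \<Rightarrow> real^3) \<Rightarrow> bool" where
  "distr_curl_eq F W \<longleftrightarrow>
     (\<forall>\<Phi>. test_function \<Phi> \<longrightarrow>
        integral\<^sup>L lborel (\<lambda>y. F y \<bullet> curl \<Phi> y) = integral\<^sup>L lborel (\<lambda>y. W y \<bullet> \<Phi> y))"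

definition cyl_r :: "real^3 \<Rightarrow> real" where
  "cyl_r y = sqrt ((y $ 1)\<^sup>2 + (y $ 2)\<^sup>2)"

text \<open>On the axis, where the frame is undefined, division by zero gives \<open>e_r = e_\<theta> = 0\<close>. For an
  axisymmetric field this agrees with the true values, since its horizontal part vanishes there.\<close>

definition e_r :: "real^3 \<Rightarrow> real^3" where
  "e_r y = vector [y $ 1 / cyl_r y, y $ 2 / cyl_r y, 0]"

definition e_\<theta> :: "real^3 \<Rightarrow> real^3" where
  "e_\<theta> y = vector [- (y $ 2) / cyl_r y, y $ 1 / cyl_r y, 0]"

definition e_z :: "real^3" where
  "e_z = vector [0, 0, 1]"

definition comp_r :: "(real^3 \<Rightarrow> real^3) \<Rightarrow> real^3 \<Rightarrow> real" where
  "comp_r U y = U y \<bullet> e_r y"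

definition comp_\<theta> :: "(real^3 \<Rightarrow> real^3) \<Rightarrow> real^3 \<Rightarrow> real" where
  "comp_\<theta> U y = U y \<bullet> e_\<theta> y"

definition comp_z :: "(real^3 \<Rightarrow> real^3) \<Rightarrow> real^3 \<Rightarrow> real" where
  "comp_z U y = U y \<bullet> e_z"

definition swirl_free_part :: "(real^3 \<Rightarrow> real^3) \<Rightarrow> real^3 \<Rightarrow> real^3" where
  "swirl_free_part U y = comp_r U y *\<^sub>R e_r y + comp_z U y *\<^sub>R e_z"

definition rot_z :: "real \<Rightarrow> real^3 \<Rightarrow> real^3" where
  "rot_z t y = vector [cos t * y $ 1 - sin t * y $ 2, sin t * y $ 1 + cos t * y $ 2, y $ 3]"

definition axisym_vector :: "(real^3 \<Rightarrow> real^3) \<Rightarrow> bool" where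
  "axisym_vector U \<longleftrightarrow> (\<forall>t y. U (rot_z t y) = rot_z t (U y))"

definition axisym_scalar :: "(real^3 \<Rightarrow> real) \<Rightarrow> bool" where
  "axisym_scalar f \<longleftrightarrow> (\<forall>t y. f (rot_z t y) = f y)"

lemma cyl_r_rot_z [simp]: "cyl_r (rot_z t y) = cyl_r y"
proof -
  have "(cos t * a - sin t * b)\<^sup>2 + (sin t * a + cos t * b)\<^sup>2
      = ((sin t)\<^sup>2 + (cos t)\<^sup>2) * (a\<^sup>2 + b\<^sup>2)" for a b :: real
    by (simp only: power2_eq_square) algebra
  then show ?thesis
    by (simp add: cyl_r_def rot_z_def vector_3)
qed

lemma polar_rot_z: "\<exists>t. y = rot_z t (vector [cyl_r y, 0, y $ 3])"
proof -
  obtain t where "y $ 1 = cyl_r y * cos t" "y $ 2 = cyl_r y * sin t"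
  proof (cases "cyl_r y = 0")
    case True
    then have "y $ 1 = 0" "y $ 2 = 0"
      by (simp_all add: cyl_r_def sum_power2_eq_zero_iff)
    then show thesis using that True by simp
  next
    case False
    have "(cyl_r y)\<^sup>2 = (y $ 1)\<^sup>2 + (y $ 2)\<^sup>2"
      by (simp add: cyl_r_def)
    then have "(y $ 1 / cyl_r y)\<^sup>2 + (y $ 2 / cyl_r y)\<^sup>2 = 1"
      using False by (metis add_divide_distrib divide_self power_divide power_not_zero)
    then obtain t where "y $ 1 / cyl_r y = cos t" "y $ 2 / cyl_r y = sin t"
      using sincos_total_2pi by metis
    then show thesis
      using that[of t] False by (simp add: field_simps)
  qed
  then show ?thesis
    by (intro exI[of _ t]) (simp add: rot_z_def vec_eq_iff forall_3 vector_3 mult.commute)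
qed

lemma axisym_vector_iff_components:
  "axisym_vector U \<longleftrightarrow>
     (\<exists>f g h. \<forall>y. U y = f (cyl_r y) (y $ 3) *\<^sub>R e_r y + g (cyl_r y) (y $ 3) *\<^sub>R e_\<theta> y
                         + h (cyl_r y) (y $ 3) *\<^sub>R e_z)"
proof
  assume U: "axisym_vector U"
  define p where "p r z = (vector [r, 0, z] :: real^3)" for r z :: real
  have p: "p r z $ 1 = r" "p r z $ 2 = 0" "p r z $ 3 = z" for r z
    by (simp_all add: p_def vector_3)
  have "U y = U (p (cyl_r y) (y $ 3)) $ 1 *\<^sub>R e_r y + U (p (cyl_r y) (y $ 3)) $ 2 *\<^sub>R e_\<theta> y
              + U (p (cyl_r y) (y $ 3)) $ 3 *\<^sub>R e_z" for y
  proof -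
    obtain t where t: "y = rot_z t (p (cyl_r y) (y $ 3))"
      using polar_rot_z[of y] unfolding p_def by blast
    have Uy: "U y = rot_z t (U (p (cyl_r y) (y $ 3)))"
      using U t unfolding axisym_vector_def by metis
    have y12: "y $ 1 = cos t * cyl_r y" "y $ 2 = sin t * cyl_r y"
      using arg_cong[OF t, of "\<lambda>v. v $ 1"] arg_cong[OF t, of "\<lambda>v. v $ 2"]
      by (simp_all add: rot_z_def p vector_3)
    show ?thesis
    proof (cases "cyl_r y = 0")
      case True
      let ?q = "p 0 (y $ 3)"
      have "rot_z pi ?q = ?q"
        by (simp add: rot_z_def vec_eq_iff forall_3 vector_3 p)
      then have "U ?q = rot_z pi (U ?q)"
        using U unfolding axisym_vector_def by metis
      then have "U ?q $ 1 = 0" "U ?q $ 2 = 0"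
        by (simp_all add: rot_z_def vec_eq_iff forall_3 vector_3)
      then show ?thesis
        using Uy True
        by (simp add: rot_z_def vec_eq_iff forall_3 vector_3 e_z_def e_r_def e_\<theta>_def)
    next
      case False
      then have "e_r y = vector [cos t, sin t, 0]" "e_\<theta> y = vector [- sin t, cos t, 0]"
        unfolding e_r_def e_\<theta>_def using y12 by simp_all
      then show ?thesis
        using Uy by (simp add: rot_z_def vec_eq_iff forall_3 vector_3 e_z_def mult.commute)
    qed
  qed
  then show "\<exists>f g h. \<forall>y. U y = f (cyl_r y) (y $ 3) *\<^sub>R e_r y
      + g (cyl_r y) (y $ 3) *\<^sub>R e_\<theta> y + h (cyl_r y) (y $ 3) *\<^sub>R e_z"
    by (intro exI[of _ "\<lambda>r z. U (p r z) $ 1"] exI[of _ "\<lambda>r z. U (p r z) $ 2"]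
        exI[of _ "\<lambda>r z. U (p r z) $ 3"] allI) blast
next
  assume "\<exists>f g h. \<forall>y. U y = f (cyl_r y) (y $ 3) *\<^sub>R e_r y + g (cyl_r y) (y $ 3) *\<^sub>R e_\<theta> y
      + h (cyl_r y) (y $ 3) *\<^sub>R e_z"
  then obtain f g h where
    "\<And>y. U y = f (cyl_r y) (y $ 3) *\<^sub>R e_r y + g (cyl_r y) (y $ 3) *\<^sub>R e_\<theta> y
      + h (cyl_r y) (y $ 3) *\<^sub>R e_z"
    by blast
  moreover have "rot_z t y $ 3 = y $ 3" for t y
    by (simp add: rot_z_def vector_3)
  moreover have "e_r (rot_z t y) = rot_z t (e_r y)" "e_\<theta> (rot_z t y) = rot_z t (e_\<theta> y)"
      "rot_z t e_z = e_z" for t y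
    unfolding e_r_def e_\<theta>_def e_z_def cyl_r_rot_z
    by (simp_all add: rot_z_def vec_eq_iff forall_3 vector_3 diff_divide_distrib add_divide_distrib)
  moreover have "rot_z t (a *\<^sub>R u + b *\<^sub>R v + c *\<^sub>R w)
      = a *\<^sub>R rot_z t u + b *\<^sub>R rot_z t v + c *\<^sub>R rot_z t w" for t a b c u v w
    by (simp add: rot_z_def vec_eq_iff forall_3 vector_3 algebra_simps)
  ultimately show "axisym_vector U"
    unfolding axisym_vector_def by simp
qed

lemma cylindrical_decomposition:
  assumes "axisym_vector U"
  shows "U y = swirl_free_part U y + comp_\<theta> U y *\<^sub>R e_\<theta> y"
proof -
  obtain f g h where U: "\<And>y. U y = f (cyl_r y) (y $ 3) *\<^sub>R e_r y
      + g (cyl_r y) (y $ 3) *\<^sub>R e_\<theta> y + h (cyl_r y) (y $ 3) *\<^sub>R e_z"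
    using assms unfolding axisym_vector_iff_components by blast
  have ez: "e_r y \<bullet> e_z = 0" "e_\<theta> y \<bullet> e_z = 0" "e_r y \<bullet> e_\<theta> y = 0" "e_z \<bullet> e_z = 1"
      "e_z \<bullet> e_r y = 0" "e_z \<bullet> e_\<theta> y = 0" "e_\<theta> y \<bullet> e_r y = 0"
    by (simp_all add: e_r_def e_\<theta>_def e_z_def inner_vec_def sum_3 vector_3)
  have er: "e_r y \<bullet> e_r y = 1" "e_\<theta> y \<bullet> e_\<theta> y = 1" if "cyl_r y \<noteq> 0"
  proof -
    have "y $ 1 * y $ 1 + y $ 2 * y $ 2 = cyl_r y * cyl_r y"
      by (simp add: cyl_r_def flip: power2_eq_square)
    then show "e_r y \<bullet> e_r y = 1" "e_\<theta> y \<bullet> e_\<theta> y = 1"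
      using that
      by (simp_all add: e_r_def e_\<theta>_def inner_vec_def sum_3 vector_3 add.commute
          flip: add_divide_distrib)
  qed
  show ?thesis
  proof (cases "cyl_r y = 0")
    case True
    then have z: "e_r y = 0" "e_\<theta> y = 0"
      by (simp_all add: e_r_def e_\<theta>_def vec_eq_iff forall_3 vector_3)
    show ?thesis
      using ez U[of y] by (simp add: z swirl_free_part_def comp_r_def comp_\<theta>_def comp_z_def)
  next
    case False
    then show ?thesis
      using ez er U[of y]
      by (simp add: swirl_free_part_def comp_r_def comp_\<theta>_def comp_z_def inner_add_left)
  qed
qed

definition locally_hoelder :: "real \<Rightarrow> (real^3 \<Rightarrow> real) \<Rightarrow> bool" where
  "locally_hoelder \<alpha> f \<longleftrightarrow>
     (\<forall>K. compact K \<longrightarrow> (\<exists>C. \<forall>x\<in>K. \<forall>y\<in>K. \<bar>f x - f y\<bar> \<le> C * dist x y powr \<alpha>))"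

definition potential_vorticity_locally_bounded :: "(real^3 \<Rightarrow> real) \<Rightarrow> bool" where
  "potential_vorticity_locally_bounded \<omega> \<longleftrightarrow>
     (\<forall>\<rho>>0. bounded ((\<lambda>y. \<omega> y / cyl_r y) ` (ball 0 \<rho> \<inter> {y. 0 < cyl_r y})))"

end

(* b = \<gamma> y + b_U points outwards on large spheres and has div b = 3 \<gamma>. The circulation \<Gamma> = r U_\<theta> satisfies
   b . grad \<Gamma> = (2 \<gamma> - 1) \<Gamma>; without swirl, Q = \<omega>_\<theta> / r satisfies b . grad Q = - (1 + \<gamma>) Q. If w is
   either of them and b . grad w = - k w with k > 0, then div (b w^p) = (3 \<gamma> - k p) w^p for even p. For
   k p > 3 \<gamma>, integration over a large ball gives a nonnegative outward flux equal to a nonpositive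
   integral, so w = 0. Hence \<gamma> < 1/2 forces \<Gamma> = 0, and without swirl Q = 0, so that U is curl-free,
   divergence-free and sublinear, thus constant by Liouville's theorem.

   Only weak equations are available. The equation for w^p follows from a DiPerna-Lions commutator
   estimate, which needs the L^1 modulus of continuity of b to be linear; this comes from the energy
   identity between grad, div and curl for mollified, cut-off fields. For Q the axis is cut out; the
   error is O(\<delta>) because Q is bounded and a cylinder of radius \<delta> has volume O(\<delta>^2). *)

theory Submission
  imports Defs "HOL-Computational_Algebra.Polynomial"
begin

section \<open>Calculus of smooth functions\<close>

text \<open>No pressure appears, since all test fields are divergence-free:
  \<open>r \<psi> e_\<theta>\<close> with axisymmetric \<psi> gives the equation of the circulation,
  the curl of such a field that of the vorticity. Both come out in conservative form, div (w b) = -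
  c w, with c = 1 - 5 \<gamma> for \<Gamma> and c = 1 - 2 \<gamma> for Q; as div b = 3 \<gamma>, the
  rate is k = c + 3 \<gamma>. The drift contains \<open>b_U\<close> and not \<open>U\<close>,
  because a continuous curl is given for \<open>b_U\<close> only; the swirl drops out against
  axisymmetric functions. The test function of the renormalization is built by mollifying twice and
  must stay axisymmetric, hence all mollifiers are radial. The gradient of b is controlled in L^2
  only, so there are no classical characteristics. On the other hand w is continuous, and the
  commutator is at most a constant times the oscillation of w at the scale of mollification. Q may
  be discontinuous on the axis; it is replaced by \<open>\<omega> / max r \<delta>\<close>, which is
  continuous and agrees with Q where the test functions live.\<close>

lemma partial_eqI: "(f has_derivative f') (at y) \<Longrightarrow> partial i f y = f' (axis i 1)"
  unfolding partial_def using frechet_derivative_at by metis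

lemma has_derivative_partial:
  fixes f :: "real^3 \<Rightarrow> 'b::real_normed_vector"
  assumes "f differentiable_on UNIV"
  shows "(f has_derivative (\<lambda>h. \<Sum>i\<in>UNIV. h $ i *\<^sub>R partial i f y)) (at y)"
proof -
  obtain f' where f': "(f has_derivative f') (at y)"
    using assms by (auto simp: differentiable_on_def differentiable_def)
  interpret bounded_linear f'
    using f' by (rule has_derivative_bounded_linear)
  have "f' h = (\<Sum>i\<in>UNIV. h $ i *\<^sub>R partial i f y)" for h
  proof -
    have "h = (\<Sum>i\<in>UNIV. h $ i *\<^sub>R axis i 1)"
      by (simp add: vec_eq_iff axis_def if_distrib sum.delta cong: if_cong)
    then have "f' h = f' (\<Sum>i\<in>UNIV. h $ i *\<^sub>R axis i 1)"
      by simp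
    then show ?thesis
      by (simp add: sum scaleR partial_eqI[OF f'])
  qed
  then have "f' = (\<lambda>h. \<Sum>i\<in>UNIV. h $ i *\<^sub>R partial i f y)" ..
  then show ?thesis using f' by simp
qed

lemma has_derivative_imp_differentiable_on:
  "(\<And>y. (f has_derivative f' y) (at y)) \<Longrightarrow> f differentiable_on UNIV"
  by (auto simp: differentiable_on_def differentiable_def)

lemma C_k_Suc_imp: "C_k (Suc k) f \<Longrightarrow> C_k k f"
  by (induction k arbitrary: f) (auto intro: differentiable_imp_continuous_on)

definition smooth :: "(real^3 \<Rightarrow> 'b::real_normed_vector) \<Rightarrow> bool" where
  "smooth f \<longleftrightarrow> (\<forall>k. C_k k f)"

lemma smooth_C_k: "smooth f \<Longrightarrow> C_k k f"
  by (simp add: smooth_def)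

lemma smooth_differentiable: "smooth f \<Longrightarrow> f differentiable_on UNIV"
  using smooth_C_k[of f "Suc 0"] by simp

lemma smooth_partial: "smooth f \<Longrightarrow> smooth (partial i f)"
  unfolding smooth_def by (metis C_k.simps(2))

lemma smooth_continuous: "smooth f \<Longrightarrow> continuous_on UNIV f"
  using smooth_C_k[of f 0] by simp

lemma smooth_has_derivative:
  "smooth f \<Longrightarrow> (f has_derivative (\<lambda>h. \<Sum>i\<in>UNIV. h $ i *\<^sub>R partial i f y)) (at y)"
  by (intro has_derivative_partial smooth_differentiable)

text \<open>Lets smoothness be read off from partial derivatives already known to be smooth, as for
  coordinates and for antiderivatives.\<close>

lemma smooth_iff: "smooth f \<longleftrightarrow> f differentiable_on UNIV \<and> (\<forall>i. smooth (partial i f))"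
  unfolding smooth_def
  by (metis C_k.simps(2) C_k_Suc_imp not0_implies_Suc)

lemma partial_bounded_linear:
  assumes "bounded_linear L" "f differentiable_on UNIV"
  shows "partial i (\<lambda>y. L (f y)) = (\<lambda>y. L (partial i f y))"
    and "(\<lambda>y. L (f y)) differentiable_on UNIV"
proof -
  interpret bounded_linear L by fact
  note D = has_derivative[OF has_derivative_partial[OF assms(2)]]
  show "partial i (\<lambda>y. L (f y)) = (\<lambda>y. L (partial i f y))"
    by (rule ext, subst partial_eqI[OF D])
       (simp add: axis_def if_distrib if_distribR sum.delta cong: if_cong)
  show "(\<lambda>y. L (f y)) differentiable_on UNIV"
    using D by (rule has_derivative_imp_differentiable_on)
qed

lemma C_k_bounded_linear: "bounded_linear L \<Longrightarrow> C_k k f \<Longrightarrow> C_k k (\<lambda>y. L (f y))"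
proof (induction k arbitrary: f)
  case 0
  then show ?case
    by (simp add: bounded_linear.continuous_on)
next
  case (Suc k)
  then show ?case by (simp add: partial_bounded_linear)
qed

lemma partial_add:
  assumes "f differentiable_on UNIV" "g differentiable_on UNIV"
  shows "partial i (\<lambda>y. f y + g y) = (\<lambda>y. partial i f y + partial i g y)"
  by (rule ext, subst partial_eqI[OF has_derivative_add[OF assms[THEN has_derivative_partial]]])
     (simp add: axis_def if_distrib if_distribR sum.delta cong: if_cong)

lemma C_k_add: "C_k k f \<Longrightarrow> C_k k g \<Longrightarrow> C_k k (\<lambda>y. f y + g y)"
proof (induction k arbitrary: f g)
  case 0
  then show ?case by (simp add: continuous_on_add)
next
  case (Suc k)
  then show ?case by (simp add: partial_add differentiable_on_add)
qed

lemma partial_bilinear: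
  assumes "bounded_bilinear B" "f differentiable_on UNIV" "g differentiable_on UNIV"
  shows "partial i (\<lambda>y. B (f y) (g y)) = (\<lambda>y. B (f y) (partial i g y) + B (partial i f y) (g y))"
    and "(\<lambda>y. B (f y) (g y)) differentiable_on UNIV"
proof -
  interpret bounded_bilinear B by fact
  note D = FDERIV[OF assms(2,3)[THEN has_derivative_partial]]
  show "partial i (\<lambda>y. B (f y) (g y)) = (\<lambda>y. B (f y) (partial i g y) + B (partial i f y) (g y))"
    by (rule ext, subst partial_eqI[OF D])
       (simp add: axis_def if_distrib if_distribR sum.delta cong: if_cong)
  show "(\<lambda>y. B (f y) (g y)) differentiable_on UNIV"
    using D by (rule has_derivative_imp_differentiable_on)
qed

lemma C_k_bilinear:
  "bounded_bilinear B \<Longrightarrow> C_k k f \<Longrightarrow> C_k k g \<Longrightarrow> C_k k (\<lambda>y. B (f y) (g y))"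
proof (induction k arbitrary: f g)
  case 0
  then show ?case
    by (simp add: bounded_bilinear.continuous_on)
next
  case (Suc k)
  have "C_k k f" "C_k k g"
    using Suc.prems C_k_Suc_imp by blast+
  with Suc show ?case by (simp add: partial_bilinear C_k_add)
qed

lemma smooth_bounded_linear: "bounded_linear L \<Longrightarrow> smooth f \<Longrightarrow> smooth (\<lambda>y. L (f y))"
  by (simp add: smooth_def C_k_bounded_linear)

lemma smooth_add: "smooth f \<Longrightarrow> smooth g \<Longrightarrow> smooth (\<lambda>y. f y + g y)"
  by (simp add: smooth_def C_k_add)

lemma smooth_mult: "smooth f \<Longrightarrow> smooth g \<Longrightarrow> smooth (\<lambda>y. f y * g y :: real)"
  unfolding smooth_def using C_k_bilinear[OF bounded_bilinear_mult] by blast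

lemma partial_mult:
  fixes f g :: "real^3 \<Rightarrow> real"
  assumes "smooth f" "smooth g"
  shows "partial i (\<lambda>y. f y * g y) = (\<lambda>y. f y * partial i g y + partial i f y * g y)"
  using partial_bilinear[OF bounded_bilinear_mult] assms smooth_differentiable by blast

lemma partial_const: "partial i (\<lambda>y. c) = (\<lambda>y. 0)"
  by (rule ext, subst partial_eqI[OF has_derivative_const]) simp

lemma smooth_const: "smooth (\<lambda>y. c)"
proof -
  have "C_k k (\<lambda>y. c :: 'a)" for k and c :: 'a
    by (induction k arbitrary: c) (auto simp: partial_const)
  then show ?thesis by (simp add: smooth_def)
qed

lemma partial_component: "partial i (\<lambda>y. y $ j) = (\<lambda>y. if i = j then 1 else 0)"
  by (rule ext, subst partial_eqI[OF bounded_linear_imp_has_derivative[OF bounded_linear_vec_nth]])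
     (simp add: axis_def)

lemma smooth_component: "smooth (\<lambda>y. y $ j)"
proof -
  have "(\<lambda>y. y $ j) differentiable_on UNIV"
    by (intro has_derivative_imp_differentiable_on[OF bounded_linear_imp_has_derivative]
        bounded_linear_vec_nth)
  then show ?thesis
    by (subst smooth_iff) (auto simp: partial_component smooth_const)
qed

lemma partial_cmult:
  fixes f :: "real^3 \<Rightarrow> real"
  shows "smooth f \<Longrightarrow> partial i (\<lambda>y. c * f y) = (\<lambda>y. c * partial i f y)"
  by (rule partial_bounded_linear(1)[OF bounded_linear_mult_right]) (rule smooth_differentiable)

lemma smooth_cmult: "smooth f \<Longrightarrow> smooth (\<lambda>y. c * f y :: real)"
  by (intro smooth_mult smooth_const)

lemma smooth_uminus: "smooth f \<Longrightarrow> smooth (\<lambda>y. - f y :: real)"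
  using smooth_cmult[of f "-1"] by simp

lemma partial_uminus:
  fixes f :: "real^3 \<Rightarrow> real"
  shows "smooth f \<Longrightarrow> partial i (\<lambda>y. - f y) = (\<lambda>y. - partial i f y)"
  using partial_cmult[of f i "-1"] by simp

lemma smooth_diff: "smooth f \<Longrightarrow> smooth g \<Longrightarrow> smooth (\<lambda>y. f y - g y :: real)"
  using smooth_add[OF _ smooth_uminus, of f g] by simp

lemma smooth_sum: "(\<And>i. i \<in> A \<Longrightarrow> smooth (f i)) \<Longrightarrow> smooth (\<lambda>y. \<Sum>i\<in>A. f i y)"
  by (induction A rule: infinite_finite_induct) (auto intro: smooth_add smooth_const)

lemma smooth_power: "smooth f \<Longrightarrow> smooth (\<lambda>y. f y ^ n :: real)"
  by (induction n) (auto intro: smooth_mult smooth_const)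

lemma partial_chain:
  fixes f :: "real^3 \<Rightarrow> real"
  assumes "f differentiable_on UNIV" "\<And>x. (g has_real_derivative g' x) (at x)"
  shows "partial i (\<lambda>y. g (f y)) = (\<lambda>y. g' (f y) * partial i f y)"
    and "(\<lambda>y. g (f y)) differentiable_on UNIV"
proof -
  have g: "(g has_derivative (*) (g' x)) (at x)" for x
    using assms(2) by (simp add: has_field_derivative_def)
  note D = diff_chain_at[OF has_derivative_partial[OF assms(1)] g, unfolded o_def]
  show "partial i (\<lambda>y. g (f y)) = (\<lambda>y. g' (f y) * partial i f y)"
    by (rule ext, subst partial_eqI[OF D])
       (simp add: axis_def if_distrib if_distribR sum.delta cong: if_cong)
  show "(\<lambda>y. g (f y)) differentiable_on UNIV"
    using D by (rule has_derivative_imp_differentiable_on)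
qed

lemma partial_power:
  fixes f :: "real^3 \<Rightarrow> real"
  assumes "smooth f"
  shows "partial i (\<lambda>y. f y ^ n) = (\<lambda>y. of_nat n * f y ^ (n - 1) * partial i f y)"
  by (rule partial_chain[OF smooth_differentiable[OF assms]])
     (auto intro!: derivative_eq_intros)

text \<open>The outer function comes with the whole sequence \<open>H\<close> of its derivatives.
  Generalizing over \<open>n\<close> makes the factor produced by the chain rule an instance of the
  induction hypothesis, at \<open>Suc n\<close>.\<close>

lemma smooth_chain:
  fixes f :: "real^3 \<Rightarrow> real" and H :: "nat \<Rightarrow> real \<Rightarrow> real"
  assumes f: "smooth f" and H: "\<And>n x. (H n has_real_derivative H (Suc n) x) (at x)"
  shows "smooth (\<lambda>y. H n (f y))"
proof -
  have "C_k k (\<lambda>y. H n (f y))" for k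
  proof (induction k arbitrary: n)
    case 0
    have "isCont (H n) x" for x
      using H DERIV_isCont by blast
    then show ?case
      using smooth_continuous[OF f] continuous_on_compose2[of UNIV "H n" UNIV f]
      by (auto simp: continuous_on_eq_continuous_at)
  next
    case (Suc k)
    note P = partial_chain[OF smooth_differentiable[OF f] H]
    show ?case
      using P(2) Suc.IH smooth_C_k[OF smooth_partial[OF f]]
      by (auto simp: P(1) intro!: C_k_bilinear[OF bounded_bilinear_mult])
  qed
  then show ?thesis by (simp add: smooth_def)
qed

text \<open>The gradient of 1/f is the gradient of f times two copies of 1/f, so
  \<open>C_k k\<close> for 1/f already yields \<open>C_k (Suc k)\<close>.\<close>

lemma smooth_inverse:
  fixes f :: "real^3 \<Rightarrow> real"
  assumes f: "smooth f" and pos: "\<And>y. f y > 0"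
  shows "smooth (\<lambda>y. inverse (f y))"
proof -
  have D: "((\<lambda>y. inverse (f y)) has_derivative
      (\<lambda>h. - (inverse (f y) * (\<Sum>i\<in>UNIV. h $ i *\<^sub>R partial i f y) * inverse (f y)))) (at y)" for y
    using pos by (intro Deriv.has_derivative_inverse smooth_has_derivative[OF f]) (metis less_irrefl)
  have P: "partial i (\<lambda>y. inverse (f y))
      = (\<lambda>y. (- partial i f y) * (inverse (f y) * inverse (f y)))" for i
    by (rule ext, subst partial_eqI[OF D])
       (simp add: axis_def if_distrib if_distribR sum.delta cong: if_cong)
  have "C_k k (\<lambda>y. inverse (f y))" for k
  proof (induction k)
    case 0
    have "f y \<noteq> 0" for y using pos[of y] by simp
    then show ?case
      using smooth_continuous[OF f] by (auto intro!: continuous_on_inverse)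
  next
    case (Suc k)
    have "C_k k (partial i (\<lambda>y. inverse (f y)))" for i
      unfolding P
      by (intro C_k_bilinear[OF bounded_bilinear_mult] Suc.IH
          smooth_C_k[OF smooth_uminus[OF smooth_partial[OF f]]])
    then show ?case
      using has_derivative_imp_differentiable_on[OF D] by simp
  qed
  then show ?thesis by (simp add: smooth_def)
qed

lemma partial_vec_lambda:
  fixes f :: "3 \<Rightarrow> real^3 \<Rightarrow> real"
  assumes "\<And>j. f j differentiable_on UNIV"
  shows "partial i (\<lambda>y. \<chi> j. f j y) = (\<lambda>y. \<chi> j. partial i (f j) y)"
    and "(\<lambda>y. \<chi> j. f j y) differentiable_on UNIV"
proof -
  have D: "((\<lambda>y. \<chi> j. f j y) has_derivative (\<lambda>h. \<chi> j. \<Sum>i\<in>UNIV. h $ i *\<^sub>R partial i (f j) y)) (at y)"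
    for y
    by (rule has_derivative_componentwise_within[THEN iffD2])
       (auto simp: Basis_vec_def inner_axis simp del: real_scaleR_def intro: has_derivative_partial[OF assms])
  show "partial i (\<lambda>y. \<chi> j. f j y) = (\<lambda>y. \<chi> j. partial i (f j) y)"
    by (rule ext, subst partial_eqI[OF D])
       (simp add: axis_def if_distrib if_distribR sum.delta vec_eq_iff cong: if_cong)
  show "(\<lambda>y. \<chi> j. f j y) differentiable_on UNIV"
    using D by (rule has_derivative_imp_differentiable_on)
qed

lemma smooth_vec_lambda:
  fixes f :: "3 \<Rightarrow> real^3 \<Rightarrow> real"
  assumes "\<And>j. smooth (f j)"
  shows "smooth (\<lambda>y. \<chi> j. f j y)"
proof -
  have key: "C_k k (\<lambda>y. \<chi> j. f j y)" if "\<And>j. smooth (f j)" for k and f :: "3 \<Rightarrow> real^3 \<Rightarrow> real"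
    using that
  proof (induction k arbitrary: f)
    case 0
    then show ?case by (simp add: continuous_on_vec_lambda smooth_continuous)
  next
    case (Suc k)
    then show ?case
      using smooth_differentiable[OF Suc.prems] by (auto simp: partial_vec_lambda smooth_partial)
  qed
  show ?thesis unfolding smooth_def using key[OF assms] by simp
qed

lemma smooth_vec_nth: "smooth F \<Longrightarrow> smooth (\<lambda>y. F y $ i)"
  by (rule smooth_bounded_linear[OF bounded_linear_vec_nth])

section \<open>Cutoff functions\<close>

text \<open>All derivatives of exp(-1/x) have the form p(1/x) exp(-1/x); keeping the polynomial as a
  parameter gives a family closed under differentiation.\<close>

definition flat_poly :: "real poly \<Rightarrow> real \<Rightarrow> real" where
  "flat_poly p x = (if x > 0 then poly p (inverse x) * exp (- inverse x) else 0)"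

text \<open>The extra power \<open>t ^ k\<close> serves the induction over coefficients: the tail of
  \<open>pCons a p\<close> reappears with exponent \<open>Suc k\<close>.\<close>

lemma poly_div_exp_tendsto_0: "((\<lambda>t::real. t ^ k * poly p t / exp t) \<longlongrightarrow> 0) at_top"
proof (induction p arbitrary: k)
  case 0
  then show ?case by simp
next
  case (pCons a p)
  have "((\<lambda>t. a * (t ^ k / exp t) + t ^ Suc k * poly p t / exp t) \<longlongrightarrow> a * 0 + 0) at_top"
    by (intro tendsto_intros tendsto_power_div_exp_0 pCons.IH)
  moreover have "a * (t ^ k / exp t) + t ^ Suc k * poly p t / exp t
      = t ^ k * poly (pCons a p) t / exp t" for t
    by (simp add: field_simps)
  ultimately show ?case by simp
qed

text \<open>With t = 1/x one has dt/dx = - t^2, so p(t) exp(-t) has derivative t^2 (p - p')(t)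
  exp(-t); the factor \<open>[:0, 0, 1:]\<close> is t^2.\<close>

lemma flat_poly_DERIV:
  "(flat_poly p has_real_derivative flat_poly ([:0, 0, 1:] * (p - pderiv p)) x) (at x)"
proof -
  let ?q = "[:0, 0, 1:] * (p - pderiv p)"
  consider "x > 0" | "x < 0" | "x = 0" by linarith
  then show ?thesis
  proof cases
    case 1
    have "((\<lambda>x. poly p (inverse x) * exp (- inverse x)) has_real_derivative flat_poly ?q x) (at x)"
      using 1 by (auto intro!: derivative_eq_intros simp: flat_poly_def power2_eq_square algebra_simps)
    then show ?thesis
    proof (rule DERIV_cong_ev[OF refl _ refl, THEN iffD1, rotated])
      show "\<forall>\<^sub>F x in nhds x. poly p (inverse x) * exp (- inverse x) = flat_poly p x"
        using eventually_nhds_in_open[of "{0<..}" x] 1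
        by (auto elim!: eventually_mono simp: flat_poly_def)
    qed
  next
    case 2
    have "((\<lambda>x. 0) has_real_derivative flat_poly ?q x) (at x)"
      using 2 by (simp add: flat_poly_def)
    then show ?thesis
    proof (rule DERIV_cong_ev[OF refl _ refl, THEN iffD1, rotated])
      show "\<forall>\<^sub>F x in nhds x. 0 = flat_poly p x"
        using eventually_nhds_in_open[of "{..<0}" x] 2
        by (auto elim!: eventually_mono simp: flat_poly_def)
    qed
  next
    case 3
    \<comment> \<open>At 0 the difference quotient is 0 on the left; on the right it is t p(t) / exp
      t with t = 1/h, which tends to 0.\<close>
    have "((\<lambda>h. flat_poly p h / h) \<longlongrightarrow> 0) (at_left 0)"
      by (rule tendsto_eventually) (auto simp: eventually_at_filter flat_poly_def)
    moreover have "((\<lambda>h. flat_poly p h / h) \<longlongrightarrow> 0) (at_right 0)"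
    proof (rule Lim_transform_eventually)
      show "((\<lambda>h. inverse h ^ 1 * poly p (inverse h) / exp (inverse h)) \<longlongrightarrow> 0) (at_right 0)"
        by (rule filterlim_compose[OF poly_div_exp_tendsto_0 filterlim_inverse_at_top_right])
      show "\<forall>\<^sub>F h in at_right 0. inverse h ^ 1 * poly p (inverse h) / exp (inverse h)
          = flat_poly p h / h"
        by (auto simp: eventually_at_filter flat_poly_def exp_minus field_simps)
    qed
    ultimately have "((\<lambda>h. flat_poly p h / h) \<longlongrightarrow> 0) (at 0)"
      by (simp add: filterlim_at_split)
    then show ?thesis
      using 3 by (simp add: has_field_derivative_iff flat_poly_def)
  qed
qed

definition flat :: "real \<Rightarrow> real" where
  "flat x = (if x > 0 then exp (- inverse x) else 0)"

lemma smooth_flat: "smooth f \<Longrightarrow> smooth (\<lambda>y. flat (f y))"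
proof -
  assume f: "smooth f"
  \<comment> \<open>\<open>P n\<close> is the polynomial belonging to the n-th derivative of
    exp(-1/x).\<close>
  define P where "P = rec_nat 1 (\<lambda>_ p. [:0, 0, 1::real:] * (p - pderiv p))"
  have "smooth (\<lambda>y. flat_poly (P 0) (f y))"
    by (rule smooth_chain[OF f, of "\<lambda>n. flat_poly (P n)"]) (simp only: P_def rec_nat_Suc_imp flat_poly_DERIV)
  moreover have "flat_poly (P 0) = flat"
    by (auto simp: P_def flat_poly_def flat_def)
  ultimately show ?thesis by simp
qed

lemma flat_nonneg: "0 \<le> flat x" and flat_le_1: "flat x \<le> 1" and flat_zero: "x \<le> 0 \<Longrightarrow> flat x = 0"
  and flat_pos: "0 < x \<Longrightarrow> 0 < flat x"
  by (auto simp: flat_def)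

lemma continuous_on_flat: "continuous_on UNIV flat"
proof -
  have "isCont (flat_poly 1) x" for x
    using flat_poly_DERIV DERIV_isCont by blast
  moreover have "flat_poly 1 = flat"
    by (auto simp: flat_poly_def flat_def)
  ultimately show ?thesis by (simp add: continuous_on_eq_continuous_at)
qed

section \<open>A smooth transition between two constants\<close>

definition bump :: "real \<Rightarrow> real" where
  "bump t = flat (t - 1) * flat (2 - t)"

text \<open>Left unnormalized, so that the derivative is exactly \<open>bump\<close>, nonnegative
  and supported in [1, 2]; this sign drives the flux arguments. The plateau value is
  \<open>step 2\<close>.\<close>

definition step :: "real \<Rightarrow> real" where
  "step s = integral {0..s} bump"

lemma bump_nonneg: "0 \<le> bump t" and bump_le_1: "bump t \<le> 1"
  and bump_zero: "t \<le> 1 \<or> 2 \<le> t \<Longrightarrow> bump t = 0"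
  and bump_pos: "1 < t \<Longrightarrow> t < 2 \<Longrightarrow> 0 < bump t"
  by (auto simp: bump_def flat_nonneg flat_le_1 flat_zero flat_pos mult_le_one)

lemma continuous_on_bump: "continuous_on S bump"
  unfolding bump_def
  by (intro continuous_intros continuous_on_compose2[OF continuous_on_flat]) auto

lemma step_zero: "s \<le> 1 \<Longrightarrow> step s = 0"
  unfolding step_def by (subst integral_cong[where g = "\<lambda>_. 0"]) (auto simp: bump_zero)

lemma step_DERIV: "(step has_real_derivative bump s) (at s)"
proof (cases "s < 1")
  case True
  have "((\<lambda>x. 0) has_real_derivative bump s) (at s)"
    using True by (simp add: bump_zero)
  then show ?thesis
  proof (rule DERIV_cong_ev[OF refl _ refl, THEN iffD1, rotated])
    show "\<forall>\<^sub>F x in nhds s. 0 = step x"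
      using eventually_nhds_in_open[of "{..<1}" s] True
      by (auto elim!: eventually_mono simp: step_zero)
  qed
next
  case False
  \<comment> \<open>Here 1 \<le> s, so \<open>s\<close> is interior to \<open>{0..s + 1}\<close> and
    the derivative within the interval is a full derivative; below 1 the function vanishes.\<close>
  have "(step has_vector_derivative bump s) (at s within {0..s + 1})"
    unfolding step_def using False
    by (intro integral_has_vector_derivative continuous_on_bump) auto
  moreover have "at s within {0..s + 1} = at s"
    using False by (intro at_within_interior) auto
  ultimately show ?thesis
    by (simp add: has_real_derivative_iff_has_vector_derivative)
qed

lemma step_mono: "s \<le> t \<Longrightarrow> step s \<le> step t"
  by (rule DERIV_nonneg_imp_nondecreasing[of s t step]) (use step_DERIV bump_nonneg in blast)+

lemma step_nonneg: "0 \<le> step s"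
  using step_mono[of "min 1 s" s] by (simp add: step_zero)

lemma step_pos: "1 < s \<Longrightarrow> 0 < step s"
proof -
  assume s: "1 < s"
  have "step 1 < step (min s 2)"
  proof (rule DERIV_pos_imp_increasing_open[of 1 "min s 2" step])
    show "\<exists>y. (step has_real_derivative y) (at x) \<and> 0 < y" if "1 < x" "x < min s 2" for x
      using that step_DERIV bump_pos by force
    show "continuous_on {1..min s 2} step"
      using step_DERIV DERIV_isCont by (blast intro: continuous_at_imp_continuous_on)
  qed (use s in auto)
  then show ?thesis
    using step_mono[of "min s 2" s] step_nonneg[of 1] by linarith
qed

lemma step_const: "2 \<le> s \<Longrightarrow> step s = step 2"
proof -
  assume s: "2 \<le> s"
  have "step s = integral {0..2} bump + integral {2..s} bump"
    unfolding step_def using s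
    by (subst Henstock_Kurzweil_Integration.integral_combine)
       (auto intro!: integrable_continuous_real continuous_on_bump)
  also have "integral {2..s} bump = 0"
    by (subst integral_cong[where g = "\<lambda>_. 0"]) (auto simp: bump_zero)
  finally show ?thesis by (simp add: step_def)
qed

lemma step_le: "step s \<le> step 2"
  using step_mono[of s 2] step_const[of s] by linarith

lemma smooth_bump: "smooth f \<Longrightarrow> smooth (\<lambda>y. bump (f y))"
  unfolding bump_def by (intro smooth_mult smooth_flat smooth_diff smooth_const)

lemma partial_step: "smooth f \<Longrightarrow> partial i (\<lambda>y. step (f y)) = (\<lambda>y. bump (f y) * partial i f y)"
  by (rule partial_chain(1)[OF smooth_differentiable step_DERIV])

lemma smooth_step: "smooth f \<Longrightarrow> smooth (\<lambda>y. step (f y))"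
proof -
  assume f: "smooth f"
  show ?thesis
    by (subst smooth_iff)
       (auto simp: partial_step[OF f] intro!: smooth_mult smooth_bump f smooth_partial
         partial_chain(2)[OF smooth_differentiable[OF f] step_DERIV])
qed

section \<open>Test functions\<close>

text \<open>Vanishing outside a ball, instead of compactness of the closed support, passes to
  products, derivatives and convolutions by inspection; \<open>test_function_iff\<close> makes the
  link.\<close>

definition csupp :: "('a::real_normed_vector \<Rightarrow> 'b::zero) \<Rightarrow> bool" where
  "csupp f \<longleftrightarrow> (\<exists>R>0. \<forall>y. R \<le> norm y \<longrightarrow> f y = 0)"

lemma csuppI: "(\<And>y. R \<le> norm y \<Longrightarrow> f y = 0) \<Longrightarrow> csupp f"
  unfolding csupp_def by (rule exI[of _ "max R 1"]) auto

lemma csuppE: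
  assumes "csupp f" obtains R where "R > 0" "\<And>y. R \<le> norm y \<Longrightarrow> f y = 0"
  using assms by (auto simp: csupp_def)

lemma csupp_mono: "csupp f \<Longrightarrow> (\<And>y. f y = 0 \<Longrightarrow> g y = 0) \<Longrightarrow> csupp g"
  by (meson csuppE csuppI)

lemma csupp_sum2: "csupp f \<Longrightarrow> csupp g \<Longrightarrow> (\<And>y. f y = 0 \<Longrightarrow> g y = 0 \<Longrightarrow> h y = 0) \<Longrightarrow> csupp h"
proof -
  assume a: "csupp f" "csupp g" "\<And>y. f y = 0 \<Longrightarrow> g y = 0 \<Longrightarrow> h y = 0"
  obtain R where R: "\<And>y. R \<le> norm y \<Longrightarrow> f y = 0" using a(1) by (meson csuppE)
  obtain R' where R': "\<And>y. R' \<le> norm y \<Longrightarrow> g y = 0" using a(2) by (meson csuppE)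
  show ?thesis using R R' a(3) by (intro csuppI[of "max R R'"]) auto
qed

lemma test_function_iff:
  fixes f :: "real^3 \<Rightarrow> 'b::real_normed_vector"
  shows "test_function f \<longleftrightarrow> smooth f \<and> csupp f"
proof -
  have "bounded {y. f y \<noteq> 0} \<longleftrightarrow> csupp f"
  proof
    assume "bounded {y. f y \<noteq> 0}"
    then obtain B where "\<And>y. f y \<noteq> 0 \<Longrightarrow> norm y \<le> B" by (auto simp: bounded_iff)
    then have "f y = 0" if "B + 1 \<le> norm y" for y
      using that by (metis add_le_same_cancel1 not_one_le_zero order_trans)
    then show "csupp f" by (rule csuppI)
  next
    assume "csupp f"
    then obtain R where "\<And>y. R \<le> norm y \<Longrightarrow> f y = 0" by (meson csuppE)
    then show "bounded {y. f y \<noteq> 0}"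
      unfolding bounded_iff by (metis (mono_tags, lifting) linear mem_Collect_eq)
  qed
  then show ?thesis
    by (simp add: test_function_def smooth_def support_on_def)
qed

text \<open>Strictness of \<open>R < norm y\<close> provides a neighbourhood on which
  \<open>f\<close> vanishes. For this reason supports of derivatives are later enclosed in radius
  \<open>R + 1\<close>.\<close>

lemma partial_zero_outside:
  assumes "\<And>y. R \<le> norm y \<Longrightarrow> f y = 0" "R < norm y"
  shows "partial i f y = 0"
proof -
  have "open {y::real^3. R < norm y}"
    by (rule open_Collect_less) (auto intro: continuous_intros)
  then have "(f has_derivative (\<lambda>h. 0)) (at y)"
    by (rule has_derivative_transform_within_open[OF has_derivative_const[of 0]])
       (use assms in auto)
  then show ?thesis by (simp add: partial_eqI)
qed

lemma csupp_partial: "csupp f \<Longrightarrow> csupp (partial i f)"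
proof -
  assume "csupp f"
  then obtain R where R: "\<And>y. R \<le> norm y \<Longrightarrow> f y = 0" by (meson csuppE)
  show ?thesis
    by (rule csuppI[of "R + 1"], rule partial_zero_outside[of R]) (use R in auto)
qed

section \<open>Integration by parts\<close>

lemma integrable_bounded_csupp:
  fixes f :: "'a::euclidean_space \<Rightarrow> real"
  assumes "f \<in> borel_measurable borel" "\<And>y. \<bar>f y\<bar> \<le> M" "\<And>y. R < norm y \<Longrightarrow> f y = 0"
  shows "integrable lborel f"
proof (rule Bochner_Integration.integrable_bound[where f = "\<lambda>y. M * indicator (cball 0 R) y"])
  show "integrable lborel (\<lambda>y::'a. M * indicator (cball 0 R) y)"
    by (intro integrable_mult_right integrable_real_indicator emeasure_lborel_cball_finite) simp
  show "AE y in lborel. norm (f y) \<le> norm (M * indicator (cball 0 R) y)"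
    using assms(2,3) by (auto simp: indicator_def not_le intro!: order_trans[OF assms(2) abs_ge_self])
qed (use assms in simp)

lemma continuous_csupp_bounded:
  fixes f :: "'a::euclidean_space \<Rightarrow> real"
  assumes "continuous_on UNIV f" "csupp f"
  obtains M where "\<And>y. \<bar>f y\<bar> \<le> M" "M \<ge> 0"
proof -
  obtain R where R: "R > 0" "\<And>y. R \<le> norm y \<Longrightarrow> f y = 0" using csuppE[OF assms(2)] by blast
  have "bounded (f ` cball 0 R)"
    using assms(1) by (intro compact_imp_bounded compact_continuous_image)
      (auto intro: continuous_on_subset)
  then obtain M where "\<forall>x\<in>f ` cball 0 R. norm x \<le> M" unfolding bounded_iff ..
  then have M: "\<bar>f y\<bar> \<le> M" if "norm y \<le> R" for y using that by simp
  moreover have "M \<ge> 0" using M[of 0] R by auto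
  ultimately have "\<bar>f y\<bar> \<le> M" for y using R(2)[of y] by (cases "norm y \<le> R") auto
  then show thesis using that \<open>M \<ge> 0\<close> by blast
qed

lemma integrable_csupp:
  fixes f :: "'a::euclidean_space \<Rightarrow> real"
  assumes "continuous_on UNIV f" "csupp f"
  shows "integrable lborel f"
proof -
  obtain M where "\<And>y. \<bar>f y\<bar> \<le> M" using continuous_csupp_bounded[OF assms] by blast
  moreover obtain R where "\<And>y. R \<le> norm y \<Longrightarrow> f y = 0" using csuppE[OF assms(2)] by blast
  ultimately show ?thesis
    using assms(1) by (intro integrable_bounded_csupp[of f M R]) (auto intro: borel_measurable_continuous_onI)
qed

section \<open>Invariance of Lebesgue measure under translations, dilations and isometries\<close>

lemma lborel_integral_shift:
  fixes f :: "'a::euclidean_space \<Rightarrow> real"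
  assumes "f \<in> borel_measurable borel"
  shows "(LINT y|lborel. f (y + h)) = (LINT y|lborel. f y)"
proof -
  have "(LINT y|lborel. f y) = (LINT y|distr lborel borel ((+) h). f y)"
    by (simp add: lborel_distr_plus)
  also have "\<dots> = (LINT y|lborel. f (y + h))"
    using assms by (subst integral_distr) (auto simp: add.commute)
  finally show ?thesis by simp
qed

lemma lborel_integral_scale:
  fixes f :: "real^3 \<Rightarrow> real"
  assumes "f \<in> borel_measurable borel" "c \<noteq> 0"
  shows "(LINT y|lborel. f y) = \<bar>c\<bar> ^ 3 * (LINT y|lborel. f (c *\<^sub>R y))"
proof -
  have "(LINT y|lborel. f y)
      = (LINT y|density (distr lborel borel (\<lambda>x. 0 + c *\<^sub>R x)) (\<lambda>_. ennreal (\<bar>c\<bar> ^ DIM(real^3))). f y)"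
    using lborel_affine[OF assms(2), of "0::real^3"] by simp
  also have "\<dots> = (LINT y|distr lborel borel (\<lambda>x. 0 + c *\<^sub>R x). (\<bar>c\<bar> ^ 3) *\<^sub>R f y)"
    using assms by (subst integral_density) auto
  also have "\<dots> = (LINT y|lborel. (\<bar>c\<bar> ^ 3) *\<^sub>R f (c *\<^sub>R y))"
    using assms by (subst integral_distr) auto
  finally show ?thesis by simp
qed

lemma lborel_integral_uminus:
  fixes f :: "real^3 \<Rightarrow> real"
  shows "f \<in> borel_measurable borel \<Longrightarrow> (LINT y|lborel. f (- y)) = (LINT y|lborel. f y)"
  using lborel_integral_scale[of f "-1"] by simp

lemma lborel_integral_reflect:
  fixes f :: "real^3 \<Rightarrow> real"
  assumes [measurable]: "f \<in> borel_measurable borel"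
  shows "(LINT y|lborel. f (x - y)) = (LINT y|lborel. f y)"
  using lborel_integral_uminus[of "\<lambda>y. f (x + y)"] lborel_integral_shift[of f x]
  by (simp add: add.commute)

text \<open>Lebesgue measure on Borel sets is determined by its values on boxes, and the preimage of
  a box is its image under the inverse isometry, to which the invariance of the completed measure
  applies.\<close>

lemma lborel_distr_orthogonal:
  fixes T :: "real^3 \<Rightarrow> real^3"
  assumes T: "orthogonal_transformation T"
  shows "distr lborel borel T = lborel"
proof (rule lborel_eqI[symmetric])
  fix l u :: "real^3"
  assume lu: "\<And>b. b \<in> Basis \<Longrightarrow> l \<bullet> b \<le> u \<bullet> b"
  obtain S where S: "orthogonal_transformation S" "\<And>x. S (T x) = x" "\<And>x. T (S x) = x"
    using T orthogonal_transformation_inv orthogonal_transformation_bij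
    by (metis bij_inv_eq_iff)
  have [measurable]: "T \<in> borel_measurable borel"
    using orthogonal_transformation_linear[OF T]
    by (intro borel_measurable_continuous_onI linear_continuous_on) (simp add: linear_conv_bounded_linear)
  have pre: "T -` box l u = S ` box l u"
  proof (intro set_eqI iffI)
    fix x assume "x \<in> T -` box l u"
    then show "x \<in> S ` box l u" using S(2)[of x] by (metis imageI vimageD)
  qed (auto simp: S(3))
  have m: "T -` box l u \<in> sets borel"
    using measurable_sets_borel[of T borel "box l u"] by simp
  have "emeasure (distr lborel borel T) (box l u) = emeasure lborel (T -` box l u)"
    by (simp add: emeasure_distr)
  also have "\<dots> = emeasure lebesgue (S ` box l u)"
    using m pre by simp
  also have "\<dots> = emeasure lebesgue (box l u)"
    using measurable_orthogonal_image[OF S(1)] measure_orthogonal_image[OF S(1)]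
    by (simp add: emeasure_eq_measure2 lmeasurable_box)
  also have "\<dots> = (\<Prod>b\<in>Basis. (u - l) \<bullet> b)"
    using lu by simp
  finally show "emeasure (distr lborel borel T) (box l u) = (\<Prod>b\<in>Basis. (u - l) \<bullet> b)" .
qed simp

lemma lborel_integral_orthogonal:
  fixes T :: "real^3 \<Rightarrow> real^3" and f :: "real^3 \<Rightarrow> real"
  assumes T: "orthogonal_transformation T" and f: "f \<in> borel_measurable borel"
  shows "(LINT y|lborel. f (T y)) = (LINT y|lborel. f y)"
proof -
  have [measurable]: "T \<in> borel_measurable borel"
    using orthogonal_transformation_linear[OF T]
    by (intro borel_measurable_continuous_onI linear_continuous_on) (simp add: linear_conv_bounded_linear)
  have "(LINT y|lborel. f y) = (LINT y|distr lborel borel T. f y)"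
    by (simp add: lborel_distr_orthogonal[OF T])
  also have "\<dots> = (LINT y|lborel. f (T y))"
    using f by (subst integral_distr) auto
  finally show ?thesis by simp
qed

section \<open>Integration by parts from averages over segments\<close>

lemma lborel_Fubini:
  fixes F :: "'a::euclidean_space \<times> 'b::euclidean_space \<Rightarrow> real"
  assumes "integrable lborel F"
  shows "(LINT x|lborel. LINT y|lborel. F (x, y)) = (LINT y|lborel. LINT x|lborel. F (x, y))"
    and "integrable lborel (\<lambda>x. LINT y|lborel. F (x, y))"
    and "integrable lborel (\<lambda>y. LINT x|lborel. F (x, y))"
proof -
  have F: "integrable (lborel \<Otimes>\<^sub>M lborel) F"
    using assms by (simp add: lborel_prod)
  then have F': "integrable (lborel \<Otimes>\<^sub>M lborel) (case_prod (\<lambda>x y. F (x, y)))" by simp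
  show "(LINT x|lborel. LINT y|lborel. F (x, y)) = (LINT y|lborel. LINT x|lborel. F (x, y))"
    using lborel_pair.Fubini_integral[OF F'] by simp
  show "integrable lborel (\<lambda>x. LINT y|lborel. F (x, y))"
    using lborel_pair.integrable_fst[OF F'] by simp
  show "integrable lborel (\<lambda>y. LINT x|lborel. F (x, y))"
    using lborel_pair.integrable_snd[OF F'] by simp
qed

text \<open>By Fubini: for fixed \<open>t\<close> the translate by \<open>t *\<^sub>R h\<close> has
  the integral of \<open>g\<close>, and \<open>t\<close> runs through an interval of length 1.
  Together with \<open>smooth_FTC\<close> this turns integrals of differences into integrals of
  derivatives.\<close>

lemma segment_average:
  fixes g :: "real^3 \<Rightarrow> real"
  assumes "continuous_on UNIV g" "csupp g"
  shows "(LINT x|lborel. LINT t|lborel. indicator {0..1} t * g (x + t *\<^sub>R h)) = (LINT x|lborel. g x)"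
    and "integrable lborel (\<lambda>x. LINT t|lborel. indicator {0..1::real} t * g (x + t *\<^sub>R h))"
proof -
  let ?F = "\<lambda>(x, t). indicator {0..1::real} t * g (x + t *\<^sub>R h)"
  obtain R where R: "R > 0" "\<And>y. R \<le> norm y \<Longrightarrow> g y = 0" using csuppE[OF assms(2)] by blast
  obtain M where M: "\<And>y. \<bar>g y\<bar> \<le> M" "M \<ge> 0" using continuous_csupp_bounded[OF assms] by blast
  have gm[measurable]: "g \<in> borel_measurable borel"
    using assms(1) by (rule borel_measurable_continuous_onI)
  have F: "integrable lborel ?F"
  proof (rule integrable_bounded_csupp[where M = M and R = "1 + R + norm h"])
    show "?F \<in> borel_measurable borel"
      unfolding split_beta' borel_prod[symmetric] by measurable
    show "\<bar>?F y\<bar> \<le> M" for y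
      using M by (auto simp: indicator_def split: prod.split)
    show "?F y = 0" if "1 + R + norm h < norm y" for y
    proof (cases y)
      case (Pair x t)
      have "norm y \<le> norm x + \<bar>t\<bar>"
        using Pair norm_Pair_le[of x t] by simp
      moreover have "norm x \<le> norm (x + t *\<^sub>R h) + \<bar>t\<bar> * norm h"
        using norm_triangle_ineq4[of "x + t *\<^sub>R h" "t *\<^sub>R h"] by simp
      moreover have "\<bar>t\<bar> * norm h \<le> norm h" if "t \<in> {0..1}"
        using that mult_right_mono[of t 1 "norm h"] by auto
      ultimately have "R \<le> norm (x + t *\<^sub>R h)" if "t \<in> {0..1}"
        using that \<open>1 + R + norm h < norm y\<close> by auto
      then show ?thesis
        using Pair R(2) by (auto simp: indicator_def)
    qed
  qed
  note Fub = lborel_Fubini[OF F, unfolded prod.case]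
  show "integrable lborel (\<lambda>x. LINT t|lborel. indicator {0..1::real} t * g (x + t *\<^sub>R h))"
    using Fub(2) .
  have "(LINT x|lborel. LINT t|lborel. indicator {0..1} t * g (x + t *\<^sub>R h))
      = (LINT t|lborel. indicator {0..1::real} t * (LINT x|lborel. g (x + t *\<^sub>R h)))"
    using Fub(1) by simp
  also have "\<dots> = (LINT t|lborel. indicator {0..1::real} t) * (LINT x|lborel. g x)"
    by (simp add: lborel_integral_shift[OF gm])
  finally show "(LINT x|lborel. LINT t|lborel. indicator {0..1} t * g (x + t *\<^sub>R h)) = (LINT x|lborel. g x)"
    by simp
qed

lemma smooth_FTC:
  fixes f :: "real^3 \<Rightarrow> real"
  assumes f: "smooth f"
  shows "f (x + h) - f x
      = (\<Sum>i\<in>UNIV. h $ i * (LINT t|lborel. indicator {0..1} t * partial i f (x + t *\<^sub>R h)))"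
proof -
  have D: "((\<lambda>t. f (x + t *\<^sub>R h)) has_real_derivative
      (\<Sum>i\<in>UNIV. h $ i * partial i f (x + t *\<^sub>R h))) (at t)" for t
  proof -
    have "((\<lambda>t. x + t *\<^sub>R h) has_derivative (\<lambda>s. s *\<^sub>R h)) (at t)"
      by (auto intro!: derivative_eq_intros)
    from diff_chain_at[OF this smooth_has_derivative[OF f]]
    have "((\<lambda>t. f (x + t *\<^sub>R h)) has_derivative
        (\<lambda>s. \<Sum>i\<in>UNIV. (s *\<^sub>R h) $ i *\<^sub>R partial i f (x + t *\<^sub>R h))) (at t)"
      by (simp only: o_def)
    moreover have "(\<lambda>s. \<Sum>i\<in>UNIV. (s *\<^sub>R h) $ i *\<^sub>R partial i f (x + t *\<^sub>R h))
        = (*) (\<Sum>i\<in>UNIV. h $ i * partial i f (x + t *\<^sub>R h))"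
      by (rule ext) (simp add: sum_distrib_left mult_ac)
    ultimately show ?thesis
      by (simp only: has_field_derivative_def)
  qed
  have c: "continuous_on S (\<lambda>t. partial i f (x + t *\<^sub>R h))" for i S
    by (rule continuous_on_compose2[OF smooth_continuous[OF smooth_partial[OF f]]])
       (auto intro!: continuous_intros)
  have int: "integrable lborel (\<lambda>t. indicator {0..1::real} t * partial i f (x + t *\<^sub>R h))" for i
    using borel_integrable_compact[of "{0..1}", OF _ c] by simp
  have "f (x + 1 *\<^sub>R h) - f (x + 0 *\<^sub>R h)
      = (LINT t|lborel. indicator {0..1} t *\<^sub>R (\<Sum>i\<in>UNIV. h $ i * partial i f (x + t *\<^sub>R h)))"
    by (rule integral_FTC_Icc[symmetric])
       (use D in \<open>auto intro!: continuous_intros c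
          simp: has_real_derivative_iff_has_vector_derivative has_vector_derivative_at_within\<close>)
  also have "\<dots> = (LINT t|lborel. (\<Sum>i\<in>UNIV. h $ i * (indicator {0..1} t * partial i f (x + t *\<^sub>R h))))"
    by (simp add: sum_distrib_left mult_ac)
  also have "\<dots> = (\<Sum>i\<in>UNIV. h $ i * (LINT t|lborel. indicator {0..1} t * partial i f (x + t *\<^sub>R h)))"
    by (subst Bochner_Integration.integral_sum) (auto intro!: integrable_mult_right int simp del: mult_eq_0_iff)
  finally show ?thesis by simp
qed

text \<open>The average of D_i f over a unit segment in direction i is f(x + e_i) - f(x), and by
  translation invariance both terms have the same integral.\<close>

lemma integral_partial_eq_0:
  fixes f :: "real^3 \<Rightarrow> real"
  assumes "smooth f" "csupp f"
  shows "(LINT x|lborel. partial i f x) = 0"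
proof -
  have int: "integrable lborel f"
    using assms by (intro integrable_csupp smooth_continuous)
  have fm: "f \<in> borel_measurable borel"
    using assms(1) by (intro borel_measurable_continuous_onI smooth_continuous)
  have "(LINT x|lborel. partial i f x)
      = (LINT x|lborel. LINT t|lborel. indicator {0..1} t * partial i f (x + t *\<^sub>R axis i 1))"
    using assms by (intro segment_average(1)[symmetric] csupp_partial smooth_continuous smooth_partial)
  also have "\<dots> = (LINT x|lborel. f (x + axis i 1) - f x)"
    by (simp add: smooth_FTC[OF assms(1)] axis_def if_distrib if_distribR sum.delta cong: if_cong)
  also have "\<dots> = (LINT x|lborel. f (x + axis i 1)) - (LINT x|lborel. f x)"
  proof (rule Bochner_Integration.integral_diff[OF _ int])
    obtain R where R: "\<And>y. R \<le> norm y \<Longrightarrow> f y = 0" using csuppE[OF assms(2)] by blast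
    have "csupp (\<lambda>x. f (x + axis i 1))"
    proof (rule csuppI[of "R + 1"])
      fix y :: "real^3" assume "R + 1 \<le> norm y"
      moreover have "norm y \<le> norm (y + axis i 1) + 1"
        using norm_triangle_ineq4[of "y + axis i 1" "axis i 1"] by (simp add: norm_axis_1)
      ultimately show "f (y + axis i 1) = 0" by (intro R) simp
    qed
    then show "integrable lborel (\<lambda>x. f (x + axis i 1))"
      by (intro integrable_csupp continuous_on_compose2[OF smooth_continuous[OF assms(1)]])
         (auto intro!: continuous_intros)
  qed
  also have "\<dots> = 0"
    by (simp add: lborel_integral_shift[OF fm])
  finally show ?thesis .
qed

lemma integration_by_parts:
  fixes f g :: "real^3 \<Rightarrow> real"
  assumes f: "smooth f" and g: "smooth g" and c: "csupp g"
  shows "(LINT x|lborel. f x * partial i g x) = - (LINT x|lborel. partial i f x * g x)"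
proof -
  have "(LINT x|lborel. f x * partial i g x + partial i f x * g x) = 0"
    using integral_partial_eq_0[OF smooth_mult[OF f g], of i] partial_mult[OF f g, of i] c
    by (simp add: csupp_mono[OF c])
  moreover have "integrable lborel (\<lambda>x. f x * partial i g x)"
    by (intro integrable_csupp)
      (auto intro!: smooth_continuous[OF smooth_mult] smooth_partial f g
        intro: csupp_mono[OF csupp_partial[OF c]])
  moreover have "integrable lborel (\<lambda>x. partial i f x * g x)"
    by (intro integrable_csupp)
      (auto intro!: smooth_continuous[OF smooth_mult] smooth_partial f g intro: csupp_mono[OF c])
  ultimately show ?thesis by (simp add: Bochner_Integration.integral_add)
qed

text \<open>Averaging the gradient along the segment leaves its L^1 norm unchanged. This is how
  gradient bounds become a linear modulus of continuity.\<close>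

lemma integral_shift_diff_le:
  fixes f :: "real^3 \<Rightarrow> real"
  assumes f: "smooth f" "csupp f"
  shows "(LINT x|lborel. \<bar>f (x + h) - f x\<bar>) \<le> norm h * (\<Sum>i\<in>UNIV. LINT x|lborel. \<bar>partial i f x\<bar>)"
proof -
  let ?A = "\<lambda>i x. LINT t|lborel. indicator {0..1} t * \<bar>partial i f (x + t *\<^sub>R h)\<bar>"
  have c: "continuous_on UNIV (\<lambda>x. \<bar>partial i f x\<bar>)" for i
    by (intro continuous_intros smooth_continuous smooth_partial f)
  have cs: "csupp (\<lambda>x. \<bar>partial i f x\<bar>)" for i
    using csupp_partial[OF f(2), of i] by (rule csupp_mono) simp
  note A = segment_average[OF c cs]
  have "\<bar>f (x + h) - f x\<bar> \<le> (\<Sum>i\<in>UNIV. norm h * ?A i x)" for x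
  proof -
    have "\<bar>LINT t|lborel. indicator {0..1} t * partial i f (x + t *\<^sub>R h)\<bar> \<le> ?A i x" for i
      using integral_norm_bound[of lborel "\<lambda>t. indicator {0..1} t * partial i f (x + t *\<^sub>R h)"]
      by (simp add: abs_mult)
    then have "\<bar>h $ i * (LINT t|lborel. indicator {0..1} t * partial i f (x + t *\<^sub>R h))\<bar> \<le> norm h * ?A i x" for i
      unfolding abs_mult by (intro mult_mono component_le_norm_cart) auto
    then show ?thesis
      unfolding smooth_FTC[OF f(1)] by (intro order_trans[OF sum_abs] sum_mono)
  qed
  then have "(LINT x|lborel. \<bar>f (x + h) - f x\<bar>) \<le> (LINT x|lborel. (\<Sum>i\<in>UNIV. norm h * ?A i x))"
    by (intro integral_mono' Bochner_Integration.integrable_sum integrable_mult_right A)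
       (auto intro: order_trans[OF abs_ge_zero])
  also have "\<dots> = norm h * (\<Sum>i\<in>UNIV. LINT x|lborel. ?A i x)"
    by (subst Bochner_Integration.integral_sum)
       (auto intro!: integrable_mult_right A simp: sum_distrib_left simp del: mult_eq_0_iff)
  finally show ?thesis by (simp add: A)
qed

section \<open>Convolution and mollifiers\<close>

lemma has_derivative_affine:
  fixes f :: "real^3 \<Rightarrow> 'b::real_normed_vector"
  assumes "f differentiable_on UNIV"
  shows "((\<lambda>y. f (x + c *\<^sub>R y)) has_derivative
     (\<lambda>h. \<Sum>i\<in>UNIV. h $ i *\<^sub>R c *\<^sub>R partial i f (x + c *\<^sub>R y))) (at y)"
proof -
  have "((\<lambda>y. x + c *\<^sub>R y) has_derivative (\<lambda>h. c *\<^sub>R h)) (at y)"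
    by (auto intro!: derivative_eq_intros)
  from diff_chain_at[OF this has_derivative_partial[OF assms]] show ?thesis
    by (simp add: o_def mult.commute)
qed

lemma partial_affine:
  fixes f :: "real^3 \<Rightarrow> 'b::real_normed_vector"
  assumes "f differentiable_on UNIV"
  shows "partial i (\<lambda>y. f (x + c *\<^sub>R y)) = (\<lambda>y. c *\<^sub>R partial i f (x + c *\<^sub>R y))"
  by (rule ext, subst partial_eqI[OF has_derivative_affine[OF assms]])
     (simp add: axis_def if_distrib if_distribR sum.delta cong: if_cong)

lemma smooth_affine:
  fixes f :: "real^3 \<Rightarrow> 'b::real_normed_vector"
  assumes "smooth f"
  shows "smooth (\<lambda>y. f (x + c *\<^sub>R y))"
proof -
  have "C_k k (\<lambda>y. f (x + c *\<^sub>R y))" if "smooth f" for k and f :: "real^3 \<Rightarrow> 'b"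
    using that
  proof (induction k arbitrary: f)
    case 0
    then show ?case
      by (auto intro!: continuous_on_compose2[OF smooth_continuous] continuous_intros)
  next
    case (Suc k)
    note d = smooth_differentiable[OF Suc.prems]
    have "(\<lambda>y. f (x + c *\<^sub>R y)) differentiable_on UNIV"
      by (rule has_derivative_imp_differentiable_on[OF has_derivative_affine[OF d]])
    moreover have "C_k k (partial i (\<lambda>y. f (x + c *\<^sub>R y)))" for i
      unfolding partial_affine[OF d]
      by (intro C_k_bounded_linear[OF bounded_linear_scaleR_right] Suc.IH smooth_partial Suc.prems)
    ultimately show ?case by simp
  qed
  with assms show ?thesis by (simp add: smooth_def)
qed

lemma csupp_affine:
  fixes f :: "'a::real_normed_vector \<Rightarrow> 'b::zero"
  shows "csupp f \<Longrightarrow> c \<noteq> 0 \<Longrightarrow> csupp (\<lambda>y. f (x + c *\<^sub>R y))"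
proof -
  assume "csupp f" and c: "c \<noteq> 0"
  then obtain R where R: "\<And>y. R \<le> norm y \<Longrightarrow> f y = 0" by (meson csuppE)
  show ?thesis
  proof (rule csuppI[of "(R + norm x) / \<bar>c\<bar>"])
    fix y :: 'a assume "(R + norm x) / \<bar>c\<bar> \<le> norm y"
    then have "R + norm x \<le> norm (c *\<^sub>R y)"
      using c by (simp add: field_simps)
    then show "f (x + c *\<^sub>R y) = 0"
      using norm_triangle_ineq4[of "x + c *\<^sub>R y" x] by (intro R) simp
  qed
qed

lemma csupp_reflect:
  fixes f :: "'a::real_normed_vector \<Rightarrow> 'b::zero"
  shows "csupp f \<Longrightarrow> csupp (\<lambda>y. f (x - y))"
  using csupp_affine[of f "-1" x] by simp

lemma smooth_reflect: "smooth f \<Longrightarrow> smooth (\<lambda>y. f (x - y))"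
  using smooth_affine[of f x "-1"] by simp

lemma partial_reflect: "smooth f \<Longrightarrow> partial i (\<lambda>y. f (x - y)) = (\<lambda>y. - partial i f (x - y))"
  using partial_affine[OF smooth_differentiable, of f i x "-1"] by simp

section \<open>Derivatives, adjoints and supports of convolutions\<close>

definition conv :: "(real^3 \<Rightarrow> real) \<Rightarrow> (real^3 \<Rightarrow> real) \<Rightarrow> real^3 \<Rightarrow> real" where
  "conv \<rho> f x = (LINT y|lborel. \<rho> (x - y) * f y)"

lemma conv_kernel:
  fixes \<rho> f :: "real^3 \<Rightarrow> real"
  assumes "continuous_on UNIV \<rho>" "csupp \<rho>" "continuous_on UNIV f"
  shows "continuous_on UNIV (\<lambda>y. \<rho> (x - y) * f y)" "csupp (\<lambda>y. \<rho> (x - y) * f y)"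
    and "integrable lborel (\<lambda>y. \<rho> (x - y) * f y)"
proof -
  show c: "continuous_on UNIV (\<lambda>y. \<rho> (x - y) * f y)"
    by (intro continuous_intros continuous_on_compose2[OF assms(1)] assms) auto
  show s: "csupp (\<lambda>y. \<rho> (x - y) * f y)"
    by (rule csupp_mono[OF csupp_reflect[OF assms(2), of x]]) simp
  show "integrable lborel (\<lambda>y. \<rho> (x - y) * f y)"
    using c s by (rule integrable_csupp)
qed

lemma conv_commute:
  fixes \<rho> f :: "real^3 \<Rightarrow> real"
  assumes "continuous_on UNIV \<rho>" "continuous_on UNIV f"
  shows "conv \<rho> f x = (LINT k|lborel. \<rho> k * f (x - k))"
proof -
  have "(\<lambda>k. \<rho> k * f (x - k)) \<in> borel_measurable borel"
    by (intro borel_measurable_continuous_onI continuous_intros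
        continuous_on_compose2[OF assms(2)] assms) auto
  from lborel_integral_reflect[OF this, of x] show ?thesis
    by (simp add: conv_def)
qed

text \<open>For x in the unit ball about \<open>x0\<close> the integrand lives in one fixed box, so
  differentiation under the integral over a compact box suffices.\<close>

lemma conv_has_derivative:
  fixes \<rho> f :: "real^3 \<Rightarrow> real"
  assumes \<rho>: "smooth \<rho>" "csupp \<rho>" and f: "continuous_on UNIV f"
  shows "(conv \<rho> f has_derivative (\<lambda>h. \<Sum>i\<in>UNIV. h $ i * conv (partial i \<rho>) f x0)) (at x0)"
proof -
  obtain R where R: "\<And>y. R \<le> norm y \<Longrightarrow> \<rho> y = 0" using csuppE[OF \<rho>(2)] by blast
  \<comment> \<open>The kernel has radius \<open>R\<close> and \<open>x\<close> moves by less than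
    1, whence the radius \<open>norm x0 + 1 + R\<close>.\<close>
  obtain a where a: "cball 0 (norm x0 + 1 + R) \<subseteq> cbox (-a) (a::real^3)"
    using bounded_subset_cbox_symmetric[OF bounded_cball] by blast
  have out: "\<rho> (x - y) = 0" if "x \<in> ball x0 1" "y \<notin> cbox (-a) a" for x y
  proof (rule R)
    have "norm y > norm x0 + 1 + R" using a that(2) by (meson mem_cball_0 not_le subsetD)
    moreover have "norm x < norm x0 + 1"
      using that(1) norm_triangle_ineq2[of x x0] by (simp add: dist_norm norm_minus_commute)
    ultimately show "R \<le> norm (x - y)"
      using norm_triangle_ineq2[of y x] by (simp add: norm_minus_commute)
  qed
  define G where "G z = (\<chi> i. partial i \<rho> z)" for z
  have G: "continuous_on UNIV G"
    unfolding G_def by (intro continuous_on_vec_lambda smooth_continuous smooth_partial \<rho>)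
  \<comment> \<open>The derivative is packaged as the inner product with the gradient of the kernel:
    a continuous family of bounded linear maps, as the Leibniz rule demands.\<close>
  define D where "D x t = blinfun_inner_right (f t *\<^sub>R G (x - t))" for x t
  have Dh: "blinfun_apply (D x t) h = (\<Sum>i\<in>UNIV. h $ i * (partial i \<rho> (x - t) * f t))" for x t h
    by (simp add: D_def G_def inner_vec_def sum_distrib_left mult_ac)
  have eq: "conv \<rho> f x = integral (cbox (-a) a) (\<lambda>y. \<rho> (x - y) * f y)" if "x \<in> ball x0 1" for x
  proof -
    have "conv \<rho> f x = integral UNIV (\<lambda>y. \<rho> (x - y) * f y)"
      unfolding conv_def
      by (intro integral_lborel[symmetric] conv_kernel smooth_continuous \<rho> f)
    also have "\<dots> = integral UNIV (\<lambda>y. if y \<in> cbox (-a) a then \<rho> (x - y) * f y else 0)"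
      by (intro integral_cong) (auto simp: out[OF that])
    finally show ?thesis by (simp only: integral_restrict_UNIV)
  qed
  have eq': "conv (partial i \<rho>) f x0 = integral (cbox (-a) a) (\<lambda>y. partial i \<rho> (x0 - y) * f y)" for i
  proof -
    have "partial i \<rho> (x0 - y) = 0" if "y \<notin> cbox (-a) a" for y
    proof (rule partial_zero_outside[of R])
      have "norm y > norm x0 + 1 + R" using a that by (meson mem_cball_0 not_le subsetD)
      then show "R < norm (x0 - y)"
        using norm_triangle_ineq2[of y x0] by (simp add: norm_minus_commute)
    qed (use R in auto)
    then have "integral UNIV (\<lambda>y. partial i \<rho> (x0 - y) * f y)
        = integral UNIV (\<lambda>y. if y \<in> cbox (-a) a then partial i \<rho> (x0 - y) * f y else 0)"
      by (intro integral_cong) auto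
    then show ?thesis
      unfolding conv_def integral_restrict_UNIV
      by (subst integral_lborel[symmetric])
         (auto intro!: conv_kernel smooth_continuous csupp_partial smooth_partial \<rho> f)
  qed
  have ker: "continuous_on S (\<lambda>y. g (x - y) * f y)" if "continuous_on UNIV g" for g x S
    by (intro continuous_intros continuous_on_compose2[OF that] continuous_on_subset[OF f]) auto
  have "((\<lambda>x. integral (cbox (-a) a) (\<lambda>y. \<rho> (x - y) * f y)) has_derivative
      integral (cbox (-a) a) (D x0)) (at x0 within ball x0 1)"
  proof (rule leibniz_rule)
    fix x t assume "x \<in> ball x0 1" "t \<in> cbox (-a) a"
    have "((\<lambda>x. \<rho> (x - t)) has_derivative (\<lambda>h. \<Sum>i\<in>UNIV. h $ i *\<^sub>R partial i \<rho> (x - t))) (at x)"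
      using has_derivative_affine[OF smooth_differentiable[OF \<rho>(1)], of "-t" 1 x] by simp
    then have "((\<lambda>x. \<rho> (x - t) * f t) has_derivative
        (\<lambda>h. (\<Sum>i\<in>UNIV. h $ i *\<^sub>R partial i \<rho> (x - t)) * f t)) (at x)"
      by (rule has_derivative_mult_left)
    moreover have "(\<lambda>h. (\<Sum>i\<in>UNIV. h $ i *\<^sub>R partial i \<rho> (x - t)) * f t) = blinfun_apply (D x t)"
      by (rule ext) (simp add: Dh sum_distrib_left mult_ac)
    ultimately show "((\<lambda>x. \<rho> (x - t) * f t) has_derivative blinfun_apply (D x t)) (at x within ball x0 1)"
      by (simp add: has_derivative_at_withinI)
  next
    fix x assume "x \<in> ball x0 1"
    show "(\<lambda>y. \<rho> (x - y) * f y) integrable_on cbox (-a) a"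
      by (intro integrable_continuous ker smooth_continuous \<rho>)
  next
    have "continuous_on (ball x0 1 \<times> cbox (-a) a) (\<lambda>p. blinfun_inner_right (f (snd p) *\<^sub>R G (fst p - snd p)))"
      by (intro bounded_linear.continuous_on[OF bounded_linear_blinfun_inner_right] continuous_intros
          continuous_on_compose2[OF G] continuous_on_compose2[OF f]) auto
    then show "continuous_on (ball x0 1 \<times> cbox (-a) a) (\<lambda>(x, t). D x t)"
      by (simp add: D_def split_beta')
  qed auto
  then have "((\<lambda>x. integral (cbox (-a) a) (\<lambda>y. \<rho> (x - y) * f y)) has_derivative
      integral (cbox (-a) a) (D x0)) (at x0)"
    by (simp add: at_within_open[of x0 "ball x0 1"])
  moreover have "blinfun_apply (integral (cbox (-a) a) (D x0))
      = (\<lambda>h. \<Sum>i\<in>UNIV. h $ i * conv (partial i \<rho>) f x0)"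
  proof (rule ext)
    fix h
    have "D x0 integrable_on cbox (-a) a"
      unfolding D_def
      by (intro integrable_continuous bounded_linear.continuous_on[OF bounded_linear_blinfun_inner_right]
          continuous_intros continuous_on_compose2[OF G] continuous_on_subset[OF f]) auto
    then have "blinfun_apply (integral (cbox (-a) a) (D x0)) h
        = integral (cbox (-a) a) (\<lambda>t. \<Sum>i\<in>UNIV. h $ i * (partial i \<rho> (x0 - t) * f t))"
      by (simp add: blinfun_apply_integral Dh)
    also have "\<dots> = (\<Sum>i\<in>UNIV. integral (cbox (-a) a) (\<lambda>t. h $ i * (partial i \<rho> (x0 - t) * f t)))"
      by (intro integral_sum integrable_continuous continuous_intros ker
          smooth_continuous smooth_partial \<rho>) auto
    finally show "blinfun_apply (integral (cbox (-a) a) (D x0)) h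
        = (\<Sum>i\<in>UNIV. h $ i * conv (partial i \<rho>) f x0)"
      by (simp add: eq')
  qed
  ultimately have "((\<lambda>x. integral (cbox (-a) a) (\<lambda>y. \<rho> (x - y) * f y)) has_derivative
      (\<lambda>h. \<Sum>i\<in>UNIV. h $ i * conv (partial i \<rho>) f x0)) (at x0)"
    by simp
  then show ?thesis
    by (rule has_derivative_transform_within_open[OF _ open_ball[of x0 1]]) (auto simp: eq)
qed

lemma partial_conv:
  assumes "smooth \<rho>" "csupp \<rho>" "continuous_on UNIV f"
  shows "partial i (conv \<rho> f) = conv (partial i \<rho>) f"
  by (rule ext, subst partial_eqI[OF conv_has_derivative[OF assms]])
     (simp add: axis_def if_distrib if_distribR sum.delta cong: if_cong)

lemma smooth_conv:
  assumes "smooth \<rho>" "csupp \<rho>" and f: "continuous_on UNIV f"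
  shows "smooth (conv \<rho> f)"
proof -
  have "C_k k (conv \<rho> f)" if "smooth \<rho>" "csupp \<rho>" for k \<rho>
    using that
  proof (induction k arbitrary: \<rho>)
    case 0
    show ?case
      using differentiable_imp_continuous_on[OF
          has_derivative_imp_differentiable_on[OF conv_has_derivative[OF 0 f]]] by simp
  next
    case (Suc k)
    then show ?case
      using has_derivative_imp_differentiable_on[OF conv_has_derivative[OF Suc.prems f]]
      by (simp add: partial_conv[OF Suc.prems f] smooth_partial csupp_partial)
  qed
  with assms show ?thesis by (simp add: smooth_def)
qed

text \<open>Exchanging the order of integration moves the convolution to the other factor, with the
  kernel reflected.\<close>

lemma conv_Fubini:
  fixes \<rho> f g :: "real^3 \<Rightarrow> real"
  assumes \<rho>: "continuous_on UNIV \<rho>" "csupp \<rho>" and f: "continuous_on UNIV f"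
    and g: "continuous_on UNIV g" "csupp g"
  shows "(LINT x|lborel. conv \<rho> f x * g x) = (LINT y|lborel. f y * conv (\<lambda>k. \<rho> (- k)) g y)"
proof -
  obtain R where R: "R > 0" "\<And>y. R \<le> norm y \<Longrightarrow> \<rho> y = 0" using csuppE[OF \<rho>(2)] by blast
  obtain R' where R': "R' > 0" "\<And>y. R' \<le> norm y \<Longrightarrow> g y = 0" using csuppE[OF g(2)] by blast
  let ?F = "\<lambda>p. \<rho> (fst p - snd p) * f (snd p) * g (fst p)"
  have "integrable lborel ?F"
  proof (rule integrable_csupp)
    show "continuous_on UNIV ?F"
      by (intro continuous_intros continuous_on_compose2[OF \<rho>(1)] continuous_on_compose2[OF f]
          continuous_on_compose2[OF g(1)]) auto
    show "csupp ?F"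
    proof (rule csuppI[of "2 * R' + R"])
      fix p :: "(real^3) \<times> (real^3)" assume p: "2 * R' + R \<le> norm p"
      \<comment> \<open>On the support |x| < R' and |x - y| < R, so |(x, y)| \<le> 2 |x| + |x - y| <
        2 R' + R.\<close>
      have "norm p \<le> norm (fst p) + norm (snd p)"
        using norm_Pair_le[of "fst p" "snd p"] by simp
      moreover have "norm (snd p) \<le> norm (fst p) + norm (fst p - snd p)"
        using norm_triangle_ineq2[of "snd p" "fst p"] by (simp add: norm_minus_commute)
      ultimately have "R' \<le> norm (fst p) \<or> R \<le> norm (fst p - snd p)"
        using p by linarith
      then show "?F p = 0" using R R' by auto
    qed
  qed
  from lborel_Fubini(1)[OF this]
  have "(LINT x|lborel. LINT y|lborel. \<rho> (x - y) * f y * g x)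
      = (LINT y|lborel. LINT x|lborel. \<rho> (x - y) * f y * g x)"
    by simp
  moreover have "(LINT y|lborel. \<rho> (x - y) * f y * g x) = conv \<rho> f x * g x" for x
    unfolding conv_def by (rule integral_mult_left_zero)
  moreover have "(LINT x|lborel. \<rho> (x - y) * f y * g x) = f y * conv (\<lambda>k. \<rho> (- k)) g y" for y
  proof -
    have "(LINT x|lborel. \<rho> (x - y) * f y * g x) = (LINT x|lborel. f y * (\<rho> (- (y - x)) * g x))"
      by (simp add: mult_ac)
    also have "\<dots> = f y * conv (\<lambda>k. \<rho> (- k)) g y"
      unfolding conv_def by (rule integral_mult_right_zero)
    finally show ?thesis .
  qed
  ultimately show ?thesis by (simp only:)
qed

lemma conv_local:
  assumes "\<And>y. \<epsilon> \<le> norm y \<Longrightarrow> \<rho> y = 0" "\<And>y. norm (x - y) < \<epsilon> \<Longrightarrow> f y = 0"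
  shows "conv \<rho> f x = 0"
proof -
  have z: "\<rho> (x - y) * f y = 0" for y
    using assms by (cases "norm (x - y) < \<epsilon>") auto
  show ?thesis by (simp only: conv_def z Bochner_Integration.integral_zero)
qed

lemma csupp_conv:
  assumes "csupp \<rho>" "csupp f"
  shows "csupp (conv \<rho> f)"
proof -
  obtain R where R: "R > 0" "\<And>y. R \<le> norm y \<Longrightarrow> \<rho> y = 0" using csuppE[OF assms(1)] by blast
  obtain R' where R': "R' > 0" "\<And>y. R' \<le> norm y \<Longrightarrow> f y = 0" using csuppE[OF assms(2)] by blast
  show ?thesis
  proof (rule csuppI[of "R + R'"], rule conv_local[OF R(2)], assumption, rule R'(2))
    fix x y :: "real^3" assume "R + R' \<le> norm x" "norm (x - y) < R"
    then show "R' \<le> norm y" using norm_triangle_ineq2[of x y] by linarith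
  qed
qed

text \<open>A nonnegative function with zero integral vanishes off a null set, and the set where a
  continuous function is nonzero is open; an open null set is empty. This converts integral
  inequalities into pointwise vanishing.\<close>

lemma integral_nonpos_imp_zero:
  fixes f :: "'a::euclidean_space \<Rightarrow> real"
  assumes c: "continuous_on UNIV f" and s: "csupp f" and nn: "\<And>y. 0 \<le> f y"
    and le: "(LINT y|lborel. f y) \<le> 0"
  shows "f y = 0"
proof (rule ccontr)
  assume y: "f y \<noteq> 0"
  have "(LINT y|lborel. f y) = 0"
    using le Bochner_Integration.integral_nonneg[of lborel f] nn by (simp add: order_antisym)
  then have "AE y in lborel. f y = 0"
    using integral_nonneg_eq_0_iff_AE[OF integrable_csupp[OF c s]] nn by simp
  then have "AE y in lebesgue. f y = 0"
    by (rule AE_completion)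
  then have "negligible {y. f y \<noteq> 0}"
    unfolding eventually_ae_filter_negligible by (blast intro: negligible_subset)
  moreover have "open {y. f y \<noteq> 0}"
    using c by (intro open_Collect_neq) auto
  ultimately show False
    using y open_not_negligible by blast
qed

section \<open>Radial mollifiers of unit mass\<close>

lemma smooth_norm_sq: "smooth (\<lambda>y::real^3. y \<bullet> y)"
  unfolding inner_vec_def by (intro smooth_sum) (simp add: smooth_mult smooth_component)

lemma partial_norm_sq: "partial i (\<lambda>y::real^3. y \<bullet> y) = (\<lambda>y. 2 * y $ i)"
proof
  fix y :: "real^3"
  have "((\<lambda>y::real^3. y \<bullet> y) has_derivative (\<lambda>h. y \<bullet> h + h \<bullet> y)) (at y)"
    by (auto intro!: derivative_eq_intros)
  from partial_eqI[OF this, of i] show "partial i (\<lambda>y::real^3. y \<bullet> y) y = 2 * y $ i"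
    by (simp add: inner_axis inner_axis')
qed

text \<open>Radial symmetry serves twice: the kernel is even, so that convolution is self-adjoint,
  and axisymmetry is preserved. \<open>C\<close> is kept apart from \<epsilon> so that the growth
  1/\<epsilon> of the gradient in L^1 can be balanced against a linear modulus of
  continuity.\<close>

definition mollifier :: "real \<Rightarrow> real \<Rightarrow> (real^3 \<Rightarrow> real) \<Rightarrow> bool" where
  "mollifier C \<epsilon> \<rho> \<longleftrightarrow> smooth \<rho> \<and> (\<forall>y. \<epsilon> \<le> norm y \<longrightarrow> \<rho> y = 0) \<and> (\<forall>y. 0 \<le> \<rho> y)
     \<and> (\<forall>y z. norm y = norm z \<longrightarrow> \<rho> y = \<rho> z) \<and> (LINT y|lborel. \<rho> y) = 1
     \<and> (\<forall>i. (LINT y|lborel. \<bar>partial i \<rho> y\<bar>) \<le> C / \<epsilon>)"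

text \<open>The kernel is k(y/\<epsilon>) / (c \<epsilon>^3) for one fixed bump k of mass c: the
  volume factor restores the mass, and a derivative costs 1/\<epsilon> in L^1. Summing over the
  derivatives of k gives one \<open>C\<close> for all directions.\<close>

lemma mollifier_exists: "\<exists>C. \<forall>\<epsilon>>0. \<exists>\<rho>. mollifier C \<epsilon> \<rho>"
proof -
  define k :: "real^3 \<Rightarrow> real" where "k y = flat (1 - y \<bullet> y)" for y
  have sm: "smooth k"
    unfolding k_def by (intro smooth_flat smooth_diff smooth_const smooth_norm_sq)
  have k0: "k y = 0" if "1 \<le> norm y" for y
  proof -
    have "1 \<le> y \<bullet> y" using that by (simp add: dot_square_norm one_le_power)
    then show ?thesis by (simp add: k_def flat_zero)
  qed
  then have cs: "csupp k" by (rule csuppI)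
  have cont: "continuous_on UNIV k" using sm by (rule smooth_continuous)
  define c where "c = (LINT y|lborel. k y)"
  have "c \<noteq> 0"
  proof
    assume "c = 0"
    then have "k 0 = 0"
      by (intro integral_nonpos_imp_zero[OF cont cs]) (auto simp: c_def k_def flat_nonneg)
    then show False by (simp add: k_def flat_def)
  qed
  moreover have "c \<ge> 0" unfolding c_def by (intro Bochner_Integration.integral_nonneg) (simp add: k_def flat_nonneg)
  ultimately have c: "c > 0" by simp
  define C where "C = (\<Sum>i\<in>UNIV. LINT y|lborel. \<bar>partial i k y\<bar>) / c"
  have "mollifier C \<epsilon> (\<lambda>y. 1 / (c * \<epsilon> ^ 3) * k (0 + (1 / \<epsilon>) *\<^sub>R y))" if \<epsilon>: "\<epsilon> > 0" for \<epsilon>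
    unfolding mollifier_def
  proof (intro conjI allI impI)
    have sm': "smooth (\<lambda>y. k (0 + (1 / \<epsilon>) *\<^sub>R y))"
      by (rule smooth_affine[OF sm])
    show "smooth (\<lambda>y. 1 / (c * \<epsilon> ^ 3) * k (0 + (1 / \<epsilon>) *\<^sub>R y))"
      by (rule smooth_cmult[OF sm'])
    show "1 / (c * \<epsilon> ^ 3) * k (0 + (1 / \<epsilon>) *\<^sub>R y) = 0" if "\<epsilon> \<le> norm y" for y
      using that \<epsilon> by (subst k0) (auto simp: field_simps)
    show "0 \<le> 1 / (c * \<epsilon> ^ 3) * k (0 + (1 / \<epsilon>) *\<^sub>R y)" for y
      using c \<epsilon> by (simp add: k_def flat_nonneg)
    show "1 / (c * \<epsilon> ^ 3) * k (0 + (1 / \<epsilon>) *\<^sub>R y) = 1 / (c * \<epsilon> ^ 3) * k (0 + (1 / \<epsilon>) *\<^sub>R z)"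
      if "norm y = norm z" for y z
      using that by (simp add: k_def dot_square_norm power_mult_distrib)
    have scale: "(LINT y|lborel. g (0 + (1 / \<epsilon>) *\<^sub>R y)) = \<epsilon> ^ 3 * (LINT y|lborel. g y)"
      if "continuous_on UNIV g" for g :: "real^3 \<Rightarrow> real"
      using lborel_integral_scale[of g "1 / \<epsilon>"] that \<epsilon>
      by (simp add: borel_measurable_continuous_onI field_simps)
    show "(LINT y|lborel. 1 / (c * \<epsilon> ^ 3) * k (0 + (1 / \<epsilon>) *\<^sub>R y)) = 1"
      using scale[OF cont] c \<epsilon> by (simp add: c_def)
    fix i
    let ?I = "LINT y|lborel. \<bar>partial i k y\<bar>"
    have "(LINT y|lborel. \<bar>partial i (\<lambda>y. 1 / (c * \<epsilon> ^ 3) * k (0 + (1 / \<epsilon>) *\<^sub>R y)) y\<bar>)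
        = (LINT y|lborel. (1 / (c * \<epsilon> ^ 3) / \<epsilon>) * \<bar>partial i k (0 + (1 / \<epsilon>) *\<^sub>R y)\<bar>)"
      using c \<epsilon>
      by (subst partial_cmult[OF sm'], subst partial_affine[OF smooth_differentiable[OF sm]])
         (simp add: abs_mult)
    also have "\<dots> = ?I / c / \<epsilon>"
      using scale[of "\<lambda>y. \<bar>partial i k y\<bar>"] c \<epsilon>
      by (simp add: continuous_intros smooth_continuous smooth_partial sm)
    also have "?I \<le> (\<Sum>i\<in>UNIV. LINT y|lborel. \<bar>partial i k y\<bar>)"
      by (rule member_le_sum) (auto intro!: Bochner_Integration.integral_nonneg)
    finally show "(LINT y|lborel. \<bar>partial i (\<lambda>y. 1 / (c * \<epsilon> ^ 3) * k (0 + (1 / \<epsilon>) *\<^sub>R y)) y\<bar>) \<le> C / \<epsilon>"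
      using c \<epsilon> by (simp add: C_def divide_right_mono)
  qed
  then show ?thesis by blast
qed

lemma mollifierD:
  assumes "mollifier C \<epsilon> \<rho>"
  shows "smooth \<rho>" "csupp \<rho>" "continuous_on UNIV \<rho>" "\<And>y. \<epsilon> \<le> norm y \<Longrightarrow> \<rho> y = 0"
    "\<And>y. \<rho> (- y) = \<rho> y" "\<And>i. (LINT y|lborel. \<bar>partial i \<rho> y\<bar>) \<le> C / \<epsilon>"
proof -
  show "smooth \<rho>" "\<And>y. \<epsilon> \<le> norm y \<Longrightarrow> \<rho> y = 0" "\<And>i. (LINT y|lborel. \<bar>partial i \<rho> y\<bar>) \<le> C / \<epsilon>"
    using assms unfolding mollifier_def by blast+
  then show "csupp \<rho>" "continuous_on UNIV \<rho>"
    by (blast intro: csuppI smooth_continuous)+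
  show "\<rho> (- y) = \<rho> y" for y
    using assms unfolding mollifier_def by (metis norm_minus_cancel)
qed

text \<open>\<open>conv \<rho> f x\<close> averages \<open>f\<close> over the ball of radius
  \<epsilon> about \<open>x\<close>, with nonnegative weights of total mass 1, and inherits any
  bound valid there.\<close>

lemma conv_near:
  assumes \<rho>: "mollifier C \<epsilon> \<rho>" and f: "continuous_on UNIV f"
    and near: "\<And>y. norm (x - y) < \<epsilon> \<Longrightarrow> \<bar>f y - c\<bar> \<le> \<eta>"
  shows "\<bar>conv \<rho> f x - c\<bar> \<le> \<eta>"
proof -
  note D = mollifierD[OF \<rho>]
  have int: "integrable lborel (\<lambda>y. \<rho> (x - y) * g y)" if "continuous_on UNIV g" for g
    using D that by (intro conv_kernel)
  have one: "(LINT y|lborel. \<rho> (x - y)) = 1"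
    using lborel_integral_reflect[OF borel_measurable_continuous_onI[OF D(3)], of x] \<rho>
    unfolding mollifier_def by linarith
  have "conv \<rho> f x - c = (LINT y|lborel. \<rho> (x - y) * f y) - (LINT y|lborel. \<rho> (x - y) * c)"
    by (simp add: conv_def one)
  also have "\<dots> = (LINT y|lborel. \<rho> (x - y) * f y - \<rho> (x - y) * c)"
    by (intro Bochner_Integration.integral_diff[symmetric] int f continuous_intros)
  finally have eq: "conv \<rho> f x - c = (LINT y|lborel. \<rho> (x - y) * (f y - c))"
    by (simp add: algebra_simps)
  have "\<bar>conv \<rho> f x - c\<bar> \<le> (LINT y|lborel. \<bar>\<rho> (x - y) * (f y - c)\<bar>)"
    unfolding eq using integral_norm_bound[of lborel "\<lambda>y. \<rho> (x - y) * (f y - c)"] by simp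
  also have "\<dots> \<le> (LINT y|lborel. \<rho> (x - y) * \<eta>)"
  proof (rule integral_mono)
    show "integrable lborel (\<lambda>y. \<bar>\<rho> (x - y) * (f y - c)\<bar>)"
      by (intro integrable_abs int continuous_intros f)
    show "integrable lborel (\<lambda>y. \<rho> (x - y) * \<eta>)"
      by (intro int continuous_intros)
    fix y
    show "\<bar>\<rho> (x - y) * (f y - c)\<bar> \<le> \<rho> (x - y) * \<eta>"
    proof (cases "norm (x - y) < \<epsilon>")
      case True
      moreover have "0 \<le> \<rho> (x - y)"
        using \<rho> unfolding mollifier_def by blast
      ultimately show ?thesis
        using near by (simp add: abs_mult mult_left_mono)
    qed (simp add: D(4))
  qed
  also have "\<dots> = \<eta>" by (simp add: one)
  finally show ?thesis .
qed

lemma conv_tendsto: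
  assumes \<rho>: "\<And>n. mollifier C (1 / real (Suc n)) (\<rho> n)" and f: "continuous_on UNIV f"
  shows "(\<lambda>n. conv (\<rho> n) f x) \<longlonglongrightarrow> f x"
proof (rule LIMSEQ_I)
  fix e :: real assume "e > 0"
  then obtain d where d: "d > 0" "\<And>y. dist y x < d \<Longrightarrow> dist (f y) (f x) < e / 2"
    using f[unfolded continuous_on_iff, rule_format, of x "e / 2"] by auto
  obtain N where N: "1 / real (Suc N) < d"
    using d(1) nat_approx_posE by blast
  have "norm (conv (\<rho> n) f x - f x) < e" if "N \<le> n" for n
  proof -
    have "1 / real (Suc n) \<le> 1 / real (Suc N)"
      using that by (simp add: frac_le)
    then have "\<bar>conv (\<rho> n) f x - f x\<bar> \<le> e / 2"
      using d(2) N by (intro conv_near[OF \<rho> f])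
        (force simp: dist_norm norm_minus_commute intro!: less_imp_le)
    then show ?thesis using \<open>e > 0\<close> by simp
  qed
  then show "\<exists>N. \<forall>n\<ge>N. norm (conv (\<rho> n) f x - f x) < e" by blast
qed

section \<open>Regularity of fields with continuous divergence and curl\<close>

lemma DERIV_along_axis:
  fixes f :: "real^3 \<Rightarrow> real"
  assumes "smooth f"
  shows "((\<lambda>s. f (a + s *\<^sub>R axis i 1)) has_real_derivative partial i f (a + s *\<^sub>R axis i 1)) (at s)"
proof -
  have "((\<lambda>s. a + s *\<^sub>R axis i 1) has_derivative (\<lambda>t. t *\<^sub>R axis i 1)) (at s)"
    by (auto intro!: derivative_eq_intros)
  from diff_chain_at[OF this smooth_has_derivative[OF assms]] show ?thesis
    by (simp add: o_def has_field_derivative_def axis_def if_distrib if_distribR sum.delta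
        mult_commute_abs cong: if_cong)
qed

text \<open>The mean value theorem is applied twice, first in direction i to the increment in
  direction j, then in direction j. The second difference is visibly symmetric in i and j, which the
  iterated derivative is not.\<close>

lemma mixed_difference:
  fixes f :: "real^3 \<Rightarrow> real"
  assumes f: "smooth f" and h: "h > 0"
  obtains p where "dist p x \<le> 2 * h"
    "f (x + h *\<^sub>R axis i 1 + h *\<^sub>R axis j 1) - f (x + h *\<^sub>R axis i 1) - f (x + h *\<^sub>R axis j 1) + f x
      = h * (h * partial j (partial i f) p)"
proof -
  let ?i = "axis i 1 :: real^3" and ?j = "axis j 1 :: real^3"
  define u where "u s = f (x + h *\<^sub>R ?j + s *\<^sub>R ?i) - f (x + s *\<^sub>R ?i)" for s
  have "(u has_real_derivative partial i f (x + h *\<^sub>R ?j + s *\<^sub>R ?i) - partial i f (x + s *\<^sub>R ?i)) (at s)" for s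
    unfolding u_def by (intro DERIV_diff DERIV_along_axis f)
  from MVT2[OF h this] obtain s where s: "0 < s" "s < h"
    "u h - u 0 = h * (partial i f (x + h *\<^sub>R ?j + s *\<^sub>R ?i) - partial i f (x + s *\<^sub>R ?i))"
    by auto
  have "((\<lambda>t. partial i f (x + s *\<^sub>R ?i + t *\<^sub>R ?j)) has_real_derivative
      partial j (partial i f) (x + s *\<^sub>R ?i + t *\<^sub>R ?j)) (at t)" for t
    by (intro DERIV_along_axis smooth_partial f)
  from MVT2[OF h this] obtain t where t: "0 < t" "t < h"
    "partial i f (x + s *\<^sub>R ?i + h *\<^sub>R ?j) - partial i f (x + s *\<^sub>R ?i)
      = h * partial j (partial i f) (x + s *\<^sub>R ?i + t *\<^sub>R ?j)"
    by auto
  have "norm (s *\<^sub>R ?i + t *\<^sub>R ?j) \<le> s + t"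
    using norm_triangle_ineq[of "s *\<^sub>R ?i" "t *\<^sub>R ?j"] s t by (simp add: norm_axis_1)
  then have "dist (x + s *\<^sub>R ?i + t *\<^sub>R ?j) x \<le> 2 * h"
    using s t by (simp add: dist_norm)
  then show thesis
    using that s(3) t(3) by (simp add: u_def algebra_simps)
qed

text \<open>One and the same second difference, divided by h^2, is a value of either mixed
  derivative near \<open>x\<close>; continuity forces them to agree.\<close>

lemma partial_partial_commute:
  fixes f :: "real^3 \<Rightarrow> real"
  assumes f: "smooth f"
  shows "partial i (partial j f) x = partial j (partial i f) x"
proof (rule ccontr)
  let ?A = "partial i (partial j f)" and ?B = "partial j (partial i f)"
  assume "?A x \<noteq> ?B x"
  define e where "e = \<bar>?A x - ?B x\<bar> / 2"
  have e: "e > 0" using \<open>?A x \<noteq> ?B x\<close> by (simp add: e_def)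
  have c: "isCont ?A x" "isCont ?B x"
    using smooth_continuous[OF smooth_partial[OF smooth_partial[OF f]]]
    by (auto simp: continuous_on_eq_continuous_at)
  obtain d1 where d1: "d1 > 0" "\<And>p. dist p x < d1 \<Longrightarrow> dist (?A p) (?A x) < e"
    using c(1) e unfolding continuous_at_eps_delta by blast
  obtain d2 where d2: "d2 > 0" "\<And>p. dist p x < d2 \<Longrightarrow> dist (?B p) (?B x) < e"
    using c(2) e unfolding continuous_at_eps_delta by blast
  \<comment> \<open>The intermediate points lie within 2 h of \<open>x\<close>, so a third of the
    smaller radius suffices.\<close>
  define h where "h = min d1 d2 / 3"
  have h: "h > 0" "2 * h < d1" "2 * h < d2" using d1 d2 by (auto simp: h_def)
  obtain p where p: "dist p x \<le> 2 * h"
    "f (x + h *\<^sub>R axis i 1 + h *\<^sub>R axis j 1) - f (x + h *\<^sub>R axis i 1) - f (x + h *\<^sub>R axis j 1) + f x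
      = h * (h * ?B p)"
    using mixed_difference[OF f h(1)] by blast
  obtain q where q: "dist q x \<le> 2 * h"
    "f (x + h *\<^sub>R axis j 1 + h *\<^sub>R axis i 1) - f (x + h *\<^sub>R axis j 1) - f (x + h *\<^sub>R axis i 1) + f x
      = h * (h * ?A q)"
    using mixed_difference[OF f h(1)] by blast
  have "h * (h * ?B p) = h * (h * ?A q)"
    unfolding p(2)[symmetric] q(2)[symmetric] by (simp add: algebra_simps)
  then have "?B p = ?A q" using h(1) by simp
  moreover have "\<bar>?A q - ?A x\<bar> < e" "\<bar>?B p - ?B x\<bar> < e"
    using d1(2)[of q] d2(2)[of p] h p(1) q(1) by (auto simp: dist_real_def)
  moreover have "\<bar>?A x - ?B x\<bar> \<le> \<bar>?A q - ?A x\<bar> + \<bar>?A q - ?B x\<bar>"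
    using abs_triangle_ineq4[of "?A q - ?B x" "?A q - ?A x"] by simp
  ultimately show False unfolding e_def by simp
qed

section \<open>The energy identity between gradient, divergence and curl\<close>

lemma integral_partial_swap:
  fixes f g :: "real^3 \<Rightarrow> real"
  assumes f: "smooth f" and g: "smooth g" "csupp g"
  shows "(LINT x|lborel. partial i f x * partial j g x) = (LINT x|lborel. partial j f x * partial i g x)"
  by (simp add: integration_by_parts smooth_partial f g partial_partial_commute[OF f, of i j])

lemma integrable_smooth_mult:
  fixes f g :: "real^3 \<Rightarrow> real"
  assumes "smooth f" "smooth g" "csupp g"
  shows "integrable lborel (\<lambda>x. f x * g x)"
  by (intro integrable_csupp smooth_continuous smooth_mult assms csupp_mono[OF assms(3)]) simp

text \<open>Expanding the squares leaves the mixed products D_i F_j D_j F_i from the curl and D_i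
  F_i D_j F_j from the divergence. Two integrations by parts show that these have the same integral,
  so they cancel; the factor 1/2 compensates for counting each pair twice.\<close>

lemma energy_identity:
  fixes F :: "3 \<Rightarrow> real^3 \<Rightarrow> real"
  assumes F: "\<And>j. smooth (F j)" "\<And>j. csupp (F j)"
  shows "(LINT x|lborel. (\<Sum>i\<in>UNIV. \<Sum>j\<in>UNIV. (partial i (F j) x)\<^sup>2))
    = (LINT x|lborel. (\<Sum>i\<in>UNIV. partial i (F i) x)\<^sup>2
        + (1 / 2) * (\<Sum>i\<in>UNIV. \<Sum>j\<in>UNIV. (partial i (F j) x - partial j (F i) x)\<^sup>2))"
proof -
  define P where "P i j k l = (LINT x|lborel. partial i (F j) x * partial k (F l) x)" for i j k l
  have int: "integrable lborel (\<lambda>x. partial i (F j) x * partial k (F l) x)" for i j k l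
    by (intro integrable_smooth_mult smooth_partial csupp_partial F)
  have swap: "P i j k l = P k j i l" for i j k l
    unfolding P_def by (intro integral_partial_swap F)
  have sym: "P i j k l = P k l i j" for i j k l
    unfolding P_def by (simp add: mult.commute)
  have "(LINT x|lborel. (\<Sum>i\<in>UNIV. \<Sum>j\<in>UNIV. (partial i (F j) x)\<^sup>2)) = (\<Sum>i\<in>UNIV. \<Sum>j\<in>UNIV. P i j i j)"
    unfolding P_def power2_eq_square
    by (simp add: Bochner_Integration.integral_sum Bochner_Integration.integrable_sum int)
  moreover have "(LINT x|lborel. (\<Sum>i\<in>UNIV. partial i (F i) x)\<^sup>2
        + (1 / 2) * (\<Sum>i\<in>UNIV. \<Sum>j\<in>UNIV. (partial i (F j) x - partial j (F i) x)\<^sup>2))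
    = (LINT x|lborel. (\<Sum>i\<in>UNIV. \<Sum>j\<in>UNIV. partial i (F i) x * partial j (F j) x)
        + (1 / 2) * (\<Sum>i\<in>UNIV. \<Sum>j\<in>UNIV. partial i (F j) x * partial i (F j) x
            - 2 * (partial i (F j) x * partial j (F i) x) + partial j (F i) x * partial j (F i) x))"
    by (intro Bochner_Integration.integral_cong refl arg_cong2[where f = "(+)"] arg_cong2[where f = "(*)"] sum.cong)
       (simp_all add: power2_eq_square sum_product algebra_simps)
  moreover have "\<dots> = (\<Sum>i\<in>UNIV. \<Sum>j\<in>UNIV. P i i j j)
      + (1 / 2) * (\<Sum>i\<in>UNIV. \<Sum>j\<in>UNIV. P i j i j - 2 * P i j j i + P j i j i)"
    unfolding P_def
    by (simp add: Bochner_Integration.integral_sum Bochner_Integration.integrable_sum int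
        Bochner_Integration.integral_add Bochner_Integration.integral_diff)
  moreover have "P i j j i = P i i j j" for i j
    using swap[of i j j i] sym[of j j i i] by simp
  moreover have "(\<Sum>i\<in>UNIV. \<Sum>j\<in>UNIV. P j i j i) = (\<Sum>i\<in>UNIV. \<Sum>j\<in>UNIV. P i j i j)"
    by (rule sum.swap)
  ultimately show ?thesis
    by (simp add: sum.distrib sum_subtractf sum_distrib_left[symmetric] diff_divide_distrib)
qed

section \<open>Uniform bounds for cut-off mollified fields\<close>

lemma cutoff_exists:
  assumes "R > 0"
  obtains \<zeta> :: "real^3 \<Rightarrow> real" where "smooth \<zeta>" "csupp \<zeta>" "\<And>y. 0 \<le> \<zeta> y" "\<And>y. \<zeta> y \<le> 1"
    "\<And>y. norm y \<le> R \<Longrightarrow> \<zeta> y = 1"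
proof
  \<comment> \<open>The argument of \<open>step\<close> is at least 2 for |y| \<le> R, where the
    plateau is reached, and at most 1 for |y| \<ge> 2 R, where \<open>step\<close> vanishes.\<close>
  define \<zeta> :: "real^3 \<Rightarrow> real" where "\<zeta> y = 1 / step 2 * step (3 - 1 / R\<^sup>2 * (y \<bullet> y))" for y
  have s2: "step 2 > 0" by (simp add: step_pos)
  show "smooth \<zeta>"
    unfolding \<zeta>_def
    by (intro smooth_cmult smooth_step smooth_diff smooth_const smooth_norm_sq)
  show "csupp \<zeta>"
  proof (rule csuppI[of "2 * R"])
    fix y :: "real^3" assume "2 * R \<le> norm y"
    then have "(2 * R)\<^sup>2 \<le> y \<bullet> y"
      using assms power_mono[of "2 * R" "norm y" 2] by (simp add: dot_square_norm)
    then have "4 \<le> 1 / R\<^sup>2 * (y \<bullet> y)"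
      using assms by (simp add: field_simps power_mult_distrib)
    then show "\<zeta> y = 0" by (simp add: \<zeta>_def step_zero)
  qed
  show "0 \<le> \<zeta> y" "\<zeta> y \<le> 1" for y
    using s2 step_nonneg[of "3 - 1 / R\<^sup>2 * (y \<bullet> y)"] step_le[of "3 - 1 / R\<^sup>2 * (y \<bullet> y)"]
    by (simp_all add: \<zeta>_def)
  show "\<zeta> y = 1" if "norm y \<le> R" for y
  proof -
    have "y \<bullet> y \<le> R\<^sup>2" using that by (simp add: dot_square_norm power_mono)
    then have "1 / R\<^sup>2 * (y \<bullet> y) \<le> 1" using assms by (simp add: field_simps)
    then have "step (3 - 1 / R\<^sup>2 * (y \<bullet> y)) = step 2" by (intro step_const) simp
    then show ?thesis using s2 by (simp add: \<zeta>_def)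
  qed
qed

lemma continuous_bounded_on_cball:
  fixes f :: "3 \<Rightarrow> real^3 \<Rightarrow> real"
  assumes "\<And>j. continuous_on UNIV (f j)"
  obtains M where "M \<ge> 0" "\<And>j y. norm y \<le> R \<Longrightarrow> \<bar>f j y\<bar> \<le> M"
proof -
  have "bounded ((\<lambda>y. \<Sum>j\<in>UNIV. \<bar>f j y\<bar>) ` cball 0 R)"
    by (intro compact_imp_bounded compact_continuous_image continuous_intros
        continuous_on_subset[OF assms]) auto
  then obtain M where "\<forall>x\<in>(\<lambda>y. \<Sum>j\<in>UNIV. \<bar>f j y\<bar>) ` cball 0 R. norm x \<le> M" unfolding bounded_iff ..
  then have M: "(\<Sum>j\<in>UNIV. \<bar>f j y\<bar>) \<le> M" if "norm y \<le> R" for y using that by fastforce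
  have "\<bar>f j y\<bar> \<le> max M 0" if "norm y \<le> R" for j y
    using M[OF that] member_le_sum[of j UNIV "\<lambda>j. \<bar>f j y\<bar>"] by simp
  then show thesis using that[of "max M 0"] by simp
qed

lemma conv_bound:
  assumes \<rho>: "mollifier C \<epsilon> \<rho>" "\<epsilon> \<le> 1" and f: "continuous_on UNIV f"
    and M: "\<And>y. norm y \<le> R + 1 \<Longrightarrow> \<bar>f y\<bar> \<le> M" and x: "norm x \<le> R"
  shows "\<bar>conv \<rho> f x\<bar> \<le> M"
proof -
  have "\<bar>conv \<rho> f x - 0\<bar> \<le> M"
  proof (rule conv_near[OF \<rho>(1) f])
    fix y assume "norm (x - y) < \<epsilon>"
    then have "norm y \<le> R + 1"
      using norm_triangle_ineq2[of y x] x \<rho>(2) by (simp add: norm_minus_commute)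
    then show "\<bar>f y - 0\<bar> \<le> M" using M by simp
  qed
  then show ?thesis by simp
qed

text \<open>Only constant divergences occur: 0 for the velocity fields and 3 \<gamma> for the
  drift.\<close>

definition weak_div :: "(3 \<Rightarrow> real^3 \<Rightarrow> real) \<Rightarrow> real \<Rightarrow> bool" where
  "weak_div B d \<longleftrightarrow> (\<forall>\<phi>. smooth \<phi> \<and> csupp \<phi> \<longrightarrow>
     (LINT y|lborel. (\<Sum>j\<in>UNIV. B j y * partial j \<phi> y)) = - d * (LINT y|lborel. \<phi> y))"

text \<open>\<open>\<Omega> i j\<close> is D_i B_j - D_j B_i in the sense of distributions: the curl
  as an antisymmetric matrix, the form in which it enters the energy identity.\<close>

definition weak_curl :: "(3 \<Rightarrow> real^3 \<Rightarrow> real) \<Rightarrow> (3 \<Rightarrow> 3 \<Rightarrow> real^3 \<Rightarrow> real) \<Rightarrow> bool" where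
  "weak_curl B \<Omega> \<longleftrightarrow> (\<forall>\<phi> i j. smooth \<phi> \<and> csupp \<phi> \<longrightarrow>
     (LINT y|lborel. B j y * partial i \<phi> y - B i y * partial j \<phi> y) = - (LINT y|lborel. \<Omega> i j y * \<phi> y))"

text \<open>Testing with the reflected kernel \<open>\<lambda>y. \<rho> (x - y)\<close> turns the
  weak divergence into a pointwise one; the sign from the reflection cancels the sign of the weak
  form.\<close>

lemma weak_div_conv:
  assumes \<rho>: "mollifier C \<epsilon> \<rho>" and B: "\<And>j. continuous_on UNIV (B j)" and d: "weak_div B d"
  shows "(\<Sum>j\<in>UNIV. partial j (conv \<rho> (B j)) x) = d"
proof -
  note D = mollifierD[OF \<rho>]
  have k: "integrable lborel (\<lambda>y. partial j \<rho> (x - y) * B j y)" for j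
    by (intro conv_kernel(3) smooth_continuous smooth_partial csupp_partial D(1,2) B)
  have "(LINT y|lborel. \<rho> (x - y)) = 1"
    using lborel_integral_reflect[OF borel_measurable_continuous_onI[OF D(3)], of x] \<rho>
    unfolding mollifier_def by linarith
  then have "(LINT y|lborel. (\<Sum>j\<in>UNIV. B j y * partial j (\<lambda>y. \<rho> (x - y)) y)) = - d"
    using d[unfolded weak_div_def, rule_format, of "\<lambda>y. \<rho> (x - y)"]
      smooth_reflect[OF D(1), of x] csupp_reflect[OF D(2), of x] by simp
  then have "(LINT y|lborel. - (\<Sum>j\<in>UNIV. partial j \<rho> (x - y) * B j y)) = - d"
    by (simp add: partial_reflect[OF D(1)] mult.commute flip: sum_negf)
  then have "(LINT y|lborel. (\<Sum>j\<in>UNIV. partial j \<rho> (x - y) * B j y)) = d"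
    by simp
  then show ?thesis
    by (simp add: Bochner_Integration.integral_sum k partial_conv[OF D(1,2) B])
       (simp add: conv_def)
qed

lemma weak_curl_conv:
  assumes \<rho>: "mollifier C \<epsilon> \<rho>" and B: "\<And>j. continuous_on UNIV (B j)" and c: "weak_curl B \<Omega>"
  shows "partial i (conv \<rho> (B j)) x - partial j (conv \<rho> (B i)) x = conv \<rho> (\<Omega> i j) x"
proof -
  note D = mollifierD[OF \<rho>]
  have k: "integrable lborel (\<lambda>y. partial i \<rho> (x - y) * B j y)" for i j
    by (intro conv_kernel(3) smooth_continuous smooth_partial csupp_partial D(1,2) B)
  have "(LINT y|lborel. B j y * partial i (\<lambda>y. \<rho> (x - y)) y - B i y * partial j (\<lambda>y. \<rho> (x - y)) y)
      = - (LINT y|lborel. \<Omega> i j y * \<rho> (x - y))"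
    using c smooth_reflect[OF D(1), of x] csupp_reflect[OF D(2), of x]
    unfolding weak_curl_def by blast
  then have "(LINT y|lborel. - (partial i \<rho> (x - y) * B j y - partial j \<rho> (x - y) * B i y))
      = - conv \<rho> (\<Omega> i j) x"
    by (simp add: partial_reflect[OF D(1)] conv_def algebra_simps)
  then have "(LINT y|lborel. partial i \<rho> (x - y) * B j y - partial j \<rho> (x - y) * B i y)
      = conv \<rho> (\<Omega> i j) x"
    by (simp only: Bochner_Integration.integral_minus neg_equal_iff_equal)
  then show ?thesis
    by (simp add: Bochner_Integration.integral_diff k partial_conv[OF D(1,2) B])
       (simp add: conv_def)
qed

text \<open>Divergence and curl of the cut-off field \<zeta> b, where b is the mollified field,
  consist of mollified data times \<zeta> and of products of the gradient of \<zeta> with b. All are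
  bounded independently of the mollifier, and through the energy identity so is the gradient in
  L^2.\<close>

lemma conv_modulus:
  fixes B :: "3 \<Rightarrow> real^3 \<Rightarrow> real" and g :: "real^3 \<Rightarrow> real"
  assumes B: "\<And>j. continuous_on UNIV (B j)" and div: "weak_div B d"
    and curl: "weak_curl B \<Omega>" and \<Omega>: "\<And>i j. continuous_on UNIV (\<Omega> i j)"
    and g: "continuous_on UNIV g" "csupp g" "\<And>y. 0 \<le> g y"
  obtains K where "\<And>C \<epsilon> \<rho> j h. mollifier C \<epsilon> \<rho> \<Longrightarrow> \<epsilon> \<le> 1 \<Longrightarrow> norm h \<le> 1 \<Longrightarrow>
    (LINT x|lborel. g x * \<bar>conv \<rho> (B j) (x + h) - conv \<rho> (B j) x\<bar>) \<le> K * norm h"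
proof -
  obtain R where R: "R > 0" "\<And>y. R \<le> norm y \<Longrightarrow> g y = 0" using csuppE[OF g(2)] by blast
  obtain M where M: "M \<ge> 0" "\<And>y. \<bar>g y\<bar> \<le> M" using continuous_csupp_bounded[OF g(1,2)] by blast
  have "R + 1 > 0" using R(1) by simp
  \<comment> \<open>With radius R + 1 the cutoff equals 1 both at \<open>x\<close> and at
    \<open>x + h\<close> whenever \<open>g x\<close> is nonzero and |h| \<le> 1.\<close>
  obtain \<zeta> :: "real^3 \<Rightarrow> real" where \<zeta>: "smooth \<zeta>" "csupp \<zeta>" "\<And>y. 0 \<le> \<zeta> y" "\<And>y. \<zeta> y \<le> 1"
    "\<And>y. norm y \<le> R + 1 \<Longrightarrow> \<zeta> y = 1" by (rule cutoff_exists[OF \<open>R + 1 > 0\<close>], rule that)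
  obtain R2 where R2: "R2 > 0" "\<And>y. R2 \<le> norm y \<Longrightarrow> \<zeta> y = 0" using csuppE[OF \<zeta>(2)] by blast
  obtain MB where MB: "MB \<ge> 0" "\<And>j y. norm y \<le> R2 + 1 \<Longrightarrow> \<bar>B j y\<bar> \<le> MB"
    by (rule continuous_bounded_on_cball[OF B], rule that)
  obtain M\<zeta> where M\<zeta>: "M\<zeta> \<ge> 0" "\<And>i y. norm y \<le> R2 \<Longrightarrow> \<bar>partial i \<zeta> y\<bar> \<le> M\<zeta>"
    by (rule continuous_bounded_on_cball[OF smooth_continuous[OF smooth_partial[OF \<zeta>(1)]]], rule that)
  have c\<Omega>: "continuous_on UNIV (\<lambda>y. \<Sum>j\<in>UNIV. \<bar>\<Omega> i j y\<bar>)" for i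
    by (intro continuous_intros \<Omega>)
  obtain MO where MO: "MO \<ge> 0" "\<And>i y. norm y \<le> R2 + 1 \<Longrightarrow> \<bar>\<Sum>j\<in>UNIV. \<bar>\<Omega> i j y\<bar>\<bar> \<le> MO"
    by (rule continuous_bounded_on_cball[OF c\<Omega>], rule that)
  have MO': "\<bar>\<Omega> i j y\<bar> \<le> MO" if "norm y \<le> R2 + 1" for i j y
    using MO(2)[OF that, of i] member_le_sum[of j UNIV "\<lambda>j. \<bar>\<Omega> i j y\<bar>"] by simp
  \<comment> \<open>Bounds for divergence and curl of the cut-off field: three products of D_i
    \<zeta> with b_i in the divergence, two such products in each entry of the curl. In
    \<open>E\<close> the nine entries carry the factor 1/2 of the energy identity.\<close>
  define K1 where "K1 = \<bar>d\<bar> + 3 * (M\<zeta> * MB)"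
  define K2 where "K2 = MO + 2 * (M\<zeta> * MB)"
  define I where "I = (indicator (cball 0 R2) :: real^3 \<Rightarrow> real)"
  have I: "integrable lborel I"
    unfolding I_def by (intro integrable_real_indicator emeasure_lborel_cball_finite) simp
  define V where "V = (LINT x|lborel. I x)"
  define E where "E = (K1\<^sup>2 + 9 / 2 * K2\<^sup>2) * V"
  show thesis
  proof (rule that)
    fix C \<epsilon> \<rho> and j :: 3 and h :: "real^3"
    assume \<rho>: "mollifier C \<epsilon> \<rho>" "\<epsilon> \<le> 1" and h: "norm h \<le> 1"
    note D = mollifierD[OF \<rho>(1)]
    define b where "b j = conv \<rho> (B j)" for j
    have sb: "smooth (b j)" for j unfolding b_def by (intro smooth_conv D(1,2) B)
    define F where "F j y = \<zeta> y * b j y" for j y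
    have F: "smooth (F j)" "csupp (F j)" for j
      unfolding F_def by (intro smooth_mult \<zeta> sb, rule csupp_mono[OF \<zeta>(2)]) simp
    have pF: "partial i (F j) y = \<zeta> y * partial i (b j) y + partial i \<zeta> y * b j y" for i j y
      unfolding F_def by (simp add: partial_mult[OF \<zeta>(1) sb])
    have out: "partial i (F j) y = 0" if "R2 < norm y" for i j y
      by (rule partial_zero_outside[OF _ that]) (simp add: F_def R2)
    have b: "\<bar>b j y\<bar> \<le> MB" if "norm y \<le> R2" for j y
      unfolding b_def using conv_bound[OF \<rho> B MB(2) that] by simp
    have \<zeta>b: "\<bar>partial i \<zeta> y * b j y\<bar> \<le> M\<zeta> * MB" if "norm y \<le> R2" for i j y
      unfolding abs_mult using that M\<zeta> b by (intro mult_mono) auto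
    have divF: "\<bar>\<Sum>i\<in>UNIV. partial i (F i) y\<bar> \<le> K1" if y: "norm y \<le> R2" for y
    proof -
      have "(\<Sum>i\<in>UNIV. partial i (F i) y) = \<zeta> y * d + (\<Sum>i\<in>UNIV. partial i \<zeta> y * b i y)"
        unfolding pF sum.distrib sum_distrib_left[symmetric]
        using weak_div_conv[OF \<rho>(1) B div, of y] by (simp add: b_def)
      moreover have "\<bar>\<Sum>i\<in>UNIV. partial i \<zeta> y * b i y\<bar> \<le> (\<Sum>i\<in>(UNIV::3 set). M\<zeta> * MB)"
        by (intro order_trans[OF sum_abs] sum_mono \<zeta>b y)
      moreover have "\<bar>\<zeta> y * d\<bar> \<le> \<bar>d\<bar>"
        using \<zeta>(3,4)[of y] by (simp add: abs_mult mult_left_le_one_le)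
      ultimately show ?thesis unfolding K1_def by simp
    qed
    have curlF: "\<bar>partial i (F j) y - partial j (F i) y\<bar> \<le> K2" if y: "norm y \<le> R2" for i j y
    proof -
      have "partial i (F j) y - partial j (F i) y = \<zeta> y * (partial i (b j) y - partial j (b i) y)
          + partial i \<zeta> y * b j y - partial j \<zeta> y * b i y"
        unfolding pF by (simp add: algebra_simps)
      also have "partial i (b j) y - partial j (b i) y = conv \<rho> (\<Omega> i j) y"
        unfolding b_def by (rule weak_curl_conv[OF \<rho>(1) B curl])
      finally have "partial i (F j) y - partial j (F i) y
          = \<zeta> y * conv \<rho> (\<Omega> i j) y + partial i \<zeta> y * b j y - partial j \<zeta> y * b i y" .
      moreover have "\<bar>conv \<rho> (\<Omega> i j) y\<bar> \<le> MO"
        using conv_bound[OF \<rho> \<Omega> MO' y] by simp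
      then have "\<bar>\<zeta> y * conv \<rho> (\<Omega> i j) y\<bar> \<le> 1 * MO"
        unfolding abs_mult using \<zeta>(3,4)[of y] by (intro mult_mono) auto
      ultimately show ?thesis
        using \<zeta>b[OF y, of i j] \<zeta>b[OF y, of j i] unfolding K2_def by linarith
    qed
    have pw: "(\<Sum>i\<in>UNIV. partial i (F i) x)\<^sup>2
        + (1 / 2) * (\<Sum>i\<in>UNIV. \<Sum>j\<in>UNIV. (partial i (F j) x - partial j (F i) x)\<^sup>2)
      \<le> (K1\<^sup>2 + 9 / 2 * K2\<^sup>2) * I x" for x
    proof (cases "norm x \<le> R2")
      case True
      have "(\<Sum>i\<in>UNIV. partial i (F i) x)\<^sup>2 \<le> K1\<^sup>2"
        using divF[OF True] by (rule power2_le_iff_abs_le[THEN iffD2, rotated]) (auto simp: K1_def M\<zeta> MB)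
      moreover have "(partial i (F j) x - partial j (F i) x)\<^sup>2 \<le> K2\<^sup>2" for i j
        using curlF[OF True] by (rule power2_le_iff_abs_le[THEN iffD2, rotated]) (auto simp: K2_def M\<zeta> MB MO)
      then have "(\<Sum>i\<in>UNIV. \<Sum>j\<in>UNIV. (partial i (F j) x - partial j (F i) x)\<^sup>2)
          \<le> (\<Sum>i\<in>(UNIV::3 set). \<Sum>j\<in>(UNIV::3 set). K2\<^sup>2)"
        by (intro sum_mono)
      ultimately show ?thesis using True by (simp add: I_def)
    next
      case False
      then show ?thesis by (simp add: I_def out)
    qed
    have "(LINT x|lborel. (\<Sum>i\<in>UNIV. \<Sum>j\<in>UNIV. (partial i (F j) x)\<^sup>2))
        \<le> (LINT x|lborel. (K1\<^sup>2 + 9 / 2 * K2\<^sup>2) * I x)"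
      unfolding energy_identity[OF F]
      by (rule integral_mono'[OF integrable_mult_right[OF I] pw]) (simp add: I_def)
    then have E: "(LINT x|lborel. (\<Sum>i\<in>UNIV. \<Sum>j\<in>UNIV. (partial i (F j) x)\<^sup>2)) \<le> E"
      by (simp add: E_def V_def)
    have intS: "integrable lborel (\<lambda>x. (\<Sum>i\<in>UNIV. \<Sum>j\<in>UNIV. (partial i (F j) x)\<^sup>2))"
      unfolding power2_eq_square
      by (intro Bochner_Integration.integrable_sum integrable_smooth_mult smooth_partial csupp_partial F)
    have L1: "(LINT x|lborel. \<bar>partial i (F j) x\<bar>) \<le> (V + E) / 2" for i
    proof -
      have "\<bar>partial i (F j) x\<bar> \<le> (I x + (\<Sum>i\<in>UNIV. \<Sum>j\<in>UNIV. (partial i (F j) x)\<^sup>2)) / 2" for x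
      proof (cases "norm x \<le> R2")
        case True
        have "(partial i (F j) x)\<^sup>2 \<le> (\<Sum>j\<in>UNIV. (partial i (F j) x)\<^sup>2)"
          by (rule member_le_sum[of j UNIV "\<lambda>j. (partial i (F j) x)\<^sup>2"]) auto
        also have "\<dots> \<le> (\<Sum>i\<in>UNIV. \<Sum>j\<in>UNIV. (partial i (F j) x)\<^sup>2)"
          by (rule member_le_sum[of i UNIV "\<lambda>i. \<Sum>j\<in>UNIV. (partial i (F j) x)\<^sup>2"]) (auto intro: sum_nonneg)
        finally have "(partial i (F j) x)\<^sup>2 \<le> (\<Sum>i\<in>UNIV. \<Sum>j\<in>UNIV. (partial i (F j) x)\<^sup>2)" .
        \<comment> \<open>From (|a| - 1)^2 \<ge> 0. Integrated over a ball of finite volume, this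
          replaces the Cauchy-Schwarz inequality in the passage from L^2 to L^1.\<close>
        moreover have "2 * \<bar>partial i (F j) x\<bar> \<le> 1 + (partial i (F j) x)\<^sup>2"
          using zero_le_power2[of "\<bar>partial i (F j) x\<bar> - 1"] by (simp add: power2_eq_square algebra_simps)
        ultimately show ?thesis using True by (simp add: I_def)
      next
        case False
        then show ?thesis by (simp add: out I_def)
      qed
      then have "(LINT x|lborel. \<bar>partial i (F j) x\<bar>)
          \<le> (LINT x|lborel. (I x + (\<Sum>i\<in>UNIV. \<Sum>j\<in>UNIV. (partial i (F j) x)\<^sup>2)) / 2)"
        by (intro integral_mono' integrable_divide Bochner_Integration.integrable_add I intS)
           (auto simp: I_def intro!: add_nonneg_nonneg sum_nonneg)
      also have "\<dots> = (V + (LINT x|lborel. (\<Sum>i\<in>UNIV. \<Sum>j\<in>UNIV. (partial i (F j) x)\<^sup>2))) / 2"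
        by (simp add: V_def Bochner_Integration.integral_add[OF I intS])
      finally show ?thesis using E by simp
    qed
    have "(LINT x|lborel. g x * \<bar>b j (x + h) - b j x\<bar>) \<le> (LINT x|lborel. M * \<bar>F j (x + h) - F j x\<bar>)"
    proof (rule integral_mono')
      have "integrable lborel (\<lambda>x. \<bar>F j (x + h) - F j x\<bar>)"
      proof (rule integrable_csupp)
        show "continuous_on UNIV (\<lambda>x. \<bar>F j (x + h) - F j x\<bar>)"
          by (intro continuous_intros continuous_on_compose2[OF smooth_continuous[OF F(1)]]) auto
        have "csupp (\<lambda>x. F j (x + h))"
          using csupp_affine[OF F(2)[of j], of 1 h] by (simp add: add.commute)
        then show "csupp (\<lambda>x. \<bar>F j (x + h) - F j x\<bar>)"
          using F(2)[of j] by (rule csupp_sum2) simp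
      qed
      then show "integrable lborel (\<lambda>x. M * \<bar>F j (x + h) - F j x\<bar>)"
        by (rule integrable_mult_right)
      fix x
      show "0 \<le> M * \<bar>F j (x + h) - F j x\<bar>" using M(1) by simp
      show "g x * \<bar>b j (x + h) - b j x\<bar> \<le> M * \<bar>F j (x + h) - F j x\<bar>"
      proof (cases "R \<le> norm x")
        case True
        then show ?thesis using R(2) M(1) by simp
      next
        case False
        then have "\<zeta> x = 1" "\<zeta> (x + h) = 1"
          using h norm_triangle_ineq[of x h] by (auto intro!: \<zeta>(5))
        then show ?thesis
          using M(2)[of x] by (auto simp: F_def intro!: mult_right_mono)
      qed
    qed
    also have "\<dots> \<le> M * (norm h * (\<Sum>i\<in>UNIV. LINT x|lborel. \<bar>partial i (F j) x\<bar>))"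
      using integral_shift_diff_le[OF F, of j h] M(1) by (simp add: mult_left_mono)
    also have "\<dots> \<le> M * (norm h * (\<Sum>i\<in>(UNIV::3 set). (V + E) / 2))"
      by (intro mult_left_mono sum_mono L1 M(1) norm_ge_zero)
    also have "\<dots> = (3 * M * (V + E) / 2) * norm h" by simp
    finally show "(LINT x|lborel. g x * \<bar>conv \<rho> (B j) (x + h) - conv \<rho> (B j) x\<bar>)
        \<le> (3 * M * (V + E) / 2) * norm h"
      by (simp add: b_def)
  qed
qed

text \<open>The constant of \<open>conv_modulus\<close> does not depend on the mollifier, so it
  survives dominated convergence as the radius tends to 0.\<close>

lemma field_modulus:
  fixes B :: "3 \<Rightarrow> real^3 \<Rightarrow> real" and g :: "real^3 \<Rightarrow> real"
  assumes B: "\<And>j. continuous_on UNIV (B j)" and div: "weak_div B d"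
    and curl: "weak_curl B \<Omega>" and \<Omega>: "\<And>i j. continuous_on UNIV (\<Omega> i j)"
    and g: "continuous_on UNIV g" "csupp g" "\<And>y. 0 \<le> g y"
  shows "\<exists>K. \<forall>h j. norm h \<le> 1 \<longrightarrow> (LINT x|lborel. g x * \<bar>B j (x + h) - B j x\<bar>) \<le> K * norm h"
proof -
  obtain K where K: "\<And>C \<epsilon> \<rho> j h. mollifier C \<epsilon> \<rho> \<Longrightarrow> \<epsilon> \<le> 1 \<Longrightarrow> norm h \<le> 1 \<Longrightarrow>
    (LINT x|lborel. g x * \<bar>conv \<rho> (B j) (x + h) - conv \<rho> (B j) x\<bar>) \<le> K * norm h"
    using conv_modulus[OF assms] by blast
  obtain C \<rho> where \<rho>: "\<And>\<epsilon>. \<epsilon> > 0 \<Longrightarrow> mollifier C \<epsilon> (\<rho> \<epsilon>)"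
    using mollifier_exists by metis
  define r where "r n = \<rho> (1 / real (Suc n))" for n
  have r: "mollifier C (1 / real (Suc n)) (r n)" for n
    unfolding r_def by (rule \<rho>) simp
  obtain R where R: "R > 0" "\<And>y. R \<le> norm y \<Longrightarrow> g y = 0" using csuppE[OF g(2)] by blast
  \<comment> \<open>Shifting by |h| \<le> 1 and mollifying at radius at most 1 each enlarge the ball
    of radius \<open>R\<close> by 1.\<close>
  obtain M where M: "M \<ge> 0" "\<And>j y. norm y \<le> R + 2 \<Longrightarrow> \<bar>B j y\<bar> \<le> M"
    by (rule continuous_bounded_on_cball[OF B], rule that)
  have "(LINT x|lborel. g x * \<bar>B j (x + h) - B j x\<bar>) \<le> K * norm h" if h: "norm h \<le> 1" for h j
  proof (rule LIMSEQ_le_const2)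
    show "(\<lambda>n. LINT x|lborel. g x * \<bar>conv (r n) (B j) (x + h) - conv (r n) (B j) x\<bar>)
        \<longlonglongrightarrow> (LINT x|lborel. g x * \<bar>B j (x + h) - B j x\<bar>)"
    proof (rule integral_dominated_convergence[where w = "\<lambda>x. g x * (2 * M)"])
      have cc: "continuous_on UNIV (\<lambda>x. g x * \<bar>f (x + h) - f x\<bar>)" if "continuous_on UNIV f" for f
        by (intro continuous_intros g continuous_on_compose2[OF that]) auto
      show "(\<lambda>x. g x * \<bar>B j (x + h) - B j x\<bar>) \<in> borel_measurable lborel"
        using borel_measurable_continuous_onI[OF cc[OF B]] by simp
      show "(\<lambda>x. g x * \<bar>conv (r n) (B j) (x + h) - conv (r n) (B j) x\<bar>) \<in> borel_measurable lborel" for n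
        using borel_measurable_continuous_onI[OF cc[OF smooth_continuous[OF
              smooth_conv[OF mollifierD(1,2)[OF r[of n]] B]]]] by simp
      show "integrable lborel (\<lambda>x. g x * (2 * M))"
        by (intro integrable_mult_left integrable_csupp g)
      show "AE x in lborel. (\<lambda>n. g x * \<bar>conv (r n) (B j) (x + h) - conv (r n) (B j) x\<bar>)
          \<longlonglongrightarrow> g x * \<bar>B j (x + h) - B j x\<bar>"
        by (intro AE_I2 tendsto_intros conv_tendsto[OF r B])
      show "AE x in lborel. norm (g x * \<bar>conv (r n) (B j) (x + h) - conv (r n) (B j) x\<bar>) \<le> g x * (2 * M)" for n
      proof (rule AE_I2)
        fix x
        show "norm (g x * \<bar>conv (r n) (B j) (x + h) - conv (r n) (B j) x\<bar>) \<le> g x * (2 * M)"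
        proof (cases "R \<le> norm x")
          case True
          then show ?thesis using R by simp
        next
          case False
          then have n: "norm x \<le> R + 1" "norm (x + h) \<le> R + 1"
            using h norm_triangle_ineq[of x h] by auto
          have "\<bar>conv (r n) (B j) y\<bar> \<le> M" if "norm y \<le> R + 1" for y
            using conv_bound[OF r _ B _ that] M(2) by (simp add: add.commute add.left_commute)
          from this[OF n(1)] this[OF n(2)] show ?thesis
            using g(3)[of x] by (simp add: abs_mult mult_left_mono)
        qed
      qed
    qed
    show "\<exists>N. \<forall>n\<ge>N. (LINT x|lborel. g x * \<bar>conv (r n) (B j) (x + h) - conv (r n) (B j) x\<bar>) \<le> K * norm h"
      using K[OF r _ h] by simp
  qed
  then show ?thesis by blast
qed

section \<open>Renormalization of the transport equation\<close>

lemma orthogonal_transformation_rot_z: "orthogonal_transformation (rot_z t)"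
proof -
  have "linear (rot_z t)"
    by (rule linearI) (simp_all add: rot_z_def vec_eq_iff forall_3 vector_3 algebra_simps)
  moreover have "norm (rot_z t y) = norm y" for y
  proof -
    have "rot_z t y \<bullet> rot_z t y = (cos t * y $ 1 - sin t * y $ 2)\<^sup>2
        + (sin t * y $ 1 + cos t * y $ 2)\<^sup>2 + (y $ 3)\<^sup>2"
      by (simp add: rot_z_def inner_vec_def sum_3 vector_3 power2_eq_square)
    also have "\<dots> = ((sin t)\<^sup>2 + (cos t)\<^sup>2) * ((y $ 1)\<^sup>2 + (y $ 2)\<^sup>2) + (y $ 3)\<^sup>2"
      by algebra
    also have "\<dots> = (y $ 1)\<^sup>2 + (y $ 2)\<^sup>2 + (y $ 3)\<^sup>2"
      by (simp only: sin_cos_squared_add mult_1)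
    also have "\<dots> = y \<bullet> y"
      by (simp add: inner_vec_def sum_3 power2_eq_square)
    finally show ?thesis by (simp add: norm_eq_sqrt_inner)
  qed
  ultimately show ?thesis by (simp add: orthogonal_transformation)
qed

text \<open>Rotations preserve the radial kernel and Lebesgue measure. The circulation equation
  holds for axisymmetric test functions, so mollified test functions have to keep this
  symmetry.\<close>

lemma conv_axisym:
  assumes \<rho>: "mollifier C \<epsilon> \<rho>" and f: "continuous_on UNIV f" "axisym_scalar f"
  shows "axisym_scalar (conv \<rho> f)"
  unfolding axisym_scalar_def
proof (intro allI)
  fix t x
  note D = mollifierD[OF \<rho>]
  note T = orthogonal_transformation_rot_z[of t]
  have m: "(\<lambda>y. \<rho> (rot_z t x - y) * f y) \<in> borel_measurable borel"
    by (intro borel_measurable_continuous_onI conv_kernel(1) D(2,3) f)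
  have r: "\<rho> (rot_z t x - rot_z t y) = \<rho> (x - y)" for y
  proof -
    have "norm (rot_z t x - rot_z t y) = norm (x - y)"
      using T by (metis linear_diff orthogonal_transformation)
    moreover have "\<forall>y z. norm y = norm z \<longrightarrow> \<rho> y = \<rho> z"
      using \<rho> unfolding mollifier_def by (elim conjE)
    ultimately show ?thesis by (elim allE impE)
  qed
  have fr: "f (rot_z t y) = f y" for y
    using f(2) unfolding axisym_scalar_def by (elim allE)
  have "conv \<rho> f (rot_z t x) = (LINT y|lborel. \<rho> (rot_z t x - rot_z t y) * f (rot_z t y))"
    unfolding conv_def by (rule lborel_integral_orthogonal[OF T m, symmetric])
  then show "conv \<rho> f (rot_z t x) = conv \<rho> f x"
    unfolding r fr conv_def .
qed

section \<open>The commutator of mollification and transport\<close>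

lemma partial_even:
  assumes "smooth \<rho>" "\<And>y. \<rho> (- y) = \<rho> y"
  shows "partial i \<rho> (- y) = - partial i \<rho> y"
proof -
  have "(\<lambda>y. \<rho> (0 - y)) = \<rho>" using assms(2) by simp
  then have "partial i \<rho> y = - partial i \<rho> (0 - y)"
    using fun_cong[OF partial_reflect[OF assms(1), of i 0], of y] by (simp only:)
  then show ?thesis by simp
qed

text \<open>An even kernel moves to the other factor unchanged; its derivatives are odd and change
  sign on the way.\<close>

lemma conv_self_adjoint:
  assumes \<rho>: "mollifier C \<epsilon> \<rho>" and f: "continuous_on UNIV f" and G: "continuous_on UNIV G" "csupp G"
  shows "(LINT y|lborel. f y * conv \<rho> G y) = (LINT x|lborel. G x * conv \<rho> f x)"
    and "(LINT y|lborel. f y * conv (partial j \<rho>) G y) = - (LINT x|lborel. G x * conv (partial j \<rho>) f x)"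
proof -
  note D = mollifierD[OF \<rho>]
  show "(LINT y|lborel. f y * conv \<rho> G y) = (LINT x|lborel. G x * conv \<rho> f x)"
    using conv_Fubini[OF D(3,2) f G] by (simp add: D(5) mult.commute)
  have odd: "partial j \<rho> (- k) = - partial j \<rho> k" for k
    by (rule partial_even[OF D(1,5)])
  have "(LINT x|lborel. conv (partial j \<rho>) f x * G x) = (LINT y|lborel. f y * conv (\<lambda>k. partial j \<rho> (- k)) G y)"
    by (rule conv_Fubini[OF smooth_continuous[OF smooth_partial[OF D(1)]] csupp_partial[OF D(2)] f G])
  also have "\<dots> = - (LINT y|lborel. f y * conv (partial j \<rho>) G y)"
    by (simp add: odd conv_def)
  finally show "(LINT y|lborel. f y * conv (partial j \<rho>) G y) = - (LINT x|lborel. G x * conv (partial j \<rho>) f x)"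
    by (simp add: mult.commute)
qed

text \<open>Formally the mollification of div (w B), minus B . grad of the mollified w, minus w div
  B; the divergence is moved onto the kernel because \<open>w\<close> and \<open>B\<close> are
  merely continuous.\<close>

definition commutator :: "(3 \<Rightarrow> real^3 \<Rightarrow> real) \<Rightarrow> real \<Rightarrow> (real^3 \<Rightarrow> real) \<Rightarrow> (real^3 \<Rightarrow> real) \<Rightarrow> real^3 \<Rightarrow> real" where
  "commutator B d w \<rho> x = (\<Sum>j\<in>UNIV. conv (partial j \<rho>) (\<lambda>y. w y * B j y) x)
     - (\<Sum>j\<in>UNIV. B j x * partial j (conv \<rho> w) x) - d * w x"

text \<open>Both increments vanish at \<open>k = 0\<close>, which compensates for the size \<open>1 / \<epsilon>\<close> of \<open>\<nabla>\<rho>\<close>.\<close>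

lemma commutator_eq:
  assumes \<rho>: "mollifier C \<epsilon> \<rho>" and B: "\<And>j. continuous_on UNIV (B j)" and div: "weak_div B d"
    and w: "continuous_on UNIV w"
  shows "commutator B d w \<rho> x
    = (\<Sum>j\<in>UNIV. LINT k|lborel. partial j \<rho> k * ((w (x - k) - w x) * (B j (x - k) - B j x)))"
proof -
  note D = mollifierD[OF \<rho>]
  have c: "continuous_on UNIV (partial j \<rho>)" "csupp (partial j \<rho>)" for j
    using D(1,2) by (blast intro: smooth_continuous smooth_partial csupp_partial)+
  have int: "integrable lborel (\<lambda>k. partial j \<rho> k * f (x - k))" if "continuous_on UNIV f" for f j
  proof (rule integrable_csupp)
    show "continuous_on UNIV (\<lambda>k. partial j \<rho> k * f (x - k))"
      by (intro continuous_intros c continuous_on_compose2[OF that]) auto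
    show "csupp (\<lambda>k. partial j \<rho> k * f (x - k))"
      using c(2)[of j] by (rule csupp_mono) simp
  qed
  have "(LINT k|lborel. partial j \<rho> k * ((w (x - k) - w x) * (B j (x - k) - B j x)))
      = conv (partial j \<rho>) (\<lambda>y. w y * B j y) x - B j x * conv (partial j \<rho>) w x
        - w x * conv (partial j \<rho>) (B j) x" for j
  proof -
    have wB: "continuous_on UNIV (\<lambda>y. w y * B j y)" by (intro continuous_intros w B)
    \<comment> \<open>When the product of increments is expanded, the term with constant
      coefficients disappears because a derivative of the kernel has integral 0; the convolutions
      with \<open>B j\<close> will sum to \<open>d\<close>.\<close>
    have "(LINT k|lborel. partial j \<rho> k * ((w (x - k) - w x) * (B j (x - k) - B j x)))
      = (LINT k|lborel. partial j \<rho> k * (w (x - k) * B j (x - k)) - B j x * (partial j \<rho> k * w (x - k))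
          - w x * (partial j \<rho> k * B j (x - k)) + w x * B j x * partial j \<rho> k)"
      by (simp add: algebra_simps)
    also have "\<dots> = (LINT k|lborel. partial j \<rho> k * (w (x - k) * B j (x - k)))
        - B j x * (LINT k|lborel. partial j \<rho> k * w (x - k))
        - w x * (LINT k|lborel. partial j \<rho> k * B j (x - k)) + w x * B j x * (LINT k|lborel. partial j \<rho> k)"
      using int[OF wB, of j] int[OF w, of j] int[OF B, of j j] integrable_csupp[OF c]
      by (simp add: Bochner_Integration.integral_add Bochner_Integration.integral_diff
          Bochner_Integration.integrable_add Bochner_Integration.integrable_diff)
    finally show ?thesis
      by (simp add: conv_commute[OF c(1)] w B wB integral_partial_eq_0[OF D(1,2)])
  qed
  moreover have "(\<Sum>j\<in>UNIV. conv (partial j \<rho>) (B j) x) = d"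
    using weak_div_conv[OF \<rho> B div, of x] by (simp add: partial_conv[OF D(1,2) B])
  ultimately show ?thesis
    by (simp add: commutator_def partial_conv[OF D(1,2) w] sum_subtractf sum_distrib_left[symmetric])
qed

text \<open>The factor C / \<epsilon> from the gradient of the kernel meets the modulus K \<epsilon>
  of the field, since the kernel sees only |k| \<le> \<epsilon>. The product stays bounded, and the
  oscillation \<eta> of \<open>w\<close> makes it small; the 3 counts directions. The weight
  \<open>g\<close>, to which \<open>K\<close> belongs, is separate from \<open>G\<close> because
  \<open>G\<close> will vary with the mollifier.\<close>

lemma commutator_bound:
  assumes \<rho>: "mollifier C \<epsilon> \<rho>" "\<epsilon> > 0" "\<epsilon> \<le> 1"
    and B: "\<And>j. continuous_on UNIV (B j)" and div: "weak_div B d"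
    and w: "continuous_on UNIV w"
    and g: "continuous_on UNIV g" "csupp g" "\<And>x. 0 \<le> g x"
    and K: "\<And>h j. norm h \<le> 1 \<Longrightarrow> (LINT x|lborel. g x * \<bar>B j (x + h) - B j x\<bar>) \<le> K * norm h" "K \<ge> 0"
    and osc: "\<And>x k. g x \<noteq> 0 \<Longrightarrow> norm k \<le> \<epsilon> \<Longrightarrow> \<bar>w (x - k) - w x\<bar> \<le> \<eta>" "\<eta> \<ge> 0"
    and G: "\<And>x. \<bar>G x\<bar> \<le> MG * g x" "MG \<ge> 0"
  shows "\<bar>LINT x|lborel. G x * commutator B d w \<rho> x\<bar> \<le> MG * \<eta> * (3 * (K * C))"
proof -
  note D = mollifierD[OF \<rho>(1)]
  have c: "continuous_on UNIV (partial j \<rho>)" "csupp (partial j \<rho>)" for j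
    using D(1,2) by (blast intro: smooth_continuous smooth_partial csupp_partial)+
  define P where "P j x = (LINT k|lborel. g x * (\<bar>partial j \<rho> k\<bar> * \<bar>B j (x - k) - B j x\<bar>))" for j x
  let ?F = "\<lambda>j p. g (fst p) * (\<bar>partial j \<rho> (snd p)\<bar> * \<bar>B j (fst p - snd p) - B j (fst p)\<bar>)"
  have F: "integrable lborel (?F j)" for j
  proof (rule integrable_csupp)
    show "continuous_on UNIV (?F j)"
      by (intro continuous_intros continuous_on_compose2[OF g(1)] continuous_on_compose2[OF c(1)]
          continuous_on_compose2[OF B]) auto
    obtain R where R: "R > 0" "\<And>y. R \<le> norm y \<Longrightarrow> g y = 0" using csuppE[OF g(2)] by blast
    obtain R' where R': "R' > 0" "\<And>y. R' \<le> norm y \<Longrightarrow> partial j \<rho> y = 0" using csuppE[OF c(2)[of j]] by blast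
    show "csupp (?F j)"
    proof (rule csuppI[of "R + R'"])
      fix p :: "(real^3) \<times> (real^3)" assume "R + R' \<le> norm p"
      then have "R \<le> norm (fst p) \<or> R' \<le> norm (snd p)"
        using norm_Pair_le[of "fst p" "snd p"] by auto
      then show "?F j p = 0" using R(2) R'(2) by auto
    qed
  qed
  have P: "integrable lborel (P j)" for j
    using lborel_Fubini(2)[OF F[of j]] unfolding fst_conv snd_conv P_def[symmetric] .
  have P_le: "(LINT x|lborel. P j x) \<le> K * C" for j
  proof -
    \<comment> \<open>Integrating in \<open>x\<close> first leaves, for each shift \<open>k\<close>,
      the L^1 modulus of continuity of \<open>B j\<close>.\<close>
    have "(LINT x|lborel. P j x)
        = (LINT k|lborel. LINT x|lborel. g x * (\<bar>partial j \<rho> k\<bar> * \<bar>B j (x - k) - B j x\<bar>))"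
      using lborel_Fubini(1)[OF F[of j]] by (simp add: P_def)
    also have "\<dots> = (LINT k|lborel. \<bar>partial j \<rho> k\<bar> * (LINT x|lborel. g x * \<bar>B j (x - k) - B j x\<bar>))"
    proof (rule Bochner_Integration.integral_cong[OF refl])
      fix k
      have "(LINT x|lborel. g x * (\<bar>partial j \<rho> k\<bar> * \<bar>B j (x - k) - B j x\<bar>))
          = (LINT x|lborel. \<bar>partial j \<rho> k\<bar> * (g x * \<bar>B j (x - k) - B j x\<bar>))"
        by (simp add: mult.left_commute)
      then show "(LINT x|lborel. g x * (\<bar>partial j \<rho> k\<bar> * \<bar>B j (x - k) - B j x\<bar>))
          = \<bar>partial j \<rho> k\<bar> * (LINT x|lborel. g x * \<bar>B j (x - k) - B j x\<bar>)"
        by (simp only: integral_mult_right_zero)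
    qed
    also have "\<dots> \<le> (LINT k|lborel. (K * \<epsilon>) * \<bar>partial j \<rho> k\<bar>)"
    proof (rule integral_mono')
      show "integrable lborel (\<lambda>k. (K * \<epsilon>) * \<bar>partial j \<rho> k\<bar>)"
        by (intro integrable_mult_right integrable_abs integrable_csupp c)
      fix k
      show "0 \<le> (K * \<epsilon>) * \<bar>partial j \<rho> k\<bar>" using K(2) \<rho>(2) by simp
      show "\<bar>partial j \<rho> k\<bar> * (LINT x|lborel. g x * \<bar>B j (x - k) - B j x\<bar>) \<le> (K * \<epsilon>) * \<bar>partial j \<rho> k\<bar>"
      proof (cases "\<epsilon> < norm k")
        case True
        then have "partial j \<rho> k = 0" using D(4) by (intro partial_zero_outside[of \<epsilon>])
        then show ?thesis by simp
      next
        case False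
        then have "(LINT x|lborel. g x * \<bar>B j (x - k) - B j x\<bar>) \<le> K * norm k"
          using K(1)[of "- k" j] \<rho>(3) by simp
        also have "\<dots> \<le> K * \<epsilon>" using False K(2) by (intro mult_left_mono) auto
        finally show ?thesis
          by (subst mult.commute) (rule mult_right_mono[OF _ abs_ge_zero])
      qed
    qed
    also have "\<dots> = K * \<epsilon> * (LINT k|lborel. \<bar>partial j \<rho> k\<bar>)" by simp
    also have "\<dots> \<le> K * \<epsilon> * (C / \<epsilon>)"
      using K(2) \<rho>(2) D(6)[of j] by (intro mult_left_mono) auto
    finally show ?thesis using \<rho>(2) by simp
  qed
  have pw: "\<bar>G x * commutator B d w \<rho> x\<bar> \<le> MG * \<eta> * (\<Sum>j\<in>UNIV. P j x)" for x
  proof (cases "g x = 0")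
    case True
    then show ?thesis using G(1)[of x] by (simp add: P_def)
  next
    case False
    let ?J = "\<lambda>j. LINT k|lborel. \<bar>partial j \<rho> k\<bar> * \<bar>B j (x - k) - B j x\<bar>"
    have "\<bar>LINT k|lborel. partial j \<rho> k * ((w (x - k) - w x) * (B j (x - k) - B j x))\<bar> \<le> \<eta> * ?J j" for j
    proof -
      have "\<bar>LINT k|lborel. partial j \<rho> k * ((w (x - k) - w x) * (B j (x - k) - B j x))\<bar>
          \<le> (LINT k|lborel. \<bar>partial j \<rho> k * ((w (x - k) - w x) * (B j (x - k) - B j x))\<bar>)"
        using integral_norm_bound[of lborel "\<lambda>k. partial j \<rho> k * ((w (x - k) - w x) * (B j (x - k) - B j x))"]
        by simp
      also have "\<dots> \<le> (LINT k|lborel. \<eta> * (\<bar>partial j \<rho> k\<bar> * \<bar>B j (x - k) - B j x\<bar>))"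
      proof (rule integral_mono')
        show "integrable lborel (\<lambda>k. \<eta> * (\<bar>partial j \<rho> k\<bar> * \<bar>B j (x - k) - B j x\<bar>))"
        proof (intro integrable_mult_right integrable_csupp)
          show "continuous_on UNIV (\<lambda>k. \<bar>partial j \<rho> k\<bar> * \<bar>B j (x - k) - B j x\<bar>)"
            by (intro continuous_intros c continuous_on_compose2[OF B]) auto
          show "csupp (\<lambda>k. \<bar>partial j \<rho> k\<bar> * \<bar>B j (x - k) - B j x\<bar>)"
            using c(2)[of j] by (rule csupp_mono) simp
        qed
        fix k
        show "0 \<le> \<eta> * (\<bar>partial j \<rho> k\<bar> * \<bar>B j (x - k) - B j x\<bar>)" using osc(2) by simp
        show "\<bar>partial j \<rho> k * ((w (x - k) - w x) * (B j (x - k) - B j x))\<bar>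
            \<le> \<eta> * (\<bar>partial j \<rho> k\<bar> * \<bar>B j (x - k) - B j x\<bar>)"
        proof (cases "norm k \<le> \<epsilon>")
          case True
          then show ?thesis
            using mult_right_mono[OF osc(1)[OF False True], of "\<bar>partial j \<rho> k\<bar> * \<bar>B j (x - k) - B j x\<bar>"]
            by (simp add: abs_mult mult_ac)
        next
          case False
          then have "partial j \<rho> k = 0"
            using D(4) by (intro partial_zero_outside[of \<epsilon>]) auto
          then show ?thesis by simp
        qed
      qed
      also have "\<dots> = \<eta> * ?J j" by (rule integral_mult_right_zero)
      finally show ?thesis .
    qed
    then have "\<bar>commutator B d w \<rho> x\<bar> \<le> (\<Sum>j\<in>UNIV. \<eta> * ?J j)"
      unfolding commutator_eq[OF \<rho>(1) B div w]
      by (intro order_trans[OF sum_abs] sum_mono)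
    then have "\<bar>G x * commutator B d w \<rho> x\<bar> \<le> (MG * g x) * (\<Sum>j\<in>UNIV. \<eta> * ?J j)"
      unfolding abs_mult using G g(3)[of x] by (intro mult_mono) auto
    also have "\<dots> = MG * \<eta> * (\<Sum>j\<in>UNIV. P j x)"
      unfolding P_def by (simp add: sum_distrib_left mult_ac)
    finally show ?thesis .
  qed
  have "\<bar>LINT x|lborel. G x * commutator B d w \<rho> x\<bar> \<le> (LINT x|lborel. \<bar>G x * commutator B d w \<rho> x\<bar>)"
    using integral_norm_bound[of lborel "\<lambda>x. G x * commutator B d w \<rho> x"] by simp
  also have "\<dots> \<le> (LINT x|lborel. MG * \<eta> * (\<Sum>j\<in>UNIV. P j x))"
  proof (rule integral_mono'[OF _ pw])
    show "integrable lborel (\<lambda>x. MG * \<eta> * (\<Sum>j\<in>UNIV. P j x))"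
      by (intro integrable_mult_right Bochner_Integration.integrable_sum P)
    have "0 \<le> P j x" for j x
      unfolding P_def by (intro Bochner_Integration.integral_nonneg mult_nonneg_nonneg g(3)) auto
    then show "0 \<le> MG * \<eta> * (\<Sum>j\<in>UNIV. P j x)" for x
      using G(2) osc(2) by (intro mult_nonneg_nonneg sum_nonneg)
  qed
  also have "\<dots> = MG * \<eta> * (\<Sum>j\<in>UNIV. LINT x|lborel. P j x)"
    by (simp add: Bochner_Integration.integral_sum P)
  also have "\<dots> \<le> MG * \<eta> * (\<Sum>j\<in>(UNIV::3 set). K * C)"
    using G(2) osc(2) by (intro mult_left_mono sum_mono P_le) auto
  finally show ?thesis by simp
qed

lemma conv_power_limit:
  assumes r: "\<And>n. mollifier C (1 / real (Suc n)) (r n)" and w: "continuous_on UNIV w"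
    and h: "continuous_on UNIV h" "csupp h"
  shows "(\<lambda>n. LINT x|lborel. h x * conv (r n) w x ^ q) \<longlonglongrightarrow> (LINT x|lborel. h x * w x ^ q)"
proof -
  obtain R where R: "R > 0" "\<And>y. R \<le> norm y \<Longrightarrow> h y = 0" using csuppE[OF h(2)] by blast
  obtain M where M: "M \<ge> 0" "\<And>(j::3) y. norm y \<le> R + 1 \<Longrightarrow> \<bar>w y\<bar> \<le> M"
    by (rule continuous_bounded_on_cball[of "\<lambda>j. w"], rule w, rule that)
  show ?thesis
  proof (rule integral_dominated_convergence[where w = "\<lambda>x. \<bar>h x\<bar> * M ^ q"])
    have cc: "continuous_on UNIV (\<lambda>x. h x * f x ^ q)" if "continuous_on UNIV f" for f
      by (intro continuous_intros h that)
    show "(\<lambda>x. h x * w x ^ q) \<in> borel_measurable lborel"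
      using borel_measurable_continuous_onI[OF cc[OF w]] by simp
    show "(\<lambda>x. h x * conv (r n) w x ^ q) \<in> borel_measurable lborel" for n
      using borel_measurable_continuous_onI[OF cc[OF smooth_continuous[OF
            smooth_conv[OF mollifierD(1,2)[OF r[of n]] w]]]] by simp
    show "integrable lborel (\<lambda>x. \<bar>h x\<bar> * M ^ q)"
      by (intro integrable_mult_left integrable_abs integrable_csupp h)
    show "AE x in lborel. (\<lambda>n. h x * conv (r n) w x ^ q) \<longlonglongrightarrow> h x * w x ^ q"
      by (intro AE_I2 tendsto_intros conv_tendsto[OF r w])
    show "AE x in lborel. norm (h x * conv (r n) w x ^ q) \<le> \<bar>h x\<bar> * M ^ q" for n
    proof (rule AE_I2)
      fix x
      show "norm (h x * conv (r n) w x ^ q) \<le> \<bar>h x\<bar> * M ^ q"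
      proof (cases "R \<le> norm x")
        case True
        then show ?thesis using R by simp
      next
        case False
        then have "\<bar>conv (r n) w x\<bar> \<le> M"
          by (intro conv_bound[OF r[of n] _ w M(2)]) auto
        then show ?thesis
          by (simp add: abs_mult power_abs mult_left_mono power_mono)
      qed
    qed
  qed
qed

lemma uniform_oscillation:
  fixes w :: "real^3 \<Rightarrow> real"
  assumes w: "continuous_on UNIV w" and "\<eta> > 0"
  obtains \<delta> where "\<delta> > 0" "\<And>x k. norm x \<le> R \<Longrightarrow> norm k < \<delta> \<Longrightarrow> \<bar>w (x - k) - w x\<bar> \<le> \<eta>"
proof -
  have "uniformly_continuous_on (cball 0 (R + 1)) w"
    by (intro compact_uniformly_continuous continuous_on_subset[OF w]) auto
  then obtain \<delta> where \<delta>: "\<delta> > 0" "\<And>x y. x \<in> cball 0 (R + 1) \<Longrightarrow> y \<in> cball 0 (R + 1) \<Longrightarrow> dist y x < \<delta> \<Longrightarrow> dist (w y) (w x) < \<eta>"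
    using \<open>\<eta> > 0\<close> unfolding uniformly_continuous_on_def by blast
  show thesis
  proof (rule that[of "min \<delta> 1"])
    fix x k :: "real^3" assume x: "norm x \<le> R" and k: "norm k < min \<delta> 1"
    have "norm (x - k) \<le> R + 1" using norm_triangle_ineq4[of x k] x k by simp
    then show "\<bar>w (x - k) - w x\<bar> \<le> \<eta>"
      using \<delta>(2)[of x "x - k"] x k norm_minus_commute[of k x] by (auto simp: dist_norm)
  qed (use \<delta> in simp)
qed

text \<open>The weak form of \<open>div (w\<^sup>p B) = (d - p (c + d)) w\<^sup>p\<close>, given \<open>div B = d\<close> and
  \<open>div (w B) = - c w\<close>, up to a commutator: test with \<open>\<rho> * (\<phi> (\<rho> * w)\<^sup>p\<^sup>-\<^sup>1)\<close>.\<close>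

lemma mollified_power_identity:
  assumes \<rho>: "mollifier C \<epsilon> \<rho>" and B: "\<And>j. continuous_on UNIV (B j)" and div: "weak_div B d"
    and w: "continuous_on UNIV w" and \<phi>: "smooth \<phi>" "csupp \<phi>" and p: "p = Suc q"
    and G: "G = (\<lambda>x. \<phi> x * conv \<rho> w x ^ q)"
    and weak: "(LINT y|lborel. w y * (\<Sum>j\<in>UNIV. B j y * partial j (conv \<rho> G) y))
      = c * (LINT y|lborel. w y * conv \<rho> G y)"
  shows "(LINT x|lborel. (\<Sum>j\<in>UNIV. B j x * partial j \<phi> x) * conv \<rho> w x ^ p)
      = p * (LINT x|lborel. G x * commutator B d w \<rho> x)
        + p * d * (LINT x|lborel. (\<phi> x * w x) * conv \<rho> w x ^ q)
        + (p * c - d) * (LINT x|lborel. \<phi> x * conv \<rho> w x ^ p)"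
proof -
  note D = mollifierD[OF \<rho>]
  define W where "W = conv \<rho> w"
  have W: "smooth W" unfolding W_def by (intro smooth_conv D(1,2) w)
  have Gs: "smooth G" unfolding G W_def[symmetric] by (intro smooth_mult smooth_power \<phi> W)
  have Gc: "csupp G" unfolding G by (rule csupp_mono[OF \<phi>(2)]) simp
  note Gcont = smooth_continuous[OF Gs]
  have wB: "continuous_on UNIV (\<lambda>y. w y * B j y)" for j by (intro continuous_intros w B)
  have c\<rho>: "continuous_on UNIV (partial j \<rho>)" "csupp (partial j \<rho>)" "smooth (partial j \<rho>)" for j
    using D(1,2) by (blast intro: smooth_continuous smooth_partial csupp_partial)+
  have cont_c: "continuous_on UNIV (conv (partial j \<rho>) f)" if "continuous_on UNIV f" for f j
    by (intro smooth_continuous smooth_conv c\<rho> that)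
  have intG: "integrable lborel (\<lambda>x. G x * f x)" if "continuous_on UNIV f" for f
    by (intro integrable_csupp continuous_intros Gcont that csupp_mono[OF Gc]) simp
  have "(LINT y|lborel. w y * (\<Sum>j\<in>UNIV. B j y * partial j (conv \<rho> G) y))
      = (LINT y|lborel. (\<Sum>j\<in>UNIV. (w y * B j y) * conv (partial j \<rho>) G y))"
    by (simp add: partial_conv[OF D(1,2) Gcont] sum_distrib_left mult_ac)
  also have "\<dots> = (\<Sum>j\<in>UNIV. LINT y|lborel. (w y * B j y) * conv (partial j \<rho>) G y)"
  proof (intro Bochner_Integration.integral_sum integrable_csupp)
    fix j
    show "continuous_on UNIV (\<lambda>y. (w y * B j y) * conv (partial j \<rho>) G y)"
      by (intro continuous_intros w B cont_c Gcont)
    show "csupp (\<lambda>y. (w y * B j y) * conv (partial j \<rho>) G y)"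
      by (rule csupp_mono[OF csupp_conv[OF c\<rho>(2)[of j] Gc]]) simp
  qed
  also have "\<dots> = - (\<Sum>j\<in>UNIV. LINT x|lborel. G x * conv (partial j \<rho>) (\<lambda>y. w y * B j y) x)"
    unfolding sum_negf[symmetric]
    by (intro sum.cong refl conv_self_adjoint(2)[OF \<rho> wB Gcont Gc])
  \<comment> \<open>The definition of the commutator, solved for the mollified divergence: error,
    transport term and zeroth-order term.\<close>
  also have "(\<Sum>j\<in>UNIV. LINT x|lborel. G x * conv (partial j \<rho>) (\<lambda>y. w y * B j y) x)
      = (LINT x|lborel. G x * commutator B d w \<rho> x + G x * (\<Sum>j\<in>UNIV. B j x * partial j W x)
          + d * (G x * w x))"
    by (subst Bochner_Integration.integral_sum[symmetric])
       (auto intro!: intG cont_c wB simp: commutator_def W_def sum_distrib_left algebra_simps)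
  also have "\<dots> = (LINT x|lborel. G x * commutator B d w \<rho> x)
      + (LINT x|lborel. G x * (\<Sum>j\<in>UNIV. B j x * partial j W x)) + d * (LINT x|lborel. G x * w x)"
  proof -
    have cs: "continuous_on UNIV (\<lambda>x. \<Sum>j\<in>UNIV. B j x * partial j W x)"
      by (intro continuous_intros B smooth_continuous smooth_partial W)
    have "continuous_on UNIV (commutator B d w \<rho>)"
      unfolding commutator_def[abs_def] W_def[symmetric]
      by (intro continuous_intros cont_c wB w cs)
    from intG[OF this] intG[OF cs] intG[OF w] show ?thesis
      by (simp add: Bochner_Integration.integral_add Bochner_Integration.integrable_add)
  qed
  finally have 1: "c * (LINT y|lborel. w y * conv \<rho> G y)
      = - ((LINT x|lborel. G x * commutator B d w \<rho> x)
      + (LINT x|lborel. G x * (\<Sum>j\<in>UNIV. B j x * partial j W x)) + d * (LINT x|lborel. G x * w x))"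
    using weak by simp
  have 2: "(LINT y|lborel. w y * conv \<rho> G y) = (LINT x|lborel. \<phi> x * W x ^ p)"
    using conv_self_adjoint(1)[OF \<rho> w Gcont Gc] by (simp add: G W_def p mult_ac)
  have 3: "(LINT x|lborel. G x * w x) = (LINT x|lborel. (\<phi> x * w x) * W x ^ q)"
    by (simp add: G W_def mult_ac)
  \<comment> \<open>Since p W^q grad W = grad W^p, testing the divergence of \<open>B\<close> with
    \<phi> W^p eliminates the transport term; mollification was made for this, as \<open>W\<close>
    is smooth and w is not.\<close>
  have test: "smooth (\<lambda>x. \<phi> x * W x ^ p)" "csupp (\<lambda>x. \<phi> x * W x ^ p)"
    by (intro smooth_mult smooth_power \<phi> W, rule csupp_mono[OF \<phi>(2)]) simp
  have "(LINT x|lborel. (\<Sum>j\<in>UNIV. B j x * partial j (\<lambda>x. \<phi> x * W x ^ p) x))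
      = - d * (LINT x|lborel. \<phi> x * W x ^ p)"
    using div test unfolding weak_div_def by blast
  moreover have "(\<Sum>j\<in>UNIV. B j x * partial j (\<lambda>x. \<phi> x * W x ^ p) x)
      = real p * (G x * (\<Sum>j\<in>UNIV. B j x * partial j W x)) + (\<Sum>j\<in>UNIV. B j x * partial j \<phi> x) * W x ^ p" for x
    unfolding partial_mult[OF \<phi>(1) smooth_power[OF W]] partial_power[OF W]
    by (simp add: G W_def[symmetric] p sum.distrib sum_distrib_left sum_distrib_right algebra_simps)
  moreover have "integrable lborel (\<lambda>x. G x * (\<Sum>j\<in>UNIV. B j x * partial j W x))"
    by (intro intG continuous_intros B smooth_continuous smooth_partial W)
  moreover have "integrable lborel (\<lambda>x. (\<Sum>j\<in>UNIV. B j x * partial j \<phi> x) * W x ^ p)"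
  proof -
    have "integrable lborel (\<lambda>x. B j x * partial j \<phi> x * W x ^ p)" for j
      by (intro integrable_csupp continuous_intros B smooth_continuous smooth_partial W \<phi>(1)
          csupp_mono[OF csupp_partial[OF \<phi>(2), of j]]) simp
    then show ?thesis by (simp add: sum_distrib_right)
  qed
  ultimately have 4: "real p * (LINT x|lborel. G x * (\<Sum>j\<in>UNIV. B j x * partial j W x))
      + (LINT x|lborel. (\<Sum>j\<in>UNIV. B j x * partial j \<phi> x) * W x ^ p) = - d * (LINT x|lborel. \<phi> x * W x ^ p)"
    by (simp add: Bochner_Integration.integral_add)
  have "(LINT x|lborel. G x * (\<Sum>j\<in>UNIV. B j x * partial j W x))
      = - c * (LINT x|lborel. \<phi> x * W x ^ p) - (LINT x|lborel. G x * commutator B d w \<rho> x)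
        - d * (LINT x|lborel. (\<phi> x * w x) * W x ^ q)"
    using 1 unfolding 2 3 by simp
  with 4 show ?thesis
    unfolding W_def[symmetric] by (simp add: algebra_simps)
qed

text \<open>The limit of \<open>mollified_power_identity\<close> as the radius tends to 0. Test
  functions of the weak equation vanish on \<open>A\<close>; the margin \<open>e0\<close> between
  \<open>A\<close> and the support of \<phi> absorbs the spreading of supports by the outer
  mollification.\<close>

lemma transport_power:
  assumes B: "\<And>j. continuous_on UNIV (B j)" and div: "weak_div B d"
    and curl: "weak_curl B \<Omega>" "\<And>i j. continuous_on UNIV (\<Omega> i j)"
    and w: "continuous_on UNIV w" "axisym_scalar w"
    and weak: "\<And>\<psi>. smooth \<psi> \<Longrightarrow> csupp \<psi> \<Longrightarrow> axisym_scalar \<psi> \<Longrightarrow> (\<And>y. y \<in> A \<Longrightarrow> \<psi> y = 0) \<Longrightarrow>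
      (LINT y|lborel. w y * (\<Sum>j\<in>UNIV. B j y * partial j \<psi> y)) = c * (LINT y|lborel. w y * \<psi> y)"
    and \<phi>: "smooth \<phi>" "csupp \<phi>" "axisym_scalar \<phi>"
    and e0: "e0 > 0" "\<And>y a. a \<in> A \<Longrightarrow> norm (a - y) < e0 \<Longrightarrow> \<phi> y = 0"
    and p: "p \<ge> 1"
  shows "(LINT x|lborel. (\<Sum>j\<in>UNIV. B j x * partial j \<phi> x) * w x ^ p)
    = (p * (c + d) - d) * (LINT x|lborel. \<phi> x * w x ^ p)"
proof -
  obtain q where q: "p = Suc q" using p by (metis Suc_le_D One_nat_def)
  obtain C \<rho> where \<rho>: "\<And>\<epsilon>. \<epsilon> > 0 \<Longrightarrow> mollifier C \<epsilon> (\<rho> \<epsilon>)"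
    using mollifier_exists by metis
  define r where "r n = \<rho> (1 / real (Suc n))" for n
  have r: "mollifier C (1 / real (Suc n)) (r n)" for n
    unfolding r_def by (rule \<rho>) simp
  define G where "G n = (\<lambda>x. \<phi> x * conv (r n) w x ^ q)" for n
  define E where "E n = (LINT x|lborel. G n x * commutator B d w (r n) x)" for n
  have c\<phi>: "continuous_on UNIV \<phi>" using \<phi>(1) by (rule smooth_continuous)
  \<comment> \<open>This weight dominates every \<open>G n\<close> up to the factor
    \<open>M ^ q\<close>, so that one constant \<open>K\<close> serves all n.\<close>
  define g where "g x = \<bar>\<phi> x\<bar>" for x
  have g: "continuous_on UNIV g" "csupp g" "\<And>x. 0 \<le> g x"
    unfolding g_def using \<phi>(2) by (auto intro!: continuous_intros c\<phi> elim: csupp_mono)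
  obtain K0 where K0: "\<And>h j. norm h \<le> 1 \<Longrightarrow> (LINT x|lborel. g x * \<bar>B j (x + h) - B j x\<bar>) \<le> K0 * norm h"
    using field_modulus[OF B div curl g] by blast
  define K where "K = max K0 0"
  have K: "(LINT x|lborel. g x * \<bar>B j (x + h) - B j x\<bar>) \<le> K * norm h" if "norm h \<le> 1" for h j
    using K0[OF that, of j] mult_right_mono[of K0 K "norm h"] by (simp add: K_def)
  obtain R where R: "R > 0" "\<And>y. R \<le> norm y \<Longrightarrow> \<phi> y = 0" using csuppE[OF \<phi>(2)] by blast
  obtain M where M: "M \<ge> 0" "\<And>(j::3) y. norm y \<le> R + 1 \<Longrightarrow> \<bar>w y\<bar> \<le> M"
    by (rule continuous_bounded_on_cball[of "\<lambda>j. w"], rule w, rule that)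
  have Gg: "\<bar>G n x\<bar> \<le> M ^ q * g x" for n x
  proof (cases "R \<le> norm x")
    case True
    then show ?thesis using R by (simp add: G_def g_def)
  next
    case False
    then have "\<bar>conv (r n) w x\<bar> \<le> M"
      by (intro conv_bound[OF r[of n] _ w(1) M(2)]) auto
    then have "\<bar>\<phi> x\<bar> * \<bar>conv (r n) w x\<bar> ^ q \<le> \<bar>\<phi> x\<bar> * M ^ q"
      by (intro mult_left_mono power_mono) auto
    then show ?thesis
      by (simp add: G_def g_def abs_mult power_abs mult.commute)
  qed
  have C: "C \<ge> 0"
  proof -
    have "0 \<le> (LINT y|lborel. \<bar>partial 1 (r 0) y\<bar>)" by (intro Bochner_Integration.integral_nonneg) simp
    also have "\<dots> \<le> C" using mollifierD(6)[OF r[of 0], of 1] by simp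
    finally show ?thesis .
  qed
  have E: "E \<longlonglongrightarrow> 0"
  proof (rule LIMSEQ_I)
    fix e :: real assume e: "e > 0"
    \<comment> \<open>The added 1 keeps the denominator positive when the constant is 0 and makes
      the final bound strictly less than e.\<close>
    define \<eta> where "\<eta> = e / (M ^ q * (3 * (K * C)) + 1)"
    have nn: "M ^ q * (3 * (K * C)) \<ge> 0" using M C by (simp add: K_def)
    then have \<eta>: "\<eta> > 0" unfolding \<eta>_def using e by (intro divide_pos_pos) linarith+
    obtain \<delta> where \<delta>: "\<delta> > 0" "\<And>x k. norm x \<le> R \<Longrightarrow> norm k < \<delta> \<Longrightarrow> \<bar>w (x - k) - w x\<bar> \<le> \<eta>"
      by (rule uniform_oscillation[OF w(1) \<eta>], rule that)
    obtain N where N: "1 / real (Suc N) < \<delta>" using \<delta>(1) nat_approx_posE by blast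
    have "norm (E n - 0) < e" if n: "N \<le> n" for n
    proof -
      have small: "1 / real (Suc n) < \<delta>"
        using n N frac_le[of 1 1 "real (Suc N)" "real (Suc n)"] by simp
      have "\<bar>E n\<bar> \<le> M ^ q * \<eta> * (3 * (K * C))"
        unfolding E_def
      proof (rule commutator_bound[OF r _ _ B div w(1) g K])
        show "\<bar>w (x - k) - w x\<bar> \<le> \<eta>" if "g x \<noteq> 0" "norm k \<le> 1 / real (Suc n)" for x k
        proof (rule \<delta>(2))
          show "norm x \<le> R" using that(1) R(2)[of x] by (force simp: g_def)
        qed (use that(2) small in linarith)
      qed (use Gg \<eta> M in \<open>auto simp: K_def\<close>)
      also have "\<dots> < e"
      proof -
        have "M ^ q * \<eta> * (3 * (K * C)) = e * ((M ^ q * (3 * (K * C))) / (M ^ q * (3 * (K * C)) + 1))"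
          by (simp add: \<eta>_def)
        also have "\<dots> < e * 1"
        proof (rule mult_strict_left_mono[OF _ e])
          have "a / (a + 1) < 1" if "a \<ge> 0" for a :: real
            using that by simp
          then show "(M ^ q * (3 * (K * C))) / (M ^ q * (3 * (K * C)) + 1) < 1"
            using nn by blast
        qed
        finally show ?thesis by simp
      qed
      finally show ?thesis by simp
    qed
    then show "\<exists>N. \<forall>n\<ge>N. norm (E n - 0) < e" by blast
  qed
  define S where "S x = (\<Sum>j\<in>UNIV. B j x * partial j \<phi> x)" for x
  have S: "continuous_on UNIV S" "csupp S"
  proof -
    show "continuous_on UNIV S"
      unfolding S_def by (intro continuous_intros B smooth_continuous smooth_partial \<phi>)
    show "csupp S"
    proof (rule csuppI[of "R + 1"])
      fix y :: "real^3" assume "R + 1 \<le> norm y"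
      then have "partial j \<phi> y = 0" for j using R by (intro partial_zero_outside[of R]) auto
      then show "S y = 0" by (simp add: S_def)
    qed
  qed
  have id: "(LINT x|lborel. S x * conv (r n) w x ^ p) = p * E n
      + p * d * (LINT x|lborel. (\<phi> x * w x) * conv (r n) w x ^ q)
      + (p * c - d) * (LINT x|lborel. \<phi> x * conv (r n) w x ^ p)" if n: "1 / real (Suc n) \<le> e0" for n
    unfolding S_def E_def
  proof (rule mollified_power_identity[OF r B div w(1) \<phi>(1,2) q G_def])
    note D = mollifierD[OF r[of n]]
    have Ws: "smooth (conv (r n) w)" by (intro smooth_conv D(1,2) w)
    have Gs: "smooth (G n)"
      unfolding G_def by (intro smooth_mult smooth_power \<phi> Ws)
    have Gc: "csupp (G n)" unfolding G_def by (rule csupp_mono[OF \<phi>(2)]) simp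
    have Ga: "axisym_scalar (G n)"
      using conv_axisym[OF r w] \<phi>(3) unfolding G_def axisym_scalar_def by simp
    show "(LINT y|lborel. w y * (\<Sum>j\<in>UNIV. B j y * partial j (conv (r n) (G n)) y))
        = c * (LINT y|lborel. w y * conv (r n) (G n) y)"
    proof (rule weak)
      show "smooth (conv (r n) (G n))" by (intro smooth_conv D(1,2) smooth_continuous Gs)
      show "csupp (conv (r n) (G n))" by (intro csupp_conv D(2) Gc)
      show "axisym_scalar (conv (r n) (G n))"
        by (intro conv_axisym[OF r] smooth_continuous Gs Ga)
      fix a assume "a \<in> A"
      show "conv (r n) (G n) a = 0"
      proof (rule conv_local[OF D(4)])
        fix y assume "norm (a - y) < 1 / real (Suc n)"
        then have "\<phi> y = 0" using e0(2)[OF \<open>a \<in> A\<close>, of y] n by simp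
        then show "G n y = 0" by (simp add: G_def)
      qed
    qed
  qed
  have "(\<lambda>n. p * E n + p * d * (LINT x|lborel. (\<phi> x * w x) * conv (r n) w x ^ q)
        + (p * c - d) * (LINT x|lborel. \<phi> x * conv (r n) w x ^ p))
      \<longlonglongrightarrow> real p * 0 + p * d * (LINT x|lborel. (\<phi> x * w x) * w x ^ q) + (p * c - d) * (LINT x|lborel. \<phi> x * w x ^ p)"
  proof -
    have "continuous_on UNIV (\<lambda>x. \<phi> x * w x)" "csupp (\<lambda>x. \<phi> x * w x)"
      by (intro continuous_intros c\<phi> w(1), rule csupp_mono[OF \<phi>(2)]) simp
    then show ?thesis
      by (intro tendsto_add tendsto_mult_left E conv_power_limit[OF r w(1)] c\<phi> \<phi>(2))
  qed
  moreover have "\<forall>\<^sub>F n in sequentially. p * E n + p * d * (LINT x|lborel. (\<phi> x * w x) * conv (r n) w x ^ q)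
        + (p * c - d) * (LINT x|lborel. \<phi> x * conv (r n) w x ^ p)
      = (LINT x|lborel. S x * conv (r n) w x ^ p)"
  proof -
    obtain N where N: "1 / real (Suc N) < e0" using e0(1) nat_approx_posE by blast
    have "1 / real (Suc n) \<le> e0" if "N \<le> n" for n
      using that N frac_le[of 1 1 "real (Suc N)" "real (Suc n)"] by simp
    then show ?thesis
      unfolding eventually_sequentially by (intro exI[of _ N] allI impI id[symmetric])
  qed
  ultimately have "(\<lambda>n. LINT x|lborel. S x * conv (r n) w x ^ p)
      \<longlonglongrightarrow> real p * 0 + p * d * (LINT x|lborel. (\<phi> x * w x) * w x ^ q) + (p * c - d) * (LINT x|lborel. \<phi> x * w x ^ p)"
    by (rule Lim_transform_eventually)
  then have "(LINT x|lborel. S x * w x ^ p)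
      = real p * 0 + p * d * (LINT x|lborel. (\<phi> x * w x) * w x ^ q) + (p * c - d) * (LINT x|lborel. \<phi> x * w x ^ p)"
    using conv_power_limit[OF r w(1) S, of p] by (rule LIMSEQ_unique[rotated])
  also have "(LINT x|lborel. (\<phi> x * w x) * w x ^ q) = (LINT x|lborel. \<phi> x * w x ^ p)"
    by (simp add: q mult_ac)
  finally show ?thesis
    by (simp add: S_def algebra_simps)
qed

section \<open>A Liouville theorem\<close>

text \<open>A smooth substitute for spherical means. As grad \<psi> = P y, the derivative in
  \<open>R\<close> of the left side is the integral of grad g(x + R y) . grad \<psi>, which
  integration by parts turns into one of the Laplacian. So the left side keeps its value at R =
  0.\<close>

lemma harmonic_mean_value:
  fixes g \<psi> P :: "real^3 \<Rightarrow> real"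
  assumes g: "smooth g" and harm: "\<And>x. (\<Sum>j\<in>UNIV. partial j (partial j g) x) = 0"
    and \<psi>: "smooth \<psi>" "csupp \<psi>" and P: "continuous_on UNIV P" "csupp P"
    and \<psi>P: "\<And>j y. partial j \<psi> y = y $ j * P y"
  shows "(LINT y|lborel. g (x + R *\<^sub>R y) * P y) = g x * (LINT y|lborel. P y)"
proof -
  have ca: "continuous_on UNIV (\<lambda>y. f (x + c *\<^sub>R y))" if "continuous_on UNIV f" for f :: "real^3 \<Rightarrow> real" and c
    by (intro continuous_on_compose2[OF that] continuous_intros) auto
  \<comment> \<open>The derivative in the scale \<open>c\<close> vanishes: integration by parts
    produces the Laplacian of \<open>g\<close> at x + c y.\<close>
  have zero: "(LINT y|lborel. (\<Sum>j\<in>UNIV. partial j g (x + c *\<^sub>R y) * (y $ j * P y))) = 0" for c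
  proof -
    note sa = smooth_affine[OF smooth_partial[OF g], of _ x c]
    have int: "integrable lborel (\<lambda>y. partial j g (x + c *\<^sub>R y) * partial j \<psi> y)" for j
      by (intro integrable_smooth_mult sa smooth_partial csupp_partial \<psi>)
    have int2: "integrable lborel (\<lambda>y. partial j (\<lambda>y. partial j g (x + c *\<^sub>R y)) y * \<psi> y)" for j
      by (intro integrable_smooth_mult sa smooth_partial \<psi>)
    have "(LINT y|lborel. (\<Sum>j\<in>UNIV. partial j g (x + c *\<^sub>R y) * (y $ j * P y)))
        = (\<Sum>j\<in>UNIV. LINT y|lborel. partial j g (x + c *\<^sub>R y) * partial j \<psi> y)"
      using int by (simp add: Bochner_Integration.integral_sum \<psi>P)
    also have "\<dots> = (\<Sum>j\<in>UNIV. - (LINT y|lborel. partial j (\<lambda>y. partial j g (x + c *\<^sub>R y)) y * \<psi> y))"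
      by (intro sum.cong refl integration_by_parts sa \<psi>)
    also have "\<dots> = - (LINT y|lborel. (\<Sum>j\<in>UNIV. partial j (\<lambda>y. partial j g (x + c *\<^sub>R y)) y * \<psi> y))"
      using int2 by (simp add: Bochner_Integration.integral_sum sum_negf)
    also have "\<dots> = 0"
    proof -
      have "(\<Sum>j\<in>UNIV. partial j (\<lambda>y. partial j g (x + c *\<^sub>R y)) y * \<psi> y) = 0" for y
      proof -
        have "(\<Sum>j\<in>UNIV. partial j (\<lambda>y. partial j g (x + c *\<^sub>R y)) y * \<psi> y)
            = c * (\<Sum>j\<in>UNIV. partial j (partial j g) (x + c *\<^sub>R y)) * \<psi> y"
          by (simp add: partial_affine[OF smooth_differentiable[OF smooth_partial[OF g]]]
              sum_distrib_left sum_distrib_right mult.assoc)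
        then show ?thesis by (simp add: harm)
      qed
      then show ?thesis by simp
    qed
    finally show ?thesis .
  qed
  let ?F = "\<lambda>(y, t). indicator {0..1::real} t * (\<Sum>j\<in>UNIV. partial j g (x + t *\<^sub>R R *\<^sub>R y) * (y $ j * P y))"
  obtain R0 where R0: "R0 > 0" "\<And>y. R0 \<le> norm y \<Longrightarrow> P y = 0" using csuppE[OF P(2)] by blast
  define H where "H = (\<lambda>p. \<Sum>j\<in>UNIV. partial j g (x + snd p *\<^sub>R R *\<^sub>R fst p) * (fst p $ j * P (fst p)))"
  have cH: "continuous_on UNIV H"
    unfolding H_def
    by (intro continuous_intros continuous_on_compose2[OF smooth_continuous[OF smooth_partial[OF g]]]
        continuous_on_compose2[OF P(1)]) auto
  have intF: "integrable lborel ?F"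
  proof -
    have "integrable lborel (\<lambda>p. indicator (cball 0 R0 \<times> {0..1}) p *\<^sub>R H p)"
      by (intro borel_integrable_compact compact_Times continuous_on_subset[OF cH]) auto
    moreover have "indicator (cball 0 R0 \<times> {0..1}) p *\<^sub>R H p = ?F p" for p
    proof -
      obtain y t where p: "p = (y, t)" by fastforce
      show ?thesis
      proof (cases "norm y \<le> R0")
        case True
        then show ?thesis by (simp add: p H_def indicator_def)
      next
        case False
        then have "P y = 0" using R0 by simp
        then show ?thesis by (simp add: p H_def)
      qed
    qed
    ultimately show ?thesis by simp
  qed
  have "(LINT y|lborel. (g (x + R *\<^sub>R y) - g x) * P y)
      = (LINT y|lborel. R * (LINT t|lborel. indicator {0..1::real} t *
          (\<Sum>j\<in>UNIV. partial j g (x + t *\<^sub>R R *\<^sub>R y) * (y $ j * P y))))"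
  proof (rule Bochner_Integration.integral_cong[OF refl])
    fix y
    have c: "continuous_on {0..1} (\<lambda>t. partial j g (x + t *\<^sub>R R *\<^sub>R y))" for j
      by (intro continuous_on_compose2[OF smooth_continuous[OF smooth_partial[OF g]]] continuous_intros) auto
    have int: "integrable lborel (\<lambda>t. indicator {0..1::real} t * partial j g (x + t *\<^sub>R R *\<^sub>R y))" for j
      using borel_integrable_compact[OF _ c] by simp
    have "(LINT t|lborel. indicator {0..1::real} t * (\<Sum>j\<in>UNIV. partial j g (x + t *\<^sub>R R *\<^sub>R y) * (y $ j * P y)))
        = (LINT t|lborel. (\<Sum>j\<in>UNIV. (indicator {0..1::real} t * partial j g (x + t *\<^sub>R R *\<^sub>R y)) * (y $ j * P y)))"
      by (simp add: sum_distrib_left mult_ac)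
    also have "\<dots> = (\<Sum>j\<in>UNIV. (LINT t|lborel. indicator {0..1::real} t * partial j g (x + t *\<^sub>R R *\<^sub>R y)) * (y $ j * P y))"
      using int by (subst Bochner_Integration.integral_sum) (auto intro!: integrable_mult_left simp del: mult_eq_0_iff)
    finally show "(g (x + R *\<^sub>R y) - g x) * P y = R * (LINT t|lborel. indicator {0..1::real} t *
          (\<Sum>j\<in>UNIV. partial j g (x + t *\<^sub>R R *\<^sub>R y) * (y $ j * P y)))"
      unfolding smooth_FTC[OF g, of x "R *\<^sub>R y"]
      by (simp add: sum_distrib_left sum_distrib_right mult_ac)
  qed
  also have "\<dots> = R * (LINT y|lborel. LINT t|lborel. indicator {0..1::real} t *
          (\<Sum>j\<in>UNIV. partial j g (x + t *\<^sub>R R *\<^sub>R y) * (y $ j * P y)))"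
    by (rule integral_mult_right_zero)
  also have "\<dots> = R * (LINT t|lborel. LINT y|lborel. indicator {0..1::real} t *
          (\<Sum>j\<in>UNIV. partial j g (x + t *\<^sub>R R *\<^sub>R y) * (y $ j * P y)))"
    using lborel_Fubini(1)[OF intF] unfolding prod.case by (simp only:)
  also have "\<dots> = 0"
    using zero[of "t * R" for t] by simp
  finally have "(LINT y|lborel. (g (x + R *\<^sub>R y) - g x) * P y) = 0" .
  moreover have "integrable lborel (\<lambda>y. g (x + R *\<^sub>R y) * P y)"
    by (intro integrable_csupp continuous_intros ca smooth_continuous[OF g] P csupp_mono[OF P(2)]) simp
  moreover have "integrable lborel (\<lambda>y. g x * P y)"
    by (intro integrable_mult_right integrable_csupp P)
  ultimately show ?thesis
    by (simp add: left_diff_distrib Bochner_Integration.integral_diff)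
qed

text \<open>The mean value property for the harmonic function D_i f, integrated by parts, puts a
  factor 1/R in front of values of \<open>f\<close> at distance O(R). These are at most 3 \<eta> R
  for suitable \<open>R\<close>, so D_i f is O(\<eta>) for every \<eta>.\<close>

lemma harmonic_sublinear_gradient:
  fixes f :: "real^3 \<Rightarrow> real"
  assumes f: "smooth f" and harm: "\<And>x. (\<Sum>j\<in>UNIV. partial j (partial j f) x) = 0"
    and growth: "\<And>\<eta>. \<eta> > 0 \<Longrightarrow> \<exists>M. \<forall>y. \<bar>f y\<bar> \<le> \<eta> * norm y + M"
  shows "partial i f x = 0"
proof -
  define \<psi> :: "real^3 \<Rightarrow> real" where "\<psi> y = step (3 - y \<bullet> y)" for y
  define P :: "real^3 \<Rightarrow> real" where "P y = - 2 * bump (3 - y \<bullet> y)" for y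
  have sq: "smooth (\<lambda>y::real^3. 3 - y \<bullet> y)" by (intro smooth_diff smooth_const smooth_norm_sq)
  have \<psi>: "smooth \<psi>" unfolding \<psi>_def by (rule smooth_step[OF sq])
  have P: "smooth P" unfolding P_def by (intro smooth_cmult smooth_bump sq)
  have large: "3 - y \<bullet> y \<le> 1" if "2 \<le> norm y" for y :: "real^3"
    using power_mono[OF that, of 2] by (simp add: dot_square_norm)
  have c\<psi>: "csupp \<psi>" by (rule csuppI[of 2]) (simp add: \<psi>_def step_zero large)
  have cP: "csupp P" by (rule csuppI[of 2]) (simp add: P_def bump_zero large)
  have psq: "partial j (\<lambda>y::real^3. 3 - y \<bullet> y) = (\<lambda>y. - (2 * y $ j))" for j
    using partial_add[OF smooth_differentiable[OF smooth_const[of "3::real"]]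
        smooth_differentiable[OF smooth_uminus[OF smooth_norm_sq]], of j]
    by (simp add: partial_const partial_uminus[OF smooth_norm_sq] partial_norm_sq)
  have \<psi>P: "partial j \<psi> y = y $ j * P y" for j y
    unfolding \<psi>_def partial_step[OF sq] psq P_def by simp
  define c where "c = (LINT y|lborel. P y)"
  have "c \<noteq> 0"
  proof
    assume "c = 0"
    then have "(LINT y|lborel. bump (3 - y \<bullet> (y::real^3))) = 0"
      by (simp add: c_def P_def)
    moreover have "csupp (\<lambda>y::real^3. bump (3 - y \<bullet> y))"
      by (rule csuppI[of 2]) (simp add: bump_zero large)
    ultimately have "bump (3 - y \<bullet> y) = 0" for y :: "real^3"
      by (intro integral_nonpos_imp_zero[of "\<lambda>y. bump (3 - y \<bullet> y)"] smooth_continuous smooth_bump sq)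
         (auto simp: bump_nonneg)
    \<comment> \<open>At this point |y|^2 = 3/2, and the argument of \<open>bump\<close> is 3/2, the
      midpoint of its support.\<close>
    from this[of "sqrt (3 / 2) *\<^sub>R axis 1 1"] show False
      using bump_pos[of "3 / 2"] by (simp add: inner_axis)
  qed
  define L where "L = (LINT y|lborel. \<bar>partial i P y\<bar>)"
  have L: "L \<ge> 0" unfolding L_def by (intro Bochner_Integration.integral_nonneg) simp
  have key: "\<bar>partial i f x * c\<bar> \<le> 3 * L * \<eta>" if \<eta>: "\<eta> > 0" for \<eta>
  proof -
    obtain M where M: "\<And>y. \<bar>f y\<bar> \<le> \<eta> * norm y + M" using growth[OF \<eta>] by blast
    have M0: "M \<ge> 0" using M[of 0] by simp
    \<comment> \<open>Large enough for |x| + M / \<eta> \<le> R, whence \<eta> (|x| + 2 R) + M \<le>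
      3 \<eta> R on the support of \<open>P\<close>.\<close>
    define R where "R = norm x + M / \<eta> + 1"
    have R: "R > 0" using \<eta> M0 by (simp add: R_def add_nonneg_pos)
    have harm': "(\<Sum>j\<in>UNIV. partial j (partial j (partial i f)) z) = 0" for z
    proof -
      have "partial j (partial j (partial i f)) z = partial i (partial j (partial j f)) z" for j
      proof -
        have "partial j (partial i f) = partial i (partial j f)"
          by (rule ext) (rule partial_partial_commute[OF f])
        then show ?thesis by (simp add: partial_partial_commute[OF smooth_partial[OF f]])
      qed
      moreover have "(\<Sum>j\<in>UNIV. partial i (partial j (partial j f)) z)
          = partial i (\<lambda>z. \<Sum>j\<in>UNIV. partial j (partial j f) z) z"
        by (simp add: sum_3 partial_add smooth_differentiable smooth_add smooth_partial f)
      moreover have "(\<lambda>z. \<Sum>j\<in>UNIV. partial j (partial j f) z) = (\<lambda>z. 0)"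
        using harm by blast
      ultimately show ?thesis by (simp add: partial_const)
    qed
    have "partial i f x * c = (LINT y|lborel. partial i f (x + R *\<^sub>R y) * P y)"
      unfolding c_def
      by (rule harmonic_mean_value[OF smooth_partial[OF f] harm' \<psi> c\<psi> smooth_continuous[OF P] cP \<psi>P, symmetric])
    then have "R * (partial i f x * c) = (LINT y|lborel. partial i (\<lambda>y. f (x + R *\<^sub>R y)) y * P y)"
      by (simp add: partial_affine[OF smooth_differentiable[OF f]] mult.assoc)
    also have "\<dots> = - (LINT y|lborel. f (x + R *\<^sub>R y) * partial i P y)"
      using integration_by_parts[OF smooth_affine[OF f] P cP, of x R i] by simp
    finally have "\<bar>R * (partial i f x * c)\<bar> = \<bar>LINT y|lborel. f (x + R *\<^sub>R y) * partial i P y\<bar>"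
      by simp
    also have "\<dots> \<le> (LINT y|lborel. \<bar>f (x + R *\<^sub>R y) * partial i P y\<bar>)"
      using integral_norm_bound[of lborel "\<lambda>y. f (x + R *\<^sub>R y) * partial i P y"] by simp
    also have "\<dots> \<le> (LINT y|lborel. (3 * \<eta> * R) * \<bar>partial i P y\<bar>)"
    proof (rule integral_mono')
      show "integrable lborel (\<lambda>y. (3 * \<eta> * R) * \<bar>partial i P y\<bar>)"
        by (intro integrable_mult_right integrable_abs integrable_csupp smooth_continuous
            smooth_partial csupp_partial P cP)
      fix y
      show "0 \<le> (3 * \<eta> * R) * \<bar>partial i P y\<bar>" using \<eta> R by simp
      show "\<bar>f (x + R *\<^sub>R y) * partial i P y\<bar> \<le> (3 * \<eta> * R) * \<bar>partial i P y\<bar>"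
      proof (cases "2 < norm y")
        case True
        then have "partial i P y = 0"
          by (intro partial_zero_outside[of 2]) (simp_all add: P_def bump_zero large)
        then show ?thesis by simp
      next
        case False
        have "norm (x + R *\<^sub>R y) \<le> norm x + R * norm y"
          using norm_triangle_ineq[of x "R *\<^sub>R y"] R by simp
        also have "\<dots> \<le> norm x + R * 2" using False R by simp
        finally have "\<eta> * norm (x + R *\<^sub>R y) \<le> \<eta> * (norm x + R * 2)"
          using \<eta> by (intro mult_left_mono) auto
        then have "\<bar>f (x + R *\<^sub>R y)\<bar> \<le> \<eta> * (norm x + R * 2) + M"
          using M[of "x + R *\<^sub>R y"] by linarith
        also have "\<dots> \<le> 3 * \<eta> * R"
          using \<eta> by (simp add: R_def algebra_simps)
        finally show ?thesis
          unfolding abs_mult by (rule mult_right_mono) simp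
      qed
    qed
    also have "\<dots> = 3 * \<eta> * R * L" by (simp add: L_def)
    finally have "R * \<bar>partial i f x * c\<bar> \<le> R * (3 * L * \<eta>)"
      using R by (simp add: abs_mult mult_ac)
    then show ?thesis using R by simp
  qed
  have "\<bar>partial i f x * c\<bar> \<le> 0"
  proof (rule field_le_epsilon)
    fix e :: real assume e: "e > 0"
    have "3 * L * (e / (3 * L + 1)) \<le> e"
      using e L by (simp add: divide_simps mult_left_mono)
    then show "\<bar>partial i f x * c\<bar> \<le> 0 + e"
      using key[of "e / (3 * L + 1)"] e L by (simp add: add_nonneg_pos)
  qed
  then show ?thesis using \<open>c \<noteq> 0\<close> by simp
qed

text \<open>Mollified components are harmonic: the vanishing curl exchanges indices, and the
  Laplacian of f_k becomes D_k of the divergence. Mollification adds only \<eta> to the constant of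
  the growth bound, so each mollification is constant, and so is the limit.\<close>

lemma liouville:
  fixes F :: "3 \<Rightarrow> real^3 \<Rightarrow> real"
  assumes F: "\<And>j. continuous_on UNIV (F j)" and div: "weak_div F 0"
    and curl: "weak_curl F (\<lambda>i j y. 0)"
    and growth: "\<And>\<eta>. \<eta> > 0 \<Longrightarrow> \<exists>M. \<forall>j y. \<bar>F j y\<bar> \<le> \<eta> * norm y + M"
  shows "F k x = F k 0"
proof -
  obtain C \<rho> where \<rho>: "\<And>\<epsilon>. \<epsilon> > 0 \<Longrightarrow> mollifier C \<epsilon> (\<rho> \<epsilon>)"
    using mollifier_exists by metis
  define r where "r n = \<rho> (1 / real (Suc n))" for n
  have r: "mollifier C (1 / real (Suc n)) (r n)" for n
    unfolding r_def by (rule \<rho>) simp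
  have const: "conv (r n) (F k) x = conv (r n) (F k) 0" for n
  proof -
    define f where "f j = conv (r n) (F j)" for j
    have f: "smooth (f j)" for j
      unfolding f_def by (intro smooth_conv mollifierD(1,2)[OF r] F)
    have dv: "(\<lambda>z. \<Sum>j\<in>UNIV. partial j (f j) z) = (\<lambda>z. 0)"
      unfolding f_def by (rule ext) (rule weak_div_conv[OF r F div])
    have cu: "partial i (f j) = partial j (f i)" for i j
      using weak_curl_conv[OF r[of n] F curl, of i j] unfolding f_def
      by (intro ext) (simp add: conv_def)
    have harm: "(\<Sum>j\<in>UNIV. partial j (partial j (f k)) z) = 0" for z
    proof -
      have "(\<Sum>j\<in>UNIV. partial j (partial j (f k)) z) = (\<Sum>j\<in>UNIV. partial k (partial j (f j)) z)"
        by (intro sum.cong refl) (simp add: cu[of _ k] partial_partial_commute[OF f])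
      also have "\<dots> = partial k (\<lambda>z. \<Sum>j\<in>UNIV. partial j (f j) z) z"
        by (simp add: sum_3 partial_add smooth_differentiable smooth_add smooth_partial f)
      finally show ?thesis by (simp add: dv partial_const)
    qed
    have gr: "\<exists>M. \<forall>y. \<bar>f k y\<bar> \<le> \<eta> * norm y + M" if \<eta>: "\<eta> > 0" for \<eta>
    proof -
      obtain M where M: "\<And>j y. \<bar>F j y\<bar> \<le> \<eta> * norm y + M" using growth[OF \<eta>] by blast
      have "\<bar>f k y\<bar> \<le> \<eta> * norm y + (\<eta> + M)" for y
        unfolding f_def
      proof (rule conv_bound[OF r _ F])
        show "\<bar>F k z\<bar> \<le> \<eta> * norm y + (\<eta> + M)" if "norm z \<le> norm y + 1" for z
          using M[of k z] mult_left_mono[OF that, of \<eta>] \<eta> by (simp add: algebra_simps)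
      qed auto
      then show ?thesis by blast
    qed
    have "partial i (f k) z = 0" for i z
      by (rule harmonic_sublinear_gradient[OF f harm gr])
    then show ?thesis
      using smooth_FTC[OF f, of k 0 x] by (simp add: f_def)
  qed
  have "(\<lambda>n. conv (r n) (F k) x) \<longlonglongrightarrow> F k 0"
    using conv_tendsto[OF r F, of k 0] unfolding const .
  then show ?thesis
    using conv_tendsto[OF r F, of k x] LIMSEQ_unique by blast
qed

section \<open>Weak equations for circulation and potential vorticity\<close>

lemma smooth_vector3:
  assumes "smooth f" "smooth g" "smooth h"
  shows "smooth (\<lambda>y. vector [f y, g y, h y] :: real^3)"
    and "partial i (\<lambda>y. vector [f y, g y, h y] :: real^3) y
      = vector [partial i f y, partial i g y, partial i h y]"
proof -
  have eq: "(\<lambda>y. vector [f y, g y, h y] :: real^3)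
      = (\<lambda>y. \<chi> j. (if j = 1 then f else if j = 2 then g else h) y)"
    by (rule ext) (simp add: vec_eq_iff forall_3 vector_3)
  have s: "smooth (if j = 1 then f else if j = 2 then g else h)" for j :: 3
    using assms by simp
  show "smooth (\<lambda>y. vector [f y, g y, h y] :: real^3)"
    unfolding eq by (rule smooth_vec_lambda[OF s])
  show "partial i (\<lambda>y. vector [f y, g y, h y] :: real^3) y
      = vector [partial i f y, partial i g y, partial i h y]"
    unfolding eq partial_vec_lambda(1)[OF smooth_differentiable[OF s]]
    by (simp add: vec_eq_iff forall_3 vector_3)
qed

lemma csupp_vector3:
  assumes "csupp f" "csupp g" "csupp h"
  shows "csupp (\<lambda>y. vector [f y, g y, h y] :: real^3)"
proof -
  have "csupp (\<lambda>y. (f y, g y))"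
    by (rule csupp_sum2[OF assms(1,2)]) (simp add: zero_prod_def)
  then show ?thesis
    using assms(3) by (rule csupp_sum2) (simp add: vec_eq_iff forall_3 vector_3 zero_prod_def)
qed

lemma partial_component_mult:
  assumes "smooth \<psi>"
  shows "partial i (\<lambda>y. y $ k * \<psi> y) = (\<lambda>y. y $ k * partial i \<psi> y + (if i = k then \<psi> y else 0))"
  unfolding partial_mult[OF smooth_component assms] partial_component by auto

lemma partial_zero_open:
  assumes "open S" "y \<in> S" "\<And>x. x \<in> S \<Longrightarrow> f x = 0"
  shows "partial i f y = 0"
proof -
  have "(f has_derivative (\<lambda>h. 0)) (at y)"
    by (rule has_derivative_transform_within_open[OF has_derivative_const[of 0] assms(1,2)])
       (use assms(3) in simp)
  then show ?thesis by (simp add: partial_eqI)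
qed

text \<open>The angular derivative of an axisymmetric function vanishes; \<open>J\<close> is the
  velocity of the rotation at angle 0.\<close>

lemma axisym_partial:
  assumes \<psi>: "smooth \<psi>" "axisym_scalar \<psi>"
  shows "y $ 1 * partial 2 \<psi> y = y $ 2 * partial 1 \<psi> y"
proof -
  define J :: "real^3" where "J = vector [- (y $ 2), y $ 1, 0]"
  have rot0: "rot_z 0 y = y"
    by (simp add: rot_z_def vec_eq_iff forall_3 vector_3)
  have "((\<lambda>t. rot_z t y) has_derivative (\<lambda>s. s *\<^sub>R J)) (at 0)"
  proof (rule has_derivative_componentwise_within[THEN iffD2], rule ballI)
    fix b :: "real^3" assume "b \<in> Basis"
    then obtain k where b: "b = axis k 1" by (auto simp: Basis_vec_def)
    have "((\<lambda>t. rot_z t y $ k) has_derivative (\<lambda>s. s * J $ k)) (at 0)"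
      using exhaust_3[of k]
      by (auto simp: rot_z_def J_def vector_3 intro!: derivative_eq_intros)
    then show "((\<lambda>t. rot_z t y \<bullet> b) has_derivative (\<lambda>s. s *\<^sub>R J \<bullet> b)) (at 0)"
      by (simp add: b inner_axis)
  qed
  from diff_chain_at[OF this smooth_has_derivative[OF \<psi>(1)]]
  have "((\<lambda>t. \<psi> (rot_z t y)) has_derivative (\<lambda>s. \<Sum>i\<in>UNIV. (s *\<^sub>R J) $ i *\<^sub>R partial i \<psi> y)) (at 0)"
    by (simp add: o_def rot0)
  moreover have "(\<lambda>t. \<psi> (rot_z t y)) = (\<lambda>t. \<psi> y)"
    using \<psi>(2) by (simp add: axisym_scalar_def)
  ultimately have "((\<lambda>t. \<psi> y) has_derivative (\<lambda>s. \<Sum>i\<in>UNIV. (s *\<^sub>R J) $ i *\<^sub>R partial i \<psi> y)) (at (0::real))"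
    by (simp only:)
  from has_derivative_unique[OF this has_derivative_const]
  have "(\<lambda>s. \<Sum>i\<in>UNIV. (s *\<^sub>R J) $ i *\<^sub>R partial i \<psi> y) = (\<lambda>s::real. 0)" .
  from fun_cong[OF this, of 1] show ?thesis
    by (simp add: sum_3 J_def vector_3)
qed

section \<open>The equation of the circulation\<close>

lemma inner_real3: "(x::real^3) \<bullet> y = x $ 1 * y $ 1 + x $ 2 * y $ 2 + x $ 3 * y $ 3"
  by (simp add: inner_vec_def sum_3)

text \<open>This is \<open>r \<psi> e_\<theta>\<close>, in Cartesian coordinates so that it is
  smooth across the axis.\<close>

definition swirl_field :: "(real^3 \<Rightarrow> real) \<Rightarrow> real^3 \<Rightarrow> real^3" where
  "swirl_field \<psi> y = vector [- (y $ 2 * \<psi> y), y $ 1 * \<psi> y, 0]"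

lemma swirl_field_test:
  assumes "smooth \<psi>" "csupp \<psi>"
  shows "test_function (swirl_field \<psi>)"
    and "partial i (swirl_field \<psi>) y = vector [- (y $ 2 * partial i \<psi> y + (if i = 2 then \<psi> y else 0)),
      y $ 1 * partial i \<psi> y + (if i = 1 then \<psi> y else 0), 0]"
proof -
  have s: "smooth (\<lambda>y. y $ k * \<psi> y)" for k by (intro smooth_mult smooth_component assms)
  have "csupp (swirl_field \<psi>)"
    by (rule csupp_mono[OF assms(2)]) (simp add: swirl_field_def vec_eq_iff forall_3 vector_3)
  then show "test_function (swirl_field \<psi>)"
    unfolding test_function_iff swirl_field_def[abs_def]
    by (intro conjI smooth_vector3 smooth_uminus s smooth_const)
  show "partial i (swirl_field \<psi>) y = vector [- (y $ 2 * partial i \<psi> y + (if i = 2 then \<psi> y else 0)),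
      y $ 1 * partial i \<psi> y + (if i = 1 then \<psi> y else 0), 0]"
    unfolding swirl_field_def[abs_def] smooth_vector3(2)[OF smooth_uminus[OF s] s smooth_const]
      partial_uminus[OF s] partial_component_mult[OF assms(1)] partial_const ..
qed

lemma curl_swirl_field:
  assumes "smooth \<psi>" "csupp \<psi>"
  shows "curl (swirl_field \<psi>) y = vector [- (y $ 1 * partial 3 \<psi> y), - (y $ 2 * partial 3 \<psi> y),
    2 * \<psi> y + (y $ 1 * partial 1 \<psi> y + y $ 2 * partial 2 \<psi> y)]"
  unfolding curl_def swirl_field_test(2)[OF assms] by (simp add: vector_3)

text \<open>The test field \<open>swirl_field \<psi>\<close> is divergence-free because \<psi> is
  axisymmetric. Derivatives that fall on its coordinate factors cancel in the quadratic term; in the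
  term with y \<otimes> U they contribute one more \<Gamma> \<psi>, which turns 1 - 4 \<gamma> into
  1 - 5 \<gamma>.\<close>

lemma circulation_equation:
  fixes U b :: "real^3 \<Rightarrow> real^3"
  assumes U: "continuous_on UNIV U" and b: "continuous_on UNIV b"
    and Ub: "\<And>y. \<exists>s. U y - b y = s *\<^sub>R vector [- (y $ 2), y $ 1, 0]"
    and eq: "\<And>\<Xi>. test_function \<Xi> \<Longrightarrow> (\<forall>y. divergence \<Xi> y = 0) \<Longrightarrow>
       integral\<^sup>L lborel (\<lambda>y. (1 - 4 * \<gamma>) * (U y \<bullet> \<Xi> y)
         - \<gamma> * tensor_grad y (U y) \<Xi> y - tensor_grad (U y) (U y) \<Xi> y) = 0"
    and \<psi>: "smooth \<psi>" "csupp \<psi>" "axisym_scalar \<psi>"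
  defines "\<Gamma> \<equiv> \<lambda>y. y $ 1 * U y $ 2 - y $ 2 * U y $ 1"
  shows "(LINT y|lborel. \<Gamma> y * (\<Sum>j\<in>UNIV. (\<gamma> * y $ j + b y $ j) * partial j \<psi> y))
    = (1 - 5 * \<gamma>) * (LINT y|lborel. \<Gamma> y * \<psi> y)"
proof -
  note T = swirl_field_test[OF \<psi>(1,2)]
  have "divergence (swirl_field \<psi>) y = 0" for y
    using axisym_partial[OF \<psi>(1,3), of y] by (simp add: divergence_def sum_3 T(2) vector_3)
  then have "integral\<^sup>L lborel (\<lambda>y. (1 - 4 * \<gamma>) * (U y \<bullet> swirl_field \<psi> y)
      - \<gamma> * tensor_grad y (U y) (swirl_field \<psi>) y - tensor_grad (U y) (U y) (swirl_field \<psi>) y) = 0"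
    by (intro eq T(1) allI)
  also have "(\<lambda>y. (1 - 4 * \<gamma>) * (U y \<bullet> swirl_field \<psi> y)
      - \<gamma> * tensor_grad y (U y) (swirl_field \<psi>) y - tensor_grad (U y) (U y) (swirl_field \<psi>) y)
    = (\<lambda>y. (1 - 5 * \<gamma>) * (\<Gamma> y * \<psi> y) - \<Gamma> y * (\<Sum>j\<in>UNIV. (\<gamma> * y $ j + b y $ j) * partial j \<psi> y))"
  proof (rule ext)
    fix y
    obtain s where s: "U y - b y = s *\<^sub>R vector [- (y $ 2), y $ 1, 0]" using Ub by blast
    have s': "b y $ 1 = U y $ 1 + s * y $ 2" "b y $ 2 = U y $ 2 - s * y $ 1" "b y $ 3 = U y $ 3"
      using arg_cong[OF s, of "\<lambda>v. v $ 1"] arg_cong[OF s, of "\<lambda>v. v $ 2"] arg_cong[OF s, of "\<lambda>v. v $ 3"]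
      by (simp_all add: vector_3)
    \<comment> \<open>\<open>U\<close> and \<open>b\<close> differ by a multiple of the angular
      direction, along which \<psi> is constant.\<close>
    have bU: "(\<Sum>j\<in>UNIV. b y $ j * partial j \<psi> y) = (\<Sum>j\<in>UNIV. U y $ j * partial j \<psi> y)"
      unfolding sum_3 s' using axisym_partial[OF \<psi>(1,3), of y] by algebra
    have split: "(\<Sum>j\<in>UNIV. (\<gamma> * y $ j + b y $ j) * partial j \<psi> y)
        = (\<Sum>j\<in>UNIV. \<gamma> * y $ j * partial j \<psi> y) + (\<Sum>j\<in>UNIV. U y $ j * partial j \<psi> y)"
      unfolding bU[symmetric] by (simp add: sum.distrib[symmetric] algebra_simps)
    show "(1 - 4 * \<gamma>) * (U y \<bullet> swirl_field \<psi> y)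
      - \<gamma> * tensor_grad y (U y) (swirl_field \<psi>) y - tensor_grad (U y) (U y) (swirl_field \<psi>) y
      = (1 - 5 * \<gamma>) * (\<Gamma> y * \<psi> y) - \<Gamma> y * (\<Sum>j\<in>UNIV. (\<gamma> * y $ j + b y $ j) * partial j \<psi> y)"
      unfolding split tensor_grad_def T(2) sum_3 inner_real3 swirl_field_def \<Gamma>_def
      by (simp add: vector_3 algebra_simps)
  qed
  also have "(LINT y|lborel. (1 - 5 * \<gamma>) * (\<Gamma> y * \<psi> y)
        - \<Gamma> y * (\<Sum>j\<in>UNIV. (\<gamma> * y $ j + b y $ j) * partial j \<psi> y))
      = (1 - 5 * \<gamma>) * (LINT y|lborel. \<Gamma> y * \<psi> y)
        - (LINT y|lborel. \<Gamma> y * (\<Sum>j\<in>UNIV. (\<gamma> * y $ j + b y $ j) * partial j \<psi> y))"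
  proof -
    have c: "continuous_on UNIV \<Gamma>" unfolding \<Gamma>_def by (intro continuous_intros U)
    have 1: "integrable lborel (\<lambda>y. \<Gamma> y * \<psi> y)"
      by (intro integrable_csupp continuous_intros c smooth_continuous \<psi> csupp_mono[OF \<psi>(2)]) simp
    have "integrable lborel (\<lambda>y. \<Gamma> y * ((\<gamma> * y $ j + b y $ j) * partial j \<psi> y))" for j
      by (intro integrable_csupp continuous_intros c b smooth_continuous smooth_partial \<psi>
          csupp_mono[OF csupp_partial[OF \<psi>(2), of j]]) simp
    then have "integrable lborel (\<lambda>y. \<Gamma> y * (\<Sum>j\<in>UNIV. (\<gamma> * y $ j + b y $ j) * partial j \<psi> y))"
      by (simp add: sum_distrib_left)
    then show ?thesis using 1 by (simp add: Bochner_Integration.integral_diff)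
  qed
  finally show ?thesis by simp
qed

section \<open>The equation of the potential vorticity\<close>

lemma conv_product_limit:
  assumes r: "\<And>n. mollifier C (1 / real (Suc n)) (r n)" and v: "continuous_on UNIV v"
    and w: "continuous_on UNIV w" and h: "continuous_on UNIV h" "csupp h"
  shows "(\<lambda>n. LINT x|lborel. conv (r n) v x * conv (r n) w x * h x) \<longlonglongrightarrow> (LINT x|lborel. v x * w x * h x)"
proof -
  obtain R where R: "R > 0" "\<And>y. R \<le> norm y \<Longrightarrow> h y = 0" using csuppE[OF h(2)] by blast
  obtain M where M: "M \<ge> 0" "\<And>(j::3) y. norm y \<le> R + 1 \<Longrightarrow> \<bar>v y\<bar> \<le> M"
    by (rule continuous_bounded_on_cball[of "\<lambda>j. v"], rule v, rule that)
  obtain M' where M': "M' \<ge> 0" "\<And>(j::3) y. norm y \<le> R + 1 \<Longrightarrow> \<bar>w y\<bar> \<le> M'"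
    by (rule continuous_bounded_on_cball[of "\<lambda>j. w"], rule w, rule that)
  show ?thesis
  proof (rule integral_dominated_convergence[where w = "\<lambda>x. M * M' * \<bar>h x\<bar>"])
    have cc: "continuous_on UNIV (\<lambda>x. f x * g x * h x)" if "continuous_on UNIV f" "continuous_on UNIV g" for f g
      by (intro continuous_intros h that)
    have ck: "continuous_on UNIV (conv (r n) f)" if "continuous_on UNIV f" for f n
      by (intro smooth_continuous smooth_conv mollifierD(1,2)[OF r] that)
    show "(\<lambda>x. v x * w x * h x) \<in> borel_measurable lborel"
      using borel_measurable_continuous_onI[OF cc[OF v w]] by simp
    show "(\<lambda>x. conv (r n) v x * conv (r n) w x * h x) \<in> borel_measurable lborel" for n
      using borel_measurable_continuous_onI[OF cc[OF ck[OF v] ck[OF w]]] by simp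
    show "integrable lborel (\<lambda>x. M * M' * \<bar>h x\<bar>)"
      by (intro integrable_mult_right integrable_abs integrable_csupp h)
    show "AE x in lborel. (\<lambda>n. conv (r n) v x * conv (r n) w x * h x) \<longlonglongrightarrow> v x * w x * h x"
      by (intro AE_I2 tendsto_intros conv_tendsto[OF r] v w)
    show "AE x in lborel. norm (conv (r n) v x * conv (r n) w x * h x) \<le> M * M' * \<bar>h x\<bar>" for n
    proof (rule AE_I2)
      fix x
      show "norm (conv (r n) v x * conv (r n) w x * h x) \<le> M * M' * \<bar>h x\<bar>"
      proof (cases "R \<le> norm x")
        case True
        then show ?thesis using R by simp
      next
        case False
        then have "\<bar>conv (r n) v x\<bar> \<le> M" "\<bar>conv (r n) w x\<bar> \<le> M'"
          by (intro conv_bound[OF r[of n] _ v M(2)] conv_bound[OF r[of n] _ w M'(2)]; auto)+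
        then show ?thesis
          unfolding real_norm_def abs_mult by (intro mult_mono) auto
      qed
    qed
  qed
qed

text \<open>The weak form of \<open>U \<cdot> \<nabla>U = curl U \<times> U + \<nabla>(|U|\<^sup>2 / 2)\<close>.\<close>

lemma convection_weak_form:
  fixes U :: "3 \<Rightarrow> real^3 \<Rightarrow> real" and X :: "3 \<Rightarrow> real^3 \<Rightarrow> real"
  assumes U: "\<And>j. continuous_on UNIV (U j)" and div: "weak_div U 0"
    and curl: "weak_curl U \<Omega>" and \<Omega>: "\<And>i j. continuous_on UNIV (\<Omega> i j)"
    and X: "\<And>j. smooth (X j)" "\<And>j. csupp (X j)" and divX: "\<And>y. (\<Sum>j\<in>UNIV. partial j (X j) y) = 0"
  shows "(LINT y|lborel. (\<Sum>i\<in>UNIV. \<Sum>j\<in>UNIV. U i y * U j y * partial i (X j) y))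
    = - (LINT y|lborel. (\<Sum>i\<in>UNIV. \<Sum>j\<in>UNIV. U i y * \<Omega> i j y * X j y))"
proof -
  obtain C \<rho> where \<rho>: "\<And>\<epsilon>. \<epsilon> > 0 \<Longrightarrow> mollifier C \<epsilon> (\<rho> \<epsilon>)"
    using mollifier_exists by metis
  define r where "r n = \<rho> (1 / real (Suc n))" for n
  have r: "mollifier C (1 / real (Suc n)) (r n)" for n
    unfolding r_def by (rule \<rho>) simp
  have cX: "continuous_on UNIV (X j)" "continuous_on UNIV (partial i (X j))" "csupp (partial i (X j))" for i j
    by (intro smooth_continuous smooth_partial csupp_partial X)+
  have id: "(\<Sum>i\<in>UNIV. \<Sum>j\<in>UNIV. LINT y|lborel. conv (r n) (U i) y * conv (r n) (U j) y * partial i (X j) y)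
      = - (\<Sum>i\<in>UNIV. \<Sum>j\<in>UNIV. LINT y|lborel. conv (r n) (U i) y * conv (r n) (\<Omega> i j) y * X j y)" for n
  proof -
    define u where "u j = conv (r n) (U j)" for j
    have u: "smooth (u j)" for j
      unfolding u_def by (intro smooth_conv mollifierD(1,2)[OF r] U)
    have su: "smooth (\<lambda>y. u i y * u j y)" for i j by (intro smooth_mult u)
    have dv: "(\<Sum>j\<in>UNIV. partial j (u j) y) = 0" for y
      unfolding u_def by (rule weak_div_conv[OF r U div])
    have cu: "conv (r n) (\<Omega> i j) y = partial i (u j) y - partial j (u i) y" for i j y
      unfolding u_def by (rule weak_curl_conv[OF r U curl, symmetric])
    have int: "integrable lborel (\<lambda>y. f y * X j y)" if "smooth f" for f j
      by (intro integrable_smooth_mult that X)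
    have sp: "smooth (\<lambda>y. u i y * partial k (u l) y)" for i k l
      by (intro smooth_mult u smooth_partial)
    have "(\<Sum>i\<in>UNIV. \<Sum>j\<in>UNIV. LINT y|lborel. u i y * u j y * partial i (X j) y)
        = (\<Sum>i\<in>UNIV. \<Sum>j\<in>UNIV. - (LINT y|lborel. (u i y * partial i (u j) y + partial i (u i) y * u j y) * X j y))"
      by (intro sum.cong refl) (simp add: integration_by_parts[OF su X] partial_mult u)
    also have "\<dots> = - (LINT y|lborel. (\<Sum>i\<in>UNIV. \<Sum>j\<in>UNIV. (u i y * partial i (u j) y + partial i (u i) y * u j y) * X j y))"
    proof -
      have "integrable lborel (\<lambda>y. (u i y * partial i (u j) y + partial i (u i) y * u j y) * X j y)" for i j
        by (intro int smooth_add smooth_mult u smooth_partial)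
      then show ?thesis by (simp add: Bochner_Integration.integral_sum sum_negf)
    qed
    also have "\<dots> = - (LINT y|lborel. (\<Sum>i\<in>UNIV. \<Sum>j\<in>UNIV. u i y * conv (r n) (\<Omega> i j) y * X j y)
        + (\<Sum>j\<in>UNIV. \<Sum>i\<in>UNIV. u i y * partial j (u i) y * X j y))"
    proof -
      have "(\<Sum>i\<in>UNIV. \<Sum>j\<in>UNIV. (u i y * partial i (u j) y + partial i (u i) y * u j y) * X j y)
          = (\<Sum>i\<in>UNIV. \<Sum>j\<in>UNIV. u i y * conv (r n) (\<Omega> i j) y * X j y)
            + (\<Sum>j\<in>UNIV. \<Sum>i\<in>UNIV. u i y * partial j (u i) y * X j y)" for y
      proof -
        \<comment> \<open>Uses u_i D_i u_j = u_i (D_i u_j - D_j u_i) + u_i D_j u_i, a vorticity term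
          plus a gradient; the remaining sum contains the vanishing divergence of u.\<close>
        have "(\<Sum>i\<in>UNIV. \<Sum>j\<in>UNIV. (u i y * partial i (u j) y + partial i (u i) y * u j y) * X j y)
            = (\<Sum>i\<in>UNIV. \<Sum>j\<in>UNIV. u i y * conv (r n) (\<Omega> i j) y * X j y)
              + (\<Sum>i\<in>UNIV. \<Sum>j\<in>UNIV. u i y * partial j (u i) y * X j y)
              + (\<Sum>i\<in>UNIV. partial i (u i) y) * (\<Sum>j\<in>UNIV. u j y * X j y)"
          unfolding sum_product cu by (simp add: sum.distrib[symmetric] algebra_simps)
        then show ?thesis
          using sum.swap[of "\<lambda>i j. u i y * partial j (u i) y * X j y" UNIV UNIV] by (simp add: dv)
      qed
      then show ?thesis by simp
    qed
    also have "\<dots> = - ((LINT y|lborel. (\<Sum>i\<in>UNIV. \<Sum>j\<in>UNIV. u i y * conv (r n) (\<Omega> i j) y * X j y))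
        + (LINT y|lborel. (\<Sum>j\<in>UNIV. \<Sum>i\<in>UNIV. u i y * partial j (u i) y * X j y)))"
    proof -
      have "integrable lborel (\<lambda>y. u i y * conv (r n) (\<Omega> i j) y * X j y)" for i j
        by (intro int smooth_mult u smooth_conv mollifierD(1,2)[OF r] \<Omega>)
      then show ?thesis
        by (subst Bochner_Integration.integral_add)
           (auto intro!: Bochner_Integration.integrable_sum int sp simp del: mult_eq_0_iff)
    qed
    also have "(LINT y|lborel. (\<Sum>j\<in>UNIV. \<Sum>i\<in>UNIV. u i y * partial j (u i) y * X j y)) = 0"
    proof -
      \<comment> \<open>Half the gradient of q = |u|^2, which integrates to 0 against the
        divergence-free \<open>X\<close>.\<close>
      define q where "q y = (\<Sum>i\<in>UNIV. u i y * u i y)" for y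
      have q: "smooth q" unfolding q_def by (intro smooth_sum su)
      have pq: "partial j q y = 2 * (\<Sum>i\<in>UNIV. u i y * partial j (u i) y)" for j y
        unfolding q_def
        by (simp add: sum_3 partial_add smooth_differentiable smooth_add su partial_mult u)
      have "(LINT y|lborel. (\<Sum>j\<in>UNIV. \<Sum>i\<in>UNIV. u i y * partial j (u i) y * X j y))
          = (LINT y|lborel. (\<Sum>j\<in>UNIV. 1 / 2 * (partial j q y * X j y)))"
        by (simp add: pq sum_distrib_right)
      also have "\<dots> = (\<Sum>j\<in>UNIV. 1 / 2 * (LINT y|lborel. partial j q y * X j y))"
        using int[OF smooth_partial[OF q]]
        by (subst Bochner_Integration.integral_sum) auto
      also have "\<dots> = (\<Sum>j\<in>UNIV. - (1 / 2) * (LINT y|lborel. q y * partial j (X j) y))"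
        by (simp add: integration_by_parts[OF q X])
      also have "\<dots> = - (1 / 2) * (LINT y|lborel. (\<Sum>j\<in>UNIV. q y * partial j (X j) y))"
      proof -
        have "integrable lborel (\<lambda>y. q y * partial j (X j) y)" for j
          by (intro integrable_smooth_mult q smooth_partial csupp_partial X)
        then show ?thesis by (simp add: Bochner_Integration.integral_sum sum_distrib_left)
      qed
      also have "\<dots> = 0"
        by (simp add: divX flip: sum_distrib_left)
      finally show ?thesis .
    qed
    also have "- ((LINT y|lborel. (\<Sum>i\<in>UNIV. \<Sum>j\<in>UNIV. u i y * conv (r n) (\<Omega> i j) y * X j y)) + 0)
        = - (\<Sum>i\<in>UNIV. \<Sum>j\<in>UNIV. LINT y|lborel. u i y * conv (r n) (\<Omega> i j) y * X j y)"
    proof -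
      have "integrable lborel (\<lambda>y. u i y * conv (r n) (\<Omega> i j) y * X j y)" for i j
        by (intro int smooth_mult u smooth_conv mollifierD(1,2)[OF r] \<Omega>)
      then show ?thesis by (simp add: Bochner_Integration.integral_sum)
    qed
    finally show ?thesis unfolding u_def .
  qed
  have "(\<lambda>n. \<Sum>i\<in>UNIV. \<Sum>j\<in>UNIV. LINT y|lborel. conv (r n) (U i) y * conv (r n) (U j) y * partial i (X j) y)
      \<longlonglongrightarrow> (\<Sum>i\<in>UNIV. \<Sum>j\<in>UNIV. LINT y|lborel. U i y * U j y * partial i (X j) y)"
    by (intro tendsto_sum conv_product_limit[OF r] U cX)
  moreover have "(\<lambda>n. - (\<Sum>i\<in>UNIV. \<Sum>j\<in>UNIV. LINT y|lborel. conv (r n) (U i) y * conv (r n) (\<Omega> i j) y * X j y))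
      \<longlonglongrightarrow> - (\<Sum>i\<in>UNIV. \<Sum>j\<in>UNIV. LINT y|lborel. U i y * \<Omega> i j y * X j y)"
    by (intro tendsto_minus tendsto_sum conv_product_limit[OF r] U \<Omega> cX X)
  ultimately have "(\<Sum>i\<in>UNIV. \<Sum>j\<in>UNIV. LINT y|lborel. U i y * U j y * partial i (X j) y)
      = - (\<Sum>i\<in>UNIV. \<Sum>j\<in>UNIV. LINT y|lborel. U i y * \<Omega> i j y * X j y)"
    unfolding id by (rule LIMSEQ_unique)
  moreover have "integrable lborel (\<lambda>y. U i y * U j y * partial i (X j) y)" for i j
    by (intro integrable_csupp continuous_intros U cX csupp_mono[OF cX(3)[of i j]]) simp
  moreover have "integrable lborel (\<lambda>y. U i y * \<Omega> i j y * X j y)" for i j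
    by (intro integrable_csupp continuous_intros U \<Omega> cX csupp_mono[OF X(2)[of j]]) simp
  ultimately show ?thesis
    by (simp add: Bochner_Integration.integral_sum)
qed

text \<open>The cross product of two basis vectors is 0 or a signed basis vector, so its inner
  products with \<open>W\<close> are the entries of the curl matrix. Test fields with a single
  nonzero component isolate them.\<close>

lemma weak_curl_of_distr:
  assumes c: "distr_curl_eq B W"
  shows "weak_curl (\<lambda>j y. B y $ j) (\<lambda>i j y. cross3 (axis i 1) (axis j 1) \<bullet> W y)"
  unfolding weak_curl_def
proof (intro allI impI)
  fix \<phi> :: "real^3 \<Rightarrow> real" and i j :: 3
  assume \<phi>: "smooth \<phi> \<and> csupp \<phi>"
  have z: "smooth (\<lambda>y::real^3. 0::real)" "csupp (\<lambda>y::real^3. 0::real)"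
    by (auto intro: smooth_const csuppI)
  note s = \<phi>[THEN conjunct1] and cs = \<phi>[THEN conjunct2]
  have test: "(LINT y|lborel. B y \<bullet> curl \<Phi> y) = (LINT y|lborel. W y \<bullet> \<Phi> y)"
    if "smooth \<Phi>" "csupp \<Phi>" for \<Phi>
    using c that unfolding distr_curl_eq_def test_function_iff by blast
  have neg: "(LINT y|lborel. f y - g y) = - (LINT y|lborel. g y - f y)" for f g :: "real^3 \<Rightarrow> real"
    by (simp flip: Bochner_Integration.integral_minus)
  have 1: "(LINT y|lborel. B y $ 2 * partial 3 \<phi> y - B y $ 3 * partial 2 \<phi> y) = (LINT y|lborel. W y $ 1 * \<phi> y)"
    using test[OF smooth_vector3(1)[OF s z(1) z(1)] csupp_vector3[OF cs z(2) z(2)]]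
    by (simp add: curl_def smooth_vector3(2)[OF s z(1) z(1)] inner_real3 vector_3 partial_const)
  have 2: "(LINT y|lborel. B y $ 3 * partial 1 \<phi> y - B y $ 1 * partial 3 \<phi> y) = (LINT y|lborel. W y $ 2 * \<phi> y)"
    using test[OF smooth_vector3(1)[OF z(1) s z(1)] csupp_vector3[OF z(2) cs z(2)]]
    by (simp add: curl_def smooth_vector3(2)[OF z(1) s z(1)] inner_real3 vector_3 partial_const)
  have 3: "(LINT y|lborel. B y $ 1 * partial 2 \<phi> y - B y $ 2 * partial 1 \<phi> y) = (LINT y|lborel. W y $ 3 * \<phi> y)"
    using test[OF smooth_vector3(1)[OF z(1) z(1) s] csupp_vector3[OF z(2) z(2) cs]]
    by (simp add: curl_def smooth_vector3(2)[OF z(1) z(1) s] inner_real3 vector_3 partial_const)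
  note n1 = neg[of "\<lambda>y. B y $ 3 * partial 2 \<phi> y" "\<lambda>y. B y $ 2 * partial 3 \<phi> y"]
  note n2 = neg[of "\<lambda>y. B y $ 1 * partial 3 \<phi> y" "\<lambda>y. B y $ 3 * partial 1 \<phi> y"]
  note n3 = neg[of "\<lambda>y. B y $ 2 * partial 1 \<phi> y" "\<lambda>y. B y $ 1 * partial 2 \<phi> y"]
  show "(LINT y|lborel. B y $ j * partial i \<phi> y - B y $ i * partial j \<phi> y)
      = - (LINT y|lborel. (cross3 (axis i 1) (axis j 1) \<bullet> W y) * \<phi> y)"
    using exhaust_3[of i] exhaust_3[of j]
    by (elim disjE; hypsubst)
       (simp_all add: cross3_def vector_3 axis_def inner_real3 1 2 3 n1 n2 n3)
qed

lemma cyl_r_sq: "(cyl_r y)\<^sup>2 = y $ 1 * y $ 1 + y $ 2 * y $ 2"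
  by (simp add: cyl_r_def power2_eq_square)

lemma cyl_r_nonneg: "0 \<le> cyl_r y"
  by (simp add: cyl_r_def)

lemma continuous_on_cyl_r: "continuous_on S cyl_r"
  unfolding cyl_r_def by (intro continuous_intros)

text \<open>The test field is the curl of \<open>r \<psi> e_\<theta>\<close> with \<psi> = \<tau> /
  r^2. Moving the curl onto \<open>U\<close> gives the integral of w \<tau>, because W = w r
  e_\<theta> where \<tau> lives. Since y . grad (r^2 \<psi>) = r^2 (y . grad \<psi>) + 2 r^2 \<psi>,
  the coefficient 1 - 4 \<gamma> becomes 1 - 2 \<gamma>.\<close>

lemma potential_vorticity_equation:
  fixes U W :: "real^3 \<Rightarrow> real^3" and w :: "real^3 \<Rightarrow> real"
  assumes U: "continuous_on UNIV U" and div: "weak_div (\<lambda>j y. U y $ j) 0"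
    and curl: "distr_curl_eq U W" and W: "continuous_on UNIV W"
    and noswirl: "\<And>y. y $ 1 * U y $ 2 = y $ 2 * U y $ 1"
    and \<delta>: "\<delta> > 0" and w: "continuous_on UNIV w"
    and Ww: "\<And>y. \<delta> \<le> cyl_r y \<Longrightarrow> W y = w y *\<^sub>R vector [- (y $ 2), y $ 1, 0]"
    and eq: "\<And>\<Xi>. test_function \<Xi> \<Longrightarrow> (\<forall>y. divergence \<Xi> y = 0) \<Longrightarrow>
       integral\<^sup>L lborel (\<lambda>y. (1 - 4 * \<gamma>) * (U y \<bullet> \<Xi> y)
         - \<gamma> * tensor_grad y (U y) \<Xi> y - tensor_grad (U y) (U y) \<Xi> y) = 0"
    and \<tau>: "smooth \<tau>" "csupp \<tau>" "\<And>y. cyl_r y \<le> \<delta> \<Longrightarrow> \<tau> y = 0"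
  shows "(LINT y|lborel. w y * (\<Sum>j\<in>UNIV. (\<gamma> * y $ j + U y $ j) * partial j \<tau> y))
    = (1 - 2 * \<gamma>) * (LINT y|lborel. w y * \<tau> y)"
proof -
  define s where "s y = y $ 1 * y $ 1 + y $ 2 * y $ 2" for y :: "real^3"
  have ss: "smooth s" unfolding s_def by (intro smooth_add smooth_mult smooth_component)
  have s_cyl: "s y = (cyl_r y)\<^sup>2" for y by (simp add: s_def cyl_r_sq)
  \<comment> \<open>A smooth extension of 1 / r^2: the \<open>flat\<close> term vanishes for r \<ge>
    \<delta>, where \<tau> lives, and keeps the denominator positive on the axis.\<close>
  define k where "k y = inverse (s y + flat (\<delta>\<^sup>2 - s y))" for y
  have pos: "s y + flat (\<delta>\<^sup>2 - s y) > 0" for y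
  proof (cases "s y = 0")
    case True
    then show ?thesis using \<delta> by (simp add: flat_pos)
  next
    case False
    then have "s y > 0" by (simp add: s_cyl)
    then show ?thesis using flat_nonneg[of "\<delta>\<^sup>2 - s y"] by linarith
  qed
  have sk: "smooth k"
    unfolding k_def by (intro smooth_inverse smooth_add smooth_flat smooth_diff smooth_const ss pos)
  define \<psi> where "\<psi> y = \<tau> y * k y" for y
  have \<psi>: "smooth \<psi>" "csupp \<psi>"
    unfolding \<psi>_def by (intro smooth_mult \<tau> sk, rule csupp_mono[OF \<tau>(2)]) simp
  have \<tau>_eq: "\<tau> y = s y * \<psi> y" for y
  proof (cases "cyl_r y \<le> \<delta>")
    case True
    then show ?thesis using \<tau>(3) by (simp add: \<psi>_def)
  next
    case False
    then have "\<delta>\<^sup>2 < s y" unfolding s_cyl using \<delta> by (intro power_strict_mono) auto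
    moreover have "s y > 0" using calculation \<delta> by (meson less_trans zero_less_power)
    ultimately show ?thesis by (simp add: \<psi>_def k_def flat_zero)
  qed
  \<comment> \<open>The azimuthal form of \<open>W\<close> is known only for r \<ge> \<delta>;
    elsewhere \<psi> and its gradient vanish, which makes the pointwise identities below
    trivial.\<close>
  have dich: "W y = w y *\<^sub>R vector [- (y $ 2), y $ 1, 0] \<or> (\<psi> y = 0 \<and> (\<forall>i. partial i \<psi> y = 0))" for y
  proof (cases "\<delta> \<le> cyl_r y")
    case False
    have "open {y. cyl_r y < \<delta>}"
      by (intro open_Collect_less continuous_on_cyl_r continuous_intros)
    then have "partial i \<psi> y = 0" for i
      by (rule partial_zero_open) (use False \<tau>(3) in \<open>auto simp: \<psi>_def\<close>)
    then show ?thesis using False \<tau>(3)[of y] by (simp add: \<psi>_def)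
  qed (use Ww in blast)
  \<comment> \<open>The Euler derivative of \<psi>. Passing to \<open>r \<psi> e_\<theta>\<close>
    raises homogeneity by one and the curl lowers it by one, so y . grad of the test field is again
    such a curl, with \<theta> in place of \<psi>.\<close>
  define \<theta> where "\<theta> y = (\<Sum>i\<in>UNIV. y $ i * partial i \<psi> y)" for y
  have \<theta>: "smooth \<theta>" "csupp \<theta>"
  proof -
    show "smooth \<theta>" unfolding \<theta>_def by (intro smooth_sum smooth_mult smooth_component smooth_partial \<psi>)
    obtain R where R: "\<And>y. R \<le> norm y \<Longrightarrow> \<psi> y = 0" using csuppE[OF \<psi>(2)] by blast
    show "csupp \<theta>"
    proof (rule csuppI[of "R + 1"])
      fix y :: "real^3" assume "R + 1 \<le> norm y"
      then have "partial i \<psi> y = 0" for i using R by (intro partial_zero_outside[of R]) auto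
      then show "\<theta> y = 0" by (simp add: \<theta>_def)
    qed
  qed
  have sw: "partial i (partial j \<psi>) y = partial j (partial i \<psi>) y" for i j y
    by (rule partial_partial_commute[OF \<psi>(1)])
  have p\<theta>: "partial j \<theta> y = (\<Sum>i\<in>UNIV. y $ i * partial j (partial i \<psi>) y) + partial j \<psi> y" for j y
    unfolding \<theta>_def sum_3
    by (subst partial_add, (intro smooth_differentiable smooth_add smooth_mult smooth_component smooth_partial \<psi>)+)+
       (use exhaust_3[of j] in \<open>auto simp: partial_component_mult[OF smooth_partial[OF \<psi>(1)]]\<close>)
  define X1 where "X1 y = - (y $ 1 * partial 3 \<psi> y)" for y
  define X2 where "X2 y = - (y $ 2 * partial 3 \<psi> y)" for y
  define X3 where "X3 y = 2 * \<psi> y + (y $ 1 * partial 1 \<psi> y + y $ 2 * partial 2 \<psi> y)" for y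
  have sX: "smooth X1" "smooth X2" "smooth X3"
    unfolding X1_def X2_def X3_def
    by (intro smooth_uminus smooth_add smooth_cmult smooth_mult smooth_component smooth_partial \<psi>)+
  obtain R where R: "\<And>y. R \<le> norm y \<Longrightarrow> \<psi> y = 0" using csuppE[OF \<psi>(2)] by blast
  have dR: "partial i \<psi> y = 0" if "R + 1 \<le> norm y" for i y
    by (rule partial_zero_outside[of R]) (use R that in auto)
  have cX: "csupp X1" "csupp X2" "csupp X3"
    by (rule csuppI[of "R + 1"]; use R dR in \<open>simp add: X1_def X2_def X3_def\<close>)+
  have sm: "smooth (\<lambda>y. y $ j * partial i \<psi> y)" for i j
    by (intro smooth_mult smooth_component smooth_partial \<psi>)
  have pX: "partial i X1 y = - (y $ 1 * partial i (partial 3 \<psi>) y + (if i = 1 then partial 3 \<psi> y else 0))"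
    "partial i X2 y = - (y $ 2 * partial i (partial 3 \<psi>) y + (if i = 2 then partial 3 \<psi> y else 0))"
    "partial i X3 y = 2 * partial i \<psi> y + ((y $ 1 * partial i (partial 1 \<psi>) y + (if i = 1 then partial 1 \<psi> y else 0))
        + (y $ 2 * partial i (partial 2 \<psi>) y + (if i = 2 then partial 2 \<psi> y else 0)))" for i y
    unfolding X1_def X2_def X3_def
    by (simp_all add: partial_uminus[OF sm] partial_component_mult[OF smooth_partial[OF \<psi>(1)]]
        partial_add smooth_differentiable smooth_cmult smooth_add sm \<psi> partial_cmult)
  define \<Xi> where "\<Xi> y = (vector [X1 y, X2 y, X3 y] :: real^3)" for y
  have curl\<Xi>: "curl (swirl_field \<psi>) = \<Xi>"
    by (rule ext) (simp add: curl_swirl_field[OF \<psi>] \<Xi>_def X1_def X2_def X3_def)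
  have p\<Xi>: "partial i \<Xi> y = vector [partial i X1 y, partial i X2 y, partial i X3 y]" for i y
    unfolding \<Xi>_def[abs_def] by (rule smooth_vector3(2)[OF sX])
  have t\<Xi>: "test_function \<Xi>"
    unfolding test_function_iff \<Xi>_def[abs_def]
    by (intro conjI smooth_vector3(1) csupp_vector3 sX cX)
  have d\<Xi>: "divergence \<Xi> y = 0" for y
    unfolding divergence_def p\<Xi> sum_3 vector_3 pX
    using sw[of 1 3 y] sw[of 2 3 y] by (simp add: algebra_simps)
  define Om where "Om i j y = cross3 (axis i 1) (axis j 1) \<bullet> W y" for i j :: 3 and y
  have cOm: "continuous_on UNIV (Om i j)" for i j
    unfolding Om_def by (intro continuous_intros W)
  define X where "X j = (if j = 1 then X1 else if j = 2 then X2 else X3)" for j :: 3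
  have cU: "continuous_on UNIV (\<lambda>y. U y $ j)" for j by (intro continuous_intros U)
  have A1: "(LINT y|lborel. U y \<bullet> \<Xi> y) = (LINT y|lborel. w y * \<tau> y)"
  proof -
    have "(LINT y|lborel. U y \<bullet> \<Xi> y) = (LINT y|lborel. W y \<bullet> swirl_field \<psi> y)"
      using curl swirl_field_test(1)[OF \<psi>] unfolding distr_curl_eq_def curl\<Xi>[symmetric] by blast
    also have "(\<lambda>y. W y \<bullet> swirl_field \<psi> y) = (\<lambda>y. w y * \<tau> y)"
    proof (rule ext)
      fix y show "W y \<bullet> swirl_field \<psi> y = w y * \<tau> y"
        using dich[of y] unfolding \<tau>_eq s_def inner_real3 swirl_field_def
        by (auto simp: vector_3 algebra_simps)
    qed
    finally show ?thesis .
  qed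
  have A2: "(LINT y|lborel. tensor_grad y (U y) \<Xi> y) = (LINT y|lborel. w y * (s y * \<theta> y))"
  proof -
    have "(\<lambda>y. tensor_grad y (U y) \<Xi> y) = (\<lambda>y. U y \<bullet> curl (swirl_field \<theta>) y)"
    proof (rule ext)
      fix y show "tensor_grad y (U y) \<Xi> y = U y \<bullet> curl (swirl_field \<theta>) y"
        unfolding tensor_grad_def p\<Xi> curl_swirl_field[OF \<theta>] inner_real3 sum_3 vector_3 pX p\<theta>
          sw[of 2 1] sw[of 3 1] sw[of 3 2] \<theta>_def
        by (simp add: algebra_simps)
    qed
    then have "(LINT y|lborel. tensor_grad y (U y) \<Xi> y) = (LINT y|lborel. W y \<bullet> swirl_field \<theta> y)"
      using curl swirl_field_test(1)[OF \<theta>] unfolding distr_curl_eq_def by simp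
    also have "(\<lambda>y. W y \<bullet> swirl_field \<theta> y) = (\<lambda>y. w y * (s y * \<theta> y))"
    proof (rule ext)
      fix y show "W y \<bullet> swirl_field \<theta> y = w y * (s y * \<theta> y)"
        using dich[of y]
      proof
        assume "W y = w y *\<^sub>R vector [- (y $ 2), y $ 1, 0]"
        then show ?thesis
          unfolding s_def inner_real3 swirl_field_def by (simp add: vector_3 algebra_simps)
      next
        assume "\<psi> y = 0 \<and> (\<forall>i. partial i \<psi> y = 0)"
        then show ?thesis by (simp add: \<theta>_def swirl_field_def inner_real3 vector_3)
      qed
    qed
    finally show ?thesis .
  qed
  \<comment> \<open>This is U . grad \<tau>, expressed through \<psi> by \<tau> = r^2
    \<psi>.\<close>
  define Z where "Z y = s y * (\<Sum>j\<in>UNIV. U y $ j * partial j \<psi> y) + 2 * (y $ 1 * U y $ 1 + y $ 2 * U y $ 2) * \<psi> y" for y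
  have A3: "(LINT y|lborel. tensor_grad (U y) (U y) \<Xi> y) = (LINT y|lborel. w y * Z y)"
  proof -
    have X: "smooth (X j)" "csupp (X j)" for j using sX cX by (auto simp: X_def)
    have divX: "(\<Sum>j\<in>UNIV. partial j (X j) y) = 0" for y
      using d\<Xi>[of y] by (simp add: divergence_def p\<Xi> sum_3 X_def vector_3)
    have "(\<lambda>y. tensor_grad (U y) (U y) \<Xi> y)
        = (\<lambda>y. \<Sum>i\<in>UNIV. \<Sum>j\<in>UNIV. U y $ i * U y $ j * partial i (X j) y)"
      by (rule ext) (simp add: tensor_grad_def p\<Xi> sum_3 X_def vector_3)
    then have "(LINT y|lborel. tensor_grad (U y) (U y) \<Xi> y)
        = - (LINT y|lborel. (\<Sum>i\<in>UNIV. \<Sum>j\<in>UNIV. U y $ i * Om i j y * X j y))"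
      using convection_weak_form[OF cU div weak_curl_of_distr[OF curl, folded Om_def] cOm X divX] by simp
    also have "\<dots> = (LINT y|lborel. - (\<Sum>i\<in>UNIV. \<Sum>j\<in>UNIV. U y $ i * Om i j y * X j y))"
      by (rule Bochner_Integration.integral_minus[symmetric])
    also have "(\<lambda>y. - (\<Sum>i\<in>UNIV. \<Sum>j\<in>UNIV. U y $ i * Om i j y * X j y)) = (\<lambda>y. w y * Z y)"
    proof (rule ext)
      fix y
      have *: "(\<Sum>i\<in>UNIV. \<Sum>j\<in>UNIV. U y $ i * Om i j y * X j y)
          = W y $ 1 * (U y $ 2 * X3 y - U y $ 3 * X2 y) + W y $ 2 * (U y $ 3 * X1 y - U y $ 1 * X3 y)
            + W y $ 3 * (U y $ 1 * X2 y - U y $ 2 * X1 y)"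
        unfolding sum_3 Om_def X_def inner_real3
        by (simp add: cross3_def vector_3 axis_def algebra_simps)
      show "- (\<Sum>i\<in>UNIV. \<Sum>j\<in>UNIV. U y $ i * Om i j y * X j y) = w y * Z y"
        using dich[of y]
      proof
        assume W: "W y = w y *\<^sub>R vector [- (y $ 2), y $ 1, 0]"
        have "W y $ 1 = - (w y * y $ 2)" "W y $ 2 = w y * y $ 1" "W y $ 3 = 0"
          by (simp_all add: W vector_3)
        \<comment> \<open>Without swirl the horizontal part of \<open>U\<close> is parallel to y',
          and \<open>h\<close> is r U_r; so multiplying y' by \<open>h\<close> gives r^2 times the
          horizontal velocity.\<close>
        define h where "h = y $ 1 * U y $ 1 + y $ 2 * U y $ 2"
        have h: "h * y $ 1 = s y * U y $ 1" "h * y $ 2 = s y * U y $ 2"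
          using noswirl[of y] unfolding h_def s_def by algebra+
        have "h * (y $ 1 * partial 1 \<psi> y + y $ 2 * partial 2 \<psi> y)
            = (h * y $ 1) * partial 1 \<psi> y + (h * y $ 2) * partial 2 \<psi> y"
          by (simp add: algebra_simps)
        then have "Z y = h * X3 y + s y * (U y $ 3 * partial 3 \<psi> y)"
          unfolding Z_def sum_3 h_def[symmetric] X3_def distrib_left h by (simp add: algebra_simps)
        also have "\<dots> = h * X3 y - U y $ 3 * (y $ 1 * X1 y + y $ 2 * X2 y)"
          unfolding X1_def X2_def s_def by (simp add: algebra_simps)
        finally have Z: "Z y = h * X3 y - U y $ 3 * (y $ 1 * X1 y + y $ 2 * X2 y)" .
        show ?thesis
          unfolding * Z \<open>W y $ 1 = _\<close> \<open>W y $ 2 = _\<close> \<open>W y $ 3 = _\<close> h_def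
          by (simp add: algebra_simps)
      next
        assume "\<psi> y = 0 \<and> (\<forall>i. partial i \<psi> y = 0)"
        then show ?thesis unfolding * by (simp add: Z_def X1_def X2_def X3_def)
      qed
    qed
    finally show ?thesis .
  qed
  have ps: "partial i s y = (if i = 1 then 2 * y $ 1 else if i = 2 then 2 * y $ 2 else 0)" for i y
    unfolding s_def
    by (subst partial_add, (intro smooth_differentiable smooth_mult smooth_component)+)
       (auto simp: partial_component_mult[OF smooth_component] partial_component)
  have grad\<tau>: "(\<Sum>j\<in>UNIV. (\<gamma> * y $ j + U y $ j) * partial j \<tau> y) = \<gamma> * (s y * \<theta> y) + 2 * \<gamma> * \<tau> y + Z y" for y
  proof -
    have p\<tau>: "partial j \<tau> y = s y * partial j \<psi> y + partial j s y * \<psi> y" for j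
    proof -
      have "\<tau> = (\<lambda>y. s y * \<psi> y)" using \<tau>_eq by (rule ext)
      then show ?thesis by (simp only: partial_mult[OF ss \<psi>(1)])
    qed
    show ?thesis
      unfolding p\<tau> ps sum_3 \<theta>_def Z_def \<tau>_eq by (simp add: s_def algebra_simps)
  qed
  have c: "continuous_on UNIV s" "continuous_on UNIV \<tau>" "continuous_on UNIV \<theta>" "continuous_on UNIV \<psi>"
    "continuous_on UNIV (partial i \<psi>)" for i
    using ss \<tau>(1) \<theta>(1) \<psi>(1) by (blast intro: smooth_continuous smooth_partial)+
  have i1: "integrable lborel (\<lambda>y. w y * \<tau> y)"
    by (intro integrable_csupp continuous_intros w c csupp_mono[OF \<tau>(2)]) simp
  have i2: "integrable lborel (\<lambda>y. w y * (s y * \<theta> y))"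
    by (intro integrable_csupp continuous_intros w c csupp_mono[OF \<theta>(2)]) simp
  have i3: "integrable lborel (\<lambda>y. w y * Z y)"
  proof (rule integrable_csupp)
    show "continuous_on UNIV (\<lambda>y. w y * Z y)"
      unfolding Z_def by (intro continuous_intros w c U)
    show "csupp (\<lambda>y. w y * Z y)"
      by (rule csuppI[of "R + 1"]) (use R dR in \<open>simp add: Z_def\<close>)
  qed
  have s\<Xi>: "smooth \<Xi>" "csupp \<Xi>" using t\<Xi> unfolding test_function_iff by blast+
  have j1: "integrable lborel (\<lambda>y. U y \<bullet> \<Xi> y)"
  proof (rule integrable_csupp)
    show "continuous_on UNIV (\<lambda>y. U y \<bullet> \<Xi> y)"
      by (rule continuous_on_inner[OF U smooth_continuous[OF s\<Xi>(1)]])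
    show "csupp (\<lambda>y. U y \<bullet> \<Xi> y)"
      by (rule csupp_mono[OF s\<Xi>(2)]) simp
  qed
  have cp: "continuous_on UNIV (\<lambda>y. partial i \<Xi> y $ j)" for i j
    by (intro smooth_continuous smooth_vec_nth smooth_partial s\<Xi>)
  have cs: "csupp (\<lambda>y. partial i \<Xi> y $ j)" for i j
    by (rule csupp_mono[OF csupp_partial[OF s\<Xi>(2), of i]]) simp
  have jt: "integrable lborel (\<lambda>y. tensor_grad (v y) (U y) \<Xi> y)" if "continuous_on UNIV v" for v
    unfolding tensor_grad_def
  proof (intro Bochner_Integration.integrable_sum integrable_csupp)
    fix i j
    show "continuous_on UNIV (\<lambda>y. v y $ i * U y $ j * partial i \<Xi> y $ j)"
      by (intro continuous_intros that U cp)
    show "csupp (\<lambda>y. v y $ i * U y $ j * partial i \<Xi> y $ j)"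
      by (rule csupp_mono[OF cs[of i j]]) simp
  qed
  have "(1 - 4 * \<gamma>) * (LINT y|lborel. U y \<bullet> \<Xi> y) - \<gamma> * (LINT y|lborel. tensor_grad y (U y) \<Xi> y)
      - (LINT y|lborel. tensor_grad (U y) (U y) \<Xi> y) = 0"
    using eq[OF t\<Xi>] d\<Xi> j1 jt[OF continuous_on_id] jt[OF U]
    by (simp add: Bochner_Integration.integral_diff)
  then have "\<gamma> * (LINT y|lborel. w y * (s y * \<theta> y)) + 2 * \<gamma> * (LINT y|lborel. w y * \<tau> y) + (LINT y|lborel. w y * Z y)
      = (1 - 2 * \<gamma>) * (LINT y|lborel. w y * \<tau> y)"
    unfolding A1 A2 A3 by (simp add: algebra_simps)
  moreover have "(LINT y|lborel. w y * (\<gamma> * (s y * \<theta> y) + 2 * \<gamma> * \<tau> y + Z y))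
      = (LINT y|lborel. \<gamma> * (w y * (s y * \<theta> y)) + 2 * \<gamma> * (w y * \<tau> y) + w y * Z y)"
    by (simp add: algebra_simps)
  moreover have "\<dots> = \<gamma> * (LINT y|lborel. w y * (s y * \<theta> y)) + 2 * \<gamma> * (LINT y|lborel. w y * \<tau> y) + (LINT y|lborel. w y * Z y)"
    using i1 i2 i3 by (simp add: Bochner_Integration.integral_add)
  ultimately show ?thesis
    unfolding grad\<tau> by (simp only:)
qed

section \<open>The swirl-free part\<close>

definition reflect2 :: "real^3 \<Rightarrow> real^3" where
  "reflect2 y = vector [y $ 1, - (y $ 2), y $ 3]"

lemma reflect2_nth: "reflect2 y $ j = (if j = 2 then - 1 else 1) * y $ j"
  using exhaust_3[of j] by (auto simp: reflect2_def vector_3)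

lemma reflect2_reflect2: "reflect2 (reflect2 y) = y"
  by (simp add: vec_eq_iff reflect2_nth)

lemma linear_reflect2: "linear reflect2"
  by (rule linearI) (simp_all add: vec_eq_iff reflect2_nth algebra_simps)

lemma continuous_on_reflect2: "continuous_on S reflect2"
  by (rule linear_continuous_on[OF linear_conv_bounded_linear[THEN iffD1, OF linear_reflect2]])

lemma norm_reflect2: "norm (reflect2 y) = norm y"
  by (simp add: norm_eq_sqrt_inner inner_real3 reflect2_nth)

lemma orthogonal_transformation_reflect2: "orthogonal_transformation reflect2"
  by (simp add: orthogonal_transformation linear_reflect2 norm_reflect2)

lemma has_derivative_reflect2:
  fixes f :: "real^3 \<Rightarrow> real"
  assumes "f differentiable_on UNIV"
  shows "((\<lambda>y. f (reflect2 y)) has_derivative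
    (\<lambda>h. \<Sum>i\<in>UNIV. reflect2 h $ i *\<^sub>R partial i f (reflect2 y))) (at y)"
  using diff_chain_at[OF bounded_linear_imp_has_derivative[OF
      linear_conv_bounded_linear[THEN iffD1, OF linear_reflect2]] has_derivative_partial[OF assms]]
  by (simp add: o_def)

lemma partial_reflect2:
  fixes f :: "real^3 \<Rightarrow> real"
  assumes "f differentiable_on UNIV"
  shows "partial i (\<lambda>y. f (reflect2 y)) = (\<lambda>y. (if i = 2 then - 1 else 1) * partial i f (reflect2 y))"
proof (rule ext)
  fix y
  have "reflect2 (axis i 1) $ j *\<^sub>R partial j f (reflect2 y)
      = (if j = i then (if i = 2 then - 1 else 1) * partial i f (reflect2 y) else 0)" for j
    by (simp add: reflect2_nth axis_def)
  then show "partial i (\<lambda>y. f (reflect2 y)) y = (if i = 2 then - 1 else 1) * partial i f (reflect2 y)"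
    unfolding partial_eqI[OF has_derivative_reflect2[OF assms]] by (simp only: sum.delta finite iso_tuple_UNIV_I if_True)
qed

lemma smooth_reflect2:
  fixes f :: "real^3 \<Rightarrow> real"
  assumes "smooth f"
  shows "smooth (\<lambda>y. f (reflect2 y))"
proof -
  have "C_k k (\<lambda>y. f (reflect2 y))" if "smooth f" for k and f :: "real^3 \<Rightarrow> real"
    using that
  proof (induction k arbitrary: f)
    case 0
    then show ?case
      using continuous_on_compose2[OF smooth_continuous[OF 0] continuous_on_reflect2] by simp
  next
    case (Suc k)
    note d = smooth_differentiable[OF Suc.prems]
    have "(\<lambda>y. f (reflect2 y)) differentiable_on UNIV"
      by (rule has_derivative_imp_differentiable_on[OF has_derivative_reflect2[OF d]])
    moreover have "C_k k (partial i (\<lambda>y. f (reflect2 y)))" for i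
      unfolding partial_reflect2[OF d]
      by (intro C_k_bounded_linear[OF bounded_linear_mult_right] Suc.IH smooth_partial Suc.prems)
    ultimately show ?case by simp
  qed
  with assms show ?thesis by (simp add: smooth_def)
qed

text \<open>Reflection across a meridional plane preserves the swirl-free part and reverses the swirl.
  This representation avoids the singular frame on the axis.\<close>

lemma swirl_free_part_reflect2:
  assumes "axisym_vector U"
  shows "swirl_free_part U y = (1 / 2) *\<^sub>R (U y + reflect2 (U (reflect2 y)))"
proof -
  obtain f g h where fgh: "\<And>y. U y = f (cyl_r y) (y $ 3) *\<^sub>R e_r y
      + g (cyl_r y) (y $ 3) *\<^sub>R e_\<theta> y + h (cyl_r y) (y $ 3) *\<^sub>R e_z"
    using assms unfolding axisym_vector_iff_components by blast
  define F G H where "F = f (cyl_r y) (y $ 3)" and "G = g (cyl_r y) (y $ 3)" and "H = h (cyl_r y) (y $ 3)"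
  have c: "cyl_r (reflect2 y) = cyl_r y" by (simp add: cyl_r_def reflect2_nth)
  have Uy: "U y = F *\<^sub>R e_r y + G *\<^sub>R e_\<theta> y + H *\<^sub>R e_z"
    unfolding F_def G_def H_def by (rule fgh)
  have Ur: "U (reflect2 y) = F *\<^sub>R e_r (reflect2 y) + G *\<^sub>R e_\<theta> (reflect2 y) + H *\<^sub>R e_z"
    unfolding F_def G_def H_def using fgh[of "reflect2 y"] c by (simp add: reflect2_nth)
  have "(1 / 2) *\<^sub>R (U y + reflect2 (U (reflect2 y))) = F *\<^sub>R e_r y + H *\<^sub>R e_z"
    unfolding Uy Ur
    by (simp add: vec_eq_iff forall_3 reflect2_nth e_r_def e_\<theta>_def e_z_def vector_3 c)
  moreover have "swirl_free_part U y = F *\<^sub>R e_r y + H *\<^sub>R e_z"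
  proof (cases "cyl_r y = 0")
    case True
    then have "e_r y = 0" "e_\<theta> y = 0"
      by (simp_all add: e_r_def e_\<theta>_def vec_eq_iff forall_3 vector_3)
    then show ?thesis
      unfolding swirl_free_part_def comp_r_def comp_z_def Uy
      by (simp add: e_z_def inner_real3 vector_3)
  next
    case False
    have 1: "e_r y \<bullet> e_r y = 1"
      using False cyl_r_sq[of y, symmetric, unfolded power2_eq_square]
      by (simp add: e_r_def inner_real3 vector_3 flip: add_divide_distrib)
    have "e_\<theta> y \<bullet> e_r y = 0" "e_z \<bullet> e_r y = 0" "e_r y \<bullet> e_z = 0" "e_\<theta> y \<bullet> e_z = 0" "e_z \<bullet> e_z = 1"
      by (simp_all add: e_r_def e_\<theta>_def e_z_def inner_real3 vector_3)
    then show ?thesis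
      unfolding swirl_free_part_def comp_r_def comp_z_def Uy by (simp add: inner_add_left 1)
  qed
  ultimately show ?thesis by simp
qed

lemma continuous_swirl_free_part:
  assumes "continuous_on UNIV U" "axisym_vector U"
  shows "continuous_on UNIV (swirl_free_part U)"
proof -
  have "continuous_on UNIV (\<lambda>y. (1 / 2) *\<^sub>R (U y + reflect2 (U (reflect2 y))))"
    by (intro continuous_intros assms(1) continuous_on_compose2[OF continuous_on_reflect2]
        continuous_on_compose2[OF assms(1) continuous_on_reflect2]) auto
  then show ?thesis by (simp add: swirl_free_part_reflect2[OF assms(2), abs_def])
qed

lemma weak_div_of_distr:
  assumes "distr_div_free U"
  shows "weak_div (\<lambda>j y. U y $ j) 0"
  using assms unfolding distr_div_free_def weak_div_def test_function_iff
  by (simp add: grad_def inner_vec_def)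

text \<open>The swirl-free part is the average of \<open>U\<close> and its mirror image. Testing the
  mirror image with \<phi> amounts to testing \<open>U\<close> with the reflected \<phi>, as the
  reflection preserves Lebesgue measure.\<close>

lemma weak_div_swirl_free_part:
  assumes U: "continuous_on UNIV U" and ax: "axisym_vector U" and div: "weak_div (\<lambda>j y. U y $ j) 0"
  shows "weak_div (\<lambda>j y. swirl_free_part U y $ j) 0"
  unfolding weak_div_def
proof (intro allI impI)
  fix \<phi> :: "real^3 \<Rightarrow> real" assume "smooth \<phi> \<and> csupp \<phi>"
  then have \<phi>: "smooth \<phi>" "csupp \<phi>" by auto
  define V where "V y = (\<Sum>j\<in>UNIV. U y $ j * partial j \<phi> y)" for y
  define V' where "V' y = (\<Sum>j\<in>UNIV. reflect2 (U (reflect2 y)) $ j * partial j \<phi> y)" for y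
  have r: "smooth (\<lambda>y. \<phi> (reflect2 y))" "csupp (\<lambda>y. \<phi> (reflect2 y))"
  proof -
    show "smooth (\<lambda>y. \<phi> (reflect2 y))" by (rule smooth_reflect2[OF \<phi>(1)])
    obtain R where "\<And>y. R \<le> norm y \<Longrightarrow> \<phi> y = 0" using csuppE[OF \<phi>(2)] by blast
    then show "csupp (\<lambda>y. \<phi> (reflect2 y))" by (intro csuppI[of R]) (simp add: norm_reflect2)
  qed
  have cp: "continuous_on UNIV (partial j \<phi>)" for j
    by (intro smooth_continuous smooth_partial \<phi>)
  have cr: "continuous_on UNIV (\<lambda>y. U (reflect2 y))"
    by (rule continuous_on_compose2[OF U continuous_on_reflect2]) simp
  have cV: "continuous_on UNIV V" "continuous_on UNIV V'"
    unfolding V_def V'_def reflect2_nth by (intro continuous_intros U cr cp)+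
  obtain R where R: "\<And>y. R \<le> norm y \<Longrightarrow> \<phi> y = 0" using csuppE[OF \<phi>(2)] by blast
  have dR: "partial i \<phi> y = 0" if "R + 1 \<le> norm y" for i y
    by (rule partial_zero_outside[of R]) (use R that in auto)
  have sV: "csupp V" "csupp V'"
    by (rule csuppI[of "R + 1"]; simp add: V_def V'_def dR)+
  have V0: "(LINT y|lborel. V y) = 0"
    using div \<phi> unfolding V_def weak_div_def by simp
  have "(LINT y|lborel. V' (reflect2 y)) = 0"
  proof -
    have "V' (reflect2 y) = (\<Sum>j\<in>UNIV. U y $ j * partial j (\<lambda>y. \<phi> (reflect2 y)) y)" for y
      unfolding V'_def partial_reflect2[OF smooth_differentiable[OF \<phi>(1)]] reflect2_reflect2
      by (simp add: reflect2_nth sum_3)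
    then show ?thesis using div r unfolding weak_div_def by simp
  qed
  then have V'0: "(LINT y|lborel. V' y) = 0"
    using lborel_integral_orthogonal[OF orthogonal_transformation_reflect2
        borel_measurable_continuous_onI[OF cV(2)]] by simp
  have "(\<lambda>y. \<Sum>j\<in>UNIV. swirl_free_part U y $ j * partial j \<phi> y) = (\<lambda>y. 1 / 2 * (V y + V' y))"
    unfolding swirl_free_part_reflect2[OF ax] V_def V'_def
    by (rule ext) (simp add: sum_3 algebra_simps)
  then show "(LINT y|lborel. (\<Sum>j\<in>UNIV. swirl_free_part U y $ j * partial j \<phi> y)) = - 0 * (LINT y|lborel. \<phi> y)"
    using V0 V'0 integrable_csupp[OF cV(1) sV(1)] integrable_csupp[OF cV(2) sV(2)]
    by (simp add: Bochner_Integration.integral_add)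
qed

lemma swirl_part_tangential:
  assumes "axisym_vector U"
  shows "\<exists>s. U y - swirl_free_part U y = s *\<^sub>R vector [- (y $ 2), y $ 1, 0]"
proof
  have "U y - swirl_free_part U y = comp_\<theta> U y *\<^sub>R e_\<theta> y"
    using cylindrical_decomposition[OF assms, of y] by simp
  also have "e_\<theta> y = (1 / cyl_r y) *\<^sub>R vector [- (y $ 2), y $ 1, 0]"
    by (simp add: e_\<theta>_def vec_eq_iff forall_3 vector_3)
  finally show "U y - swirl_free_part U y = (comp_\<theta> U y / cyl_r y) *\<^sub>R vector [- (y $ 2), y $ 1, 0]"
    by simp
qed

section \<open>Continuity of the vorticity; weak divergence and curl of the drift\<close>

lemma locally_hoelder_continuous:
  assumes "locally_hoelder \<alpha> f" "\<alpha> > 0"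
  shows "continuous_on UNIV f"
proof -
  have "isCont f x" for x
  proof -
    obtain C where C: "\<forall>y\<in>cball x 1. \<forall>z\<in>cball x 1. \<bar>f y - f z\<bar> \<le> C * dist y z powr \<alpha>"
      using assms(1) compact_cball unfolding locally_hoelder_def by blast
    have lim: "((\<lambda>y. C * dist y x powr \<alpha>) \<longlongrightarrow> C * 0) (at x)"
    proof (intro tendsto_mult_left)
      have "((\<lambda>y. dist y x) \<longlongrightarrow> 0) (at x)"
        using tendsto_dist[OF tendsto_ident_at tendsto_const, of x x UNIV] by simp
      then show "((\<lambda>y. dist y x powr \<alpha>) \<longlongrightarrow> 0) (at x)"
        using assms(2) by (intro tendsto_zero_powrI[where b = \<alpha>]) (auto intro: tendsto_const)
    qed
    have "\<forall>\<^sub>F y in at x. norm (f y - f x) \<le> C * dist y x powr \<alpha>"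
      unfolding eventually_at
    proof (intro exI[of _ 1] conjI ballI impI)
      fix y assume "y \<noteq> x \<and> dist y x < 1"
      then have "y \<in> cball x 1" "x \<in> cball x 1" by (auto simp: dist_commute)
      then show "norm (f y - f x) \<le> C * dist y x powr \<alpha>" using C by simp
    qed simp
    from Lim_null_comparison[OF this] lim have "((\<lambda>y. f y - f x) \<longlongrightarrow> 0) (at x)"
      by simp
    then show ?thesis unfolding isCont_def by (rule LIM_zero_cancel)
  qed
  then show ?thesis by (simp add: continuous_on_eq_continuous_at)
qed

text \<open>The frame vector is discontinuous on the axis but has norm at most 1, and \<omega> tends
  to 0 there; off the axis both factors are continuous.\<close>

lemma continuous_azimuthal:
  fixes \<omega> :: "real^3 \<Rightarrow> real"
  assumes \<omega>: "continuous_on UNIV \<omega>" and zero: "\<And>y. cyl_r y = 0 \<Longrightarrow> \<omega> y = 0"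
  shows "continuous_on UNIV (\<lambda>y. \<omega> y *\<^sub>R e_\<theta> y)"
proof -
  have i: "isCont \<omega> x" for x using \<omega> by (simp add: continuous_on_eq_continuous_at)
  have c: "isCont cyl_r x" for x
    using continuous_on_cyl_r[of UNIV] by (simp add: continuous_on_eq_continuous_at)
  have n: "norm (e_\<theta> y) \<le> 1" for y
  proof (cases "cyl_r y = 0")
    case False
    then have "e_\<theta> y \<bullet> e_\<theta> y = 1"
      using cyl_r_sq[of y, symmetric, unfolded power2_eq_square]
      by (simp add: e_\<theta>_def inner_real3 vector_3 add.commute flip: add_divide_distrib)
    then show ?thesis by (simp add: norm_eq_sqrt_inner)
  qed (simp add: e_\<theta>_def norm_eq_sqrt_inner inner_real3 vector_3)
  have "isCont (\<lambda>y. \<omega> y *\<^sub>R e_\<theta> y) x" for x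
  proof (cases "cyl_r x = 0")
    case True
    have "(\<omega> \<longlongrightarrow> 0) (at x)" using i[of x] zero[OF True] by (simp add: isCont_def)
    then have "((\<lambda>y. \<omega> y *\<^sub>R e_\<theta> y) \<longlongrightarrow> 0) (at x)"
      by (rule Lim_null_comparison[rotated, OF tendsto_norm_zero])
         (use n in \<open>simp add: mult_left_le\<close>)
    then show ?thesis using zero[OF True] by (simp add: isCont_def)
  next
    case False
    have "isCont (\<lambda>y::real^3. (1 / cyl_r y) *\<^sub>R (vector [- (y $ 2), y $ 1, 0] :: real^3)) x"
    proof (intro continuous_intros c False)
      have "continuous_on UNIV (\<lambda>y::real^3. vector [- (y $ 2), y $ 1, 0] :: real^3)"
        by (intro smooth_continuous smooth_vector3(1) smooth_uminus smooth_component smooth_const)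
      then show "isCont (\<lambda>y::real^3. vector [- (y $ 2), y $ 1, 0] :: real^3) x"
        by (simp add: continuous_on_eq_continuous_at)
    qed
    moreover have "(1 / cyl_r y) *\<^sub>R (vector [- (y $ 2), y $ 1, 0] :: real^3) = e_\<theta> y" for y
      by (simp add: e_\<theta>_def vec_eq_iff forall_3 vector_3)
    ultimately show ?thesis using i by (intro continuous_intros) simp_all
  qed
  then show ?thesis by (simp add: continuous_on_eq_continuous_at)
qed

lemma weak_div_drift:
  assumes b: "continuous_on UNIV b" and div: "weak_div (\<lambda>j y. b y $ j) 0"
  shows "weak_div (\<lambda>j y. \<gamma> * y $ j + b y $ j) (3 * \<gamma>)"
  unfolding weak_div_def
proof (intro allI impI)
  fix \<phi> :: "real^3 \<Rightarrow> real" assume "smooth \<phi> \<and> csupp \<phi>"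
  then have \<phi>: "smooth \<phi>" "csupp \<phi>" by auto
  have i1: "integrable lborel (\<lambda>y. y $ j * partial j \<phi> y)" for j
    by (intro integrable_smooth_mult smooth_component smooth_partial csupp_partial \<phi>)
  have i2: "integrable lborel (\<lambda>y. b y $ j * partial j \<phi> y)" for j
    by (intro integrable_csupp continuous_intros b smooth_continuous smooth_partial \<phi>
        csupp_mono[OF csupp_partial[OF \<phi>(2), of j]]) simp
  have p: "(LINT y|lborel. y $ j * partial j \<phi> y) = - (LINT y|lborel. \<phi> y)" for j
    using integration_by_parts[OF smooth_component \<phi>, of j j] by (simp add: partial_component)
  have "(LINT y|lborel. (\<Sum>j\<in>UNIV. (\<gamma> * y $ j + b y $ j) * partial j \<phi> y))
      = (LINT y|lborel. (\<Sum>j\<in>UNIV. \<gamma> * (y $ j * partial j \<phi> y)) + (\<Sum>j\<in>UNIV. b y $ j * partial j \<phi> y))"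
    by (simp add: algebra_simps sum.distrib)
  also have "\<dots> = (\<Sum>j\<in>UNIV. \<gamma> * (LINT y|lborel. y $ j * partial j \<phi> y)) + (LINT y|lborel. (\<Sum>j\<in>UNIV. b y $ j * partial j \<phi> y))"
    using i1 i2 by (simp add: Bochner_Integration.integral_add Bochner_Integration.integral_sum
        Bochner_Integration.integrable_sum)
  also have "\<dots> = - (3 * \<gamma>) * (LINT y|lborel. \<phi> y)"
    using div \<phi> unfolding weak_div_def by (simp add: p sum_3)
  finally show "(LINT y|lborel. (\<Sum>j\<in>UNIV. (\<gamma> * y $ j + b y $ j) * partial j \<phi> y)) = - (3 * \<gamma>) * (LINT y|lborel. \<phi> y)" .
qed

lemma weak_curl_drift:
  assumes b: "continuous_on UNIV b" and curl: "weak_curl (\<lambda>j y. b y $ j) \<Omega>"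
  shows "weak_curl (\<lambda>j y. \<gamma> * y $ j + b y $ j) \<Omega>"
  unfolding weak_curl_def
proof (intro allI impI)
  fix \<phi> :: "real^3 \<Rightarrow> real" and i j :: 3 assume "smooth \<phi> \<and> csupp \<phi>"
  then have \<phi>: "smooth \<phi>" "csupp \<phi>" by auto
  have i1: "integrable lborel (\<lambda>y. y $ j * partial i \<phi> y)" for i j
    by (intro integrable_smooth_mult smooth_component smooth_partial csupp_partial \<phi>)
  have i2: "integrable lborel (\<lambda>y. b y $ j * partial i \<phi> y)" for i j
    by (intro integrable_csupp continuous_intros b smooth_continuous smooth_partial \<phi>
        csupp_mono[OF csupp_partial[OF \<phi>(2), of i]]) simp
  \<comment> \<open>Both sides are minus the integral of \<phi> if i = j and 0 otherwise: the field
    y is curl-free.\<close>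
  have p: "(LINT y|lborel. y $ j * partial i \<phi> y) = (LINT y|lborel. y $ i * partial j \<phi> y)"
    unfolding integration_by_parts[OF smooth_component \<phi>] partial_component
    by (cases "i = j") simp_all
  have "(LINT y|lborel. (\<gamma> * y $ j + b y $ j) * partial i \<phi> y - (\<gamma> * y $ i + b y $ i) * partial j \<phi> y)
      = (LINT y|lborel. \<gamma> * (y $ j * partial i \<phi> y) - \<gamma> * (y $ i * partial j \<phi> y)
          + (b y $ j * partial i \<phi> y - b y $ i * partial j \<phi> y))"
    by (simp add: algebra_simps)
  also have "\<dots> = (LINT y|lborel. b y $ j * partial i \<phi> y - b y $ i * partial j \<phi> y)"
    using i1 i2 by (simp add: Bochner_Integration.integral_add Bochner_Integration.integral_diff p)
  also have "\<dots> = - (LINT y|lborel. \<Omega> i j y * \<phi> y)"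
    using curl \<phi> unfolding weak_curl_def by blast
  finally show "(LINT y|lborel. (\<gamma> * y $ j + b y $ j) * partial i \<phi> y - (\<gamma> * y $ i + b y $ i) * partial j \<phi> y)
      = - (LINT y|lborel. \<Omega> i j y * \<phi> y)" .
qed

section \<open>Vanishing of circulation and potential vorticity\<close>

text \<open>In contrast to \<open>cutoff_exists\<close> the plateau is \<open>step 2\<close> and not
  1: what counts here is positivity, boundedness and the sign of the gradient.\<close>

definition radial_cutoff :: "real \<Rightarrow> real^3 \<Rightarrow> real" where
  "radial_cutoff R y = step (3 - 1 / R\<^sup>2 * (y \<bullet> y))"

lemma smooth_radial_arg: "smooth (\<lambda>y::real^3. 3 - 1 / R\<^sup>2 * (y \<bullet> y))"
  by (intro smooth_diff smooth_const smooth_cmult smooth_norm_sq)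

lemma smooth_radial_cutoff: "smooth (radial_cutoff R)"
  unfolding radial_cutoff_def by (rule smooth_step[OF smooth_radial_arg])

lemma radial_cutoff_outside:
  assumes "R > 0" "2 * R \<le> norm y"
  shows "radial_cutoff R y = 0"
proof -
  have "(2 * R)\<^sup>2 \<le> y \<bullet> y"
    using assms power_mono[of "2 * R" "norm y" 2] by (simp add: dot_square_norm)
  then have "4 \<le> 1 / R\<^sup>2 * (y \<bullet> y)"
    using assms by (simp add: field_simps power_mult_distrib)
  then show ?thesis by (simp add: radial_cutoff_def step_zero)
qed

lemma csupp_radial_cutoff: "R > 0 \<Longrightarrow> csupp (radial_cutoff R)"
  by (rule csuppI[of "2 * R"]) (rule radial_cutoff_outside)

lemma radial_cutoff_pos:
  assumes "R > 0" "norm y \<le> R"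
  shows "0 < radial_cutoff R y"
proof -
  have "y \<bullet> y \<le> R\<^sup>2" using assms by (simp add: dot_square_norm power_mono)
  then have "1 / R\<^sup>2 * (y \<bullet> y) \<le> 1" using assms by (simp add: field_simps)
  then show ?thesis by (simp add: radial_cutoff_def step_pos)
qed

lemma axisym_radial_cutoff: "axisym_scalar (radial_cutoff R)"
proof -
  have "rot_z t y \<bullet> rot_z t y = y \<bullet> y" for t y
    using orthogonal_transformation_rot_z[of t] by (simp add: orthogonal_transformation_def)
  then show ?thesis by (simp add: axisym_scalar_def radial_cutoff_def)
qed

lemma partial_radial_cutoff:
  "partial i (radial_cutoff R) y = - (bump (3 - 1 / R\<^sup>2 * (y \<bullet> y)) * (2 / R\<^sup>2) * y $ i)"
proof -
  have "partial i (\<lambda>y::real^3. 3 - 1 / R\<^sup>2 * (y \<bullet> y)) = (\<lambda>y. - (1 / R\<^sup>2 * (2 * y $ i)))"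
    using partial_add[OF smooth_differentiable[OF smooth_const[of "3::real"]]
        smooth_differentiable[OF smooth_uminus[OF smooth_cmult[OF smooth_norm_sq, of "1 / R\<^sup>2"]]], of i]
    by (simp add: partial_const partial_uminus[OF smooth_cmult[OF smooth_norm_sq, of "1 / R\<^sup>2", simplified]]
        partial_cmult[OF smooth_norm_sq, of i "1 / R\<^sup>2", simplified] partial_norm_sq)
  then show ?thesis
    unfolding radial_cutoff_def[abs_def] partial_step[OF smooth_radial_arg] by simp
qed

text \<open>The gradient of the cutoff is a nonpositive multiple of y, and it vanishes for |y| < R,
  where the drift may point in any direction.\<close>

lemma drift_radial_cutoff:
  assumes R: "R > 0" and out: "\<And>y. R \<le> norm y \<Longrightarrow> 0 \<le> (\<Sum>j\<in>UNIV. B j y * y $ j)"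
  shows "(\<Sum>j\<in>UNIV. B j y * partial j (radial_cutoff R) y) \<le> 0"
proof -
  define q where "q = bump (3 - 1 / R\<^sup>2 * (y \<bullet> y)) * (2 / R\<^sup>2)"
  have "(\<Sum>j\<in>UNIV. B j y * partial j (radial_cutoff R) y) = - (q * (\<Sum>j\<in>UNIV. B j y * y $ j))"
    unfolding partial_radial_cutoff q_def[symmetric] by (simp add: sum_3 algebra_simps)
  moreover have "0 \<le> q * (\<Sum>j\<in>UNIV. B j y * y $ j)"
  proof (cases "R \<le> norm y")
    case True
    have "0 \<le> q" unfolding q_def by (intro mult_nonneg_nonneg bump_nonneg) simp
    then show ?thesis using out[OF True] by (rule mult_nonneg_nonneg)
  next
    case False
    then have "y \<bullet> y \<le> R\<^sup>2" by (simp add: dot_square_norm power_mono)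
    then have "1 / R\<^sup>2 * (y \<bullet> y) \<le> 1" using R by (simp add: field_simps)
    then have "q = 0" by (simp add: q_def bump_zero)
    then show ?thesis by simp
  qed
  ultimately show ?thesis by linarith
qed

text \<open>If |d| < n (c + d), then the doubled index 2 n is even and still beats d.\<close>

lemma even_power_choice:
  fixes c d :: real
  assumes "c + d > 0"
  obtains p :: nat where "even p" "p \<ge> 1" "p * (c + d) - d > 0"
proof -
  obtain n :: nat where n: "\<bar>d\<bar> < n * (c + d)" using reals_Archimedean3[OF assms] by blast
  then have "n \<noteq> 0" by (cases "n = 0") auto
  then show thesis using that[of "2 * n"] n by (simp add: algebra_simps)
qed

lemma transport_vanishes:
  assumes B: "\<And>j. continuous_on UNIV (B j)" and div: "weak_div B d"
    and curl: "weak_curl B \<Omega>" "\<And>i j. continuous_on UNIV (\<Omega> i j)"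
    and out: "\<And>y. R0 \<le> norm y \<Longrightarrow> 0 \<le> (\<Sum>j\<in>UNIV. B j y * y $ j)"
    and w: "continuous_on UNIV w" "axisym_scalar w"
    and weak: "\<And>\<psi>. smooth \<psi> \<Longrightarrow> csupp \<psi> \<Longrightarrow> axisym_scalar \<psi> \<Longrightarrow>
      (LINT y|lborel. w y * (\<Sum>j\<in>UNIV. B j y * partial j \<psi> y)) = c * (LINT y|lborel. w y * \<psi> y)"
    and cd: "c + d > 0"
  shows "w y = 0"
proof -
  obtain p :: nat where p: "even p" "p \<ge> 1" "p * (c + d) - d > 0" using even_power_choice[OF cd] .
  \<comment> \<open>Large enough for the drift to point outwards beyond \<open>R\<close> and for the
    given point to lie where the cutoff is positive.\<close>
  define R where "R = max R0 (norm y + 1)"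
  have R: "R > 0" "R0 \<le> R" "norm y \<le> R" unfolding R_def using norm_ge_zero[of y] by linarith+
  let ?\<phi> = "radial_cutoff R"
  note \<phi> = smooth_radial_cutoff[of R] csupp_radial_cutoff[OF R(1)] axisym_radial_cutoff[of R]
  \<comment> \<open>No region is to be avoided here: \<open>A\<close> is empty, and any positive
    margin serves.\<close>
  have id: "(LINT x|lborel. (\<Sum>j\<in>UNIV. B j x * partial j ?\<phi> x) * w x ^ p)
      = (p * (c + d) - d) * (LINT x|lborel. ?\<phi> x * w x ^ p)"
    by (rule transport_power[OF B div curl w _ \<phi>, where A = "{}" and ?e0.0 = 1]) (use p in \<open>auto intro: weak\<close>)
  have "(LINT x|lborel. - ((\<Sum>j\<in>UNIV. B j x * partial j ?\<phi> x) * w x ^ p)) \<ge> 0"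
  proof (intro Bochner_Integration.integral_nonneg)
    fix x
    have "(\<Sum>j\<in>UNIV. B j x * partial j ?\<phi> x) \<le> 0"
      by (rule drift_radial_cutoff[OF R(1)]) (use out R in auto)
    then show "0 \<le> - ((\<Sum>j\<in>UNIV. B j x * partial j ?\<phi> x) * w x ^ p)"
      using mult_nonpos_nonneg[OF _ zero_le_even_power[OF p(1)]] by simp
  qed
  then have "(p * (c + d) - d) * (LINT x|lborel. ?\<phi> x * w x ^ p) \<le> 0"
    unfolding id[symmetric] by simp
  then have "(LINT x|lborel. ?\<phi> x * w x ^ p) \<le> 0"
    using p(3) by (simp add: mult_le_0_iff)
  then have "?\<phi> y * w y ^ p = 0"
  proof (rule integral_nonpos_imp_zero[rotated 3])
    show "continuous_on UNIV (\<lambda>x. ?\<phi> x * w x ^ p)"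
      by (intro continuous_intros w smooth_continuous[OF \<phi>(1)])
    show "csupp (\<lambda>x. ?\<phi> x * w x ^ p)"
      by (rule csupp_mono[OF \<phi>(2)]) simp
    show "0 \<le> ?\<phi> x * w x ^ p" for x
      by (intro mult_nonneg_nonneg zero_le_even_power p) (simp add: radial_cutoff_def step_nonneg)
  qed
  then show ?thesis using radial_cutoff_pos[OF R(1,3)] by simp
qed

text \<open>Zero for r \<le> 2 \<delta> and constant for r \<ge> 3 \<delta>. The weak equation is
  available for test functions vanishing on r \<le> \<delta>; the gap of width \<delta> leaves room
  for mollification.\<close>

definition axis_cutoff :: "real \<Rightarrow> real^3 \<Rightarrow> real" where
  "axis_cutoff \<delta> y = step (1 / (4 * \<delta>\<^sup>2) * (y $ 1 * y $ 1 + y $ 2 * y $ 2))"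

lemma smooth_axis_arg: "smooth (\<lambda>y::real^3. k * (y $ 1 * y $ 1 + y $ 2 * y $ 2))"
  by (intro smooth_cmult smooth_add smooth_mult smooth_component)

lemma smooth_axis_cutoff: "smooth (axis_cutoff \<delta>)"
  unfolding axis_cutoff_def by (rule smooth_step[OF smooth_axis_arg])

lemma axis_cutoff_cyl: "axis_cutoff \<delta> y = step (1 / (4 * \<delta>\<^sup>2) * (cyl_r y)\<^sup>2)"
  by (simp add: axis_cutoff_def cyl_r_sq)

lemma axisym_axis_cutoff: "axisym_scalar (axis_cutoff \<delta>)"
  by (simp add: axisym_scalar_def axis_cutoff_cyl)

lemma axis_cutoff_zero:
  assumes "\<delta> > 0" "cyl_r y \<le> 2 * \<delta>"
  shows "axis_cutoff \<delta> y = 0"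
proof -
  have "(cyl_r y)\<^sup>2 \<le> (2 * \<delta>)\<^sup>2" using assms cyl_r_nonneg by (intro power_mono) auto
  then have "1 / (4 * \<delta>\<^sup>2) * (cyl_r y)\<^sup>2 \<le> 1" using assms by (simp add: field_simps power_mult_distrib)
  then show ?thesis unfolding axis_cutoff_cyl by (rule step_zero)
qed

lemma axis_cutoff_pos:
  assumes "\<delta> > 0" "2 * \<delta> < cyl_r y"
  shows "0 < axis_cutoff \<delta> y"
proof -
  have "(2 * \<delta>)\<^sup>2 < (cyl_r y)\<^sup>2" using assms by (intro power_strict_mono) auto
  then have "1 < 1 / (4 * \<delta>\<^sup>2) * (cyl_r y)\<^sup>2" using assms by (simp add: field_simps power_mult_distrib)
  then show ?thesis unfolding axis_cutoff_cyl by (rule step_pos)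
qed

lemma axis_cutoff_mono:
  assumes "0 < \<delta>" "\<delta> \<le> \<delta>'"
  shows "axis_cutoff \<delta>' y \<le> axis_cutoff \<delta> y"
proof -
  have "\<delta>\<^sup>2 \<le> \<delta>'\<^sup>2" using assms by (intro power_mono) auto
  then have "1 / (4 * \<delta>'\<^sup>2) \<le> 1 / (4 * \<delta>\<^sup>2)" using assms by (intro divide_left_mono) auto
  then show ?thesis unfolding axis_cutoff_cyl by (intro step_mono mult_right_mono) auto
qed

lemma partial_axis_cutoff:
  "partial i (axis_cutoff \<delta>) y = bump (1 / (4 * \<delta>\<^sup>2) * (cyl_r y)\<^sup>2) * (1 / (4 * \<delta>\<^sup>2)) *
     (if i = 1 then 2 * y $ 1 else if i = 2 then 2 * y $ 2 else 0)"
proof -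
  have s: "smooth (\<lambda>y::real^3. y $ 1 * y $ 1 + y $ 2 * y $ 2)"
    by (intro smooth_add smooth_mult smooth_component)
  have "partial i (\<lambda>y::real^3. y $ 1 * y $ 1 + y $ 2 * y $ 2) y
      = (if i = 1 then 2 * y $ 1 else if i = 2 then 2 * y $ 2 else 0)"
    by (subst partial_add, (intro smooth_differentiable smooth_mult smooth_component)+)
       (auto simp: partial_component_mult[OF smooth_component] partial_component)
  then show ?thesis
    unfolding axis_cutoff_def[abs_def] partial_step[OF smooth_axis_arg] partial_cmult[OF s] cyl_r_sq by simp
qed

lemma abs_component_le_cyl_r: "\<bar>y $ 1\<bar> \<le> cyl_r y" "\<bar>y $ 2\<bar> \<le> cyl_r y"
  unfolding cyl_r_def by (rule real_le_rsqrt; simp)+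

text \<open>The gradient is (y_1, y_2, 0) / (2 \<delta>^2) times a value of \<open>bump\<close>,
  hence times at most 1. With |y_1|, |y_2| \<le> 3 \<delta> the two terms add up to at most 3 M /
  \<delta>.\<close>

lemma drift_axis_cutoff:
  assumes \<delta>: "\<delta> > 0" and M: "\<And>j. \<bar>B j y\<bar> \<le> M"
  shows "\<bar>\<Sum>j\<in>UNIV. B j y * partial j (axis_cutoff \<delta>) y\<bar>
    \<le> 3 * M / \<delta> * indicator {y. cyl_r y \<le> 3 * \<delta>} y"
proof (cases "cyl_r y \<le> 3 * \<delta>")
  case True
  define q where "q = bump (1 / (4 * \<delta>\<^sup>2) * (cyl_r y)\<^sup>2)"
  have q: "0 \<le> q" "q \<le> 1" by (simp_all add: q_def bump_nonneg bump_le_1)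
  have y12: "\<bar>y $ 1\<bar> \<le> 3 * \<delta>" "\<bar>y $ 2\<bar> \<le> 3 * \<delta>"
    using True abs_component_le_cyl_r[of y]
    by simp_all
  have b: "\<bar>B 1 y * y $ 1\<bar> \<le> M * (3 * \<delta>)" "\<bar>B 2 y * y $ 2\<bar> \<le> M * (3 * \<delta>)"
    unfolding abs_mult using M[of 1] M[of 2] y12 by (intro mult_mono; linarith)+
  have "(\<Sum>j\<in>UNIV. B j y * partial j (axis_cutoff \<delta>) y)
      = q * (1 / (2 * \<delta>\<^sup>2)) * (B 1 y * y $ 1 + B 2 y * y $ 2)"
    unfolding partial_axis_cutoff q_def[symmetric] by (simp add: sum_3 add_divide_distrib algebra_simps)
  also have "\<bar>\<dots>\<bar> \<le> 1 * (1 / (2 * \<delta>\<^sup>2)) * (M * (3 * \<delta>) + M * (3 * \<delta>))"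
    unfolding abs_mult using q b abs_triangle_ineq[of "B 1 y * y $ 1" "B 2 y * y $ 2"]
    by (intro mult_mono) auto
  also have "\<dots> = 3 * M / \<delta>" using \<delta> by (simp add: field_simps power2_eq_square)
  finally show ?thesis using True by simp
next
  case False
  then have "(3 * \<delta>)\<^sup>2 \<le> (cyl_r y)\<^sup>2" using \<delta> by (intro power_mono) auto
  then have "9 * \<delta>\<^sup>2 \<le> (cyl_r y)\<^sup>2" by (simp add: power_mult_distrib)
  then have "8 * \<delta>\<^sup>2 \<le> (cyl_r y)\<^sup>2"
    using zero_le_power2[of \<delta>] by linarith
  then have "2 \<le> 1 / (4 * \<delta>\<^sup>2) * (cyl_r y)\<^sup>2" using \<delta> by (simp add: field_simps)
  then have "bump (1 / (4 * \<delta>\<^sup>2) * (cyl_r y)\<^sup>2) = 0" by (simp add: bump_zero)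
  then show ?thesis using False by (simp add: partial_axis_cutoff)
qed

text \<open>The box has sides 6 \<delta>, 6 \<delta> and 4 R, and encloses the part of the cylinder
  r \<le> 3 \<delta> that lies in the ball of radius 2 R.\<close>

lemma thin_cylinder_volume:
  assumes "\<delta> > 0" "R > 0"
  shows "integrable lborel (indicator (cbox (vector [-3 * \<delta>, -3 * \<delta>, -2 * R]) (vector [3 * \<delta>, 3 * \<delta>, 2 * R])) :: real^3 \<Rightarrow> real)"
    and "(LINT y|lborel. indicator (cbox (vector [-3 * \<delta>, -3 * \<delta>, -2 * R]) (vector [3 * \<delta>, 3 * \<delta>, 2 * R]) :: (real^3) set) y)
      = 144 * R * \<delta>\<^sup>2"
proof -
  let ?c = "cbox (vector [-3 * \<delta>, -3 * \<delta>, -2 * R]) (vector [3 * \<delta>, 3 * \<delta>, 2 * R]) :: (real^3) set"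
  show "integrable lborel (indicator ?c :: real^3 \<Rightarrow> real)"
    by (intro integrable_real_indicator emeasure_lborel_cbox_finite) simp
  define a b :: "real^3" where "a = vector [-3 * \<delta>, -3 * \<delta>, -2 * R]" and "b = vector [3 * \<delta>, 3 * \<delta>, 2 * R]"
  have ab: "a $ 1 = -3 * \<delta>" "a $ 2 = -3 * \<delta>" "a $ 3 = -2 * R" "b $ 1 = 3 * \<delta>" "b $ 2 = 3 * \<delta>" "b $ 3 = 2 * R"
    unfolding a_def b_def vector_3 by (rule refl)+
  have "a \<in> cbox a b"
    unfolding mem_box_cart forall_3 ab using assms by simp
  then have "measure lborel (cbox a b) = (\<Prod>i\<in>{1, 2, 3}. b $ i - a $ i)"
    unfolding UNIV_3[symmetric] by (intro content_cbox_cart) blast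
  also have "\<dots> = 144 * R * \<delta>\<^sup>2"
    by (simp add: ab power2_eq_square)
  finally have "measure lborel ?c = 144 * R * \<delta>\<^sup>2"
    unfolding a_def b_def .
  then show "(LINT y|lborel. indicator ?c y) = 144 * R * \<delta>\<^sup>2" by simp
qed

lemma cyl_r_shift: "cyl_r y \<le> cyl_r a + norm (a - y)"
proof -
  have n: "cyl_r v = norm (vector [v $ 1, v $ 2, 0] :: real^3)" for v
    by (simp add: cyl_r_def norm_eq_sqrt_inner inner_real3 vector_3 power2_eq_square)
  have "cyl_r v \<le> norm v" for v
    by (simp add: cyl_r_def norm_eq_sqrt_inner inner_real3 power2_eq_square)
  moreover have "(vector [y $ 1, y $ 2, 0] :: real^3)
      = vector [a $ 1, a $ 2, 0] - vector [(a - y) $ 1, (a - y) $ 2, 0]"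
    by (simp add: vec_eq_iff forall_3 vector_3)
  ultimately show ?thesis
    using norm_triangle_ineq4[of "vector [a $ 1, a $ 2, 0] :: real^3" "vector [(a - y) $ 1, (a - y) $ 2, 0]"]
    unfolding n[of y] n[of a] by (metis add_left_mono n order_trans)
qed

text \<open>The quotient \<open>\<omega> y / max (cyl_r y) \<delta>\<close> is continuous and equals
  Q for r \<ge> \<delta>. The integral of its power away from a fixed cylinder is squeezed between 0
  and a multiple of \<delta>, for every small \<delta>.\<close>

lemma potential_vorticity_vanishes:
  fixes \<omega> :: "real^3 \<Rightarrow> real"
  assumes B: "\<And>j. continuous_on UNIV (B j)" and div: "weak_div B d"
    and curl: "weak_curl B \<Omega>" "\<And>i j. continuous_on UNIV (\<Omega> i j)"
    and out: "\<And>y. R0 \<le> norm y \<Longrightarrow> 0 \<le> (\<Sum>j\<in>UNIV. B j y * y $ j)"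
    and \<omega>: "continuous_on UNIV \<omega>" "axisym_scalar \<omega>"
    and bound: "\<And>R. R > 0 \<Longrightarrow> \<exists>M. \<forall>y. norm y < R \<longrightarrow> 0 < cyl_r y \<longrightarrow> \<bar>\<omega> y / cyl_r y\<bar> \<le> M"
    and weak: "\<And>\<delta> \<psi>. \<delta> > 0 \<Longrightarrow> smooth \<psi> \<Longrightarrow> csupp \<psi> \<Longrightarrow> (\<And>y. cyl_r y \<le> \<delta> \<Longrightarrow> \<psi> y = 0) \<Longrightarrow>
      (LINT y|lborel. \<omega> y / max (cyl_r y) \<delta> * (\<Sum>j\<in>UNIV. B j y * partial j \<psi> y))
        = c * (LINT y|lborel. \<omega> y / max (cyl_r y) \<delta> * \<psi> y)"
    and cd: "c + d > 0" and y0: "0 < cyl_r y0"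
  shows "\<omega> y0 = 0"
proof -
  obtain p :: nat where p: "even p" "p \<ge> 1" "p * (c + d) - d > 0" using even_power_choice[OF cd] .
  define K where "K = p * (c + d) - d"
  have K: "K > 0" using p(3) by (simp add: K_def)
  define R where "R = max R0 (norm y0 + 1)"
  have R: "R > 0" "R0 \<le> R" "norm y0 \<le> R" unfolding R_def using norm_ge_zero[of y0] by linarith+
  define f where "f = radial_cutoff R"
  note f = smooth_radial_cutoff[of R, folded f_def] csupp_radial_cutoff[OF R(1), folded f_def]
    axisym_radial_cutoff[of R, folded f_def]
  have f0: "0 \<le> f x" "f x \<le> step 2" for x
    by (simp_all add: f_def radial_cutoff_def step_nonneg step_le)
  define w where "w \<delta> y = \<omega> y / max (cyl_r y) \<delta>" for \<delta> y
  have cw: "continuous_on UNIV (w \<delta>)" if "\<delta> > 0" for \<delta>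
  proof -
    have "max (cyl_r y) \<delta> \<noteq> 0" for y using that by simp
    then show ?thesis unfolding w_def by (intro continuous_intros \<omega> continuous_on_cyl_r) simp
  qed
  have aw: "axisym_scalar (w \<delta>)" for \<delta>
    using \<omega>(2) by (simp add: axisym_scalar_def w_def)
  obtain MB where MB: "MB \<ge> 0" "\<And>j y. norm y \<le> 2 * R \<Longrightarrow> \<bar>B j y\<bar> \<le> MB"
    by (rule continuous_bounded_on_cball[OF B], rule that)
  obtain MQ0 where MQ0: "\<And>y. norm y < 2 * R + 1 \<Longrightarrow> 0 < cyl_r y \<Longrightarrow> \<bar>\<omega> y / cyl_r y\<bar> \<le> MQ0"
    using bound[of "2 * R + 1"] R by auto
  define MQ where "MQ = max MQ0 0"
  \<comment> \<open>The collected bounds: \<open>step 2\<close> for the radial cutoff, 3 MB /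
    \<delta> for the drift across the axis cutoff, \<open>MQ ^ p\<close> for the power and 144 R
    \<delta>^2 for the volume, with the remaining factor \<delta> split off.\<close>
  define C where "C = step 2 * (3 * MB) * MQ ^ p * (144 * R)"
  define h where "h \<delta> y = f y * axis_cutoff \<delta> y * w \<delta> y ^ p" for \<delta> y
  have ch: "continuous_on UNIV (h \<delta>)" "csupp (h \<delta>)" "0 \<le> h \<delta> y" if "\<delta> > 0" for \<delta> y
  proof -
    show "continuous_on UNIV (h \<delta>)"
      unfolding h_def by (intro continuous_intros cw[OF that] smooth_continuous[OF f(1)] smooth_continuous[OF smooth_axis_cutoff])
    show "csupp (h \<delta>)" unfolding h_def by (rule csupp_mono[OF f(2)]) simp
    show "0 \<le> h \<delta> y"
      unfolding h_def using f0 by (intro mult_nonneg_nonneg zero_le_even_power p) (auto simp: axis_cutoff_def step_nonneg)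
  qed
  have small: "K * (LINT y|lborel. h \<delta> y) \<le> C * \<delta>" if \<delta>: "\<delta> > 0" for \<delta>
  proof -
    define \<phi> where "\<phi> y = f y * axis_cutoff \<delta> y" for y
    have \<phi>: "smooth \<phi>" "csupp \<phi>" "axisym_scalar \<phi>"
    proof -
      show "smooth \<phi>" unfolding \<phi>_def by (intro smooth_mult f smooth_axis_cutoff)
      show "csupp \<phi>" unfolding \<phi>_def by (rule csupp_mono[OF f(2)]) simp
      show "axisym_scalar \<phi>"
        using f(3) axisym_axis_cutoff[of \<delta>] by (simp add: axisym_scalar_def \<phi>_def)
    qed
    let ?c = "cbox (vector [-3 * \<delta>, -3 * \<delta>, -2 * R]) (vector [3 * \<delta>, 3 * \<delta>, 2 * R]) :: (real^3) set"
    have "(LINT x|lborel. (\<Sum>j\<in>UNIV. B j x * partial j \<phi> x) * w \<delta> x ^ p) = K * (LINT x|lborel. \<phi> x * w \<delta> x ^ p)"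
      unfolding K_def
    proof (rule transport_power[OF B div curl cw[OF \<delta>] aw _ \<phi> \<delta>, where A = "{y. cyl_r y \<le> \<delta>}"])
      fix \<psi> :: "real^3 \<Rightarrow> real"
      assume "smooth \<psi>" "csupp \<psi>" "axisym_scalar \<psi>" and z: "\<And>y. y \<in> {y. cyl_r y \<le> \<delta>} \<Longrightarrow> \<psi> y = 0"
      then show "(LINT y|lborel. w \<delta> y * (\<Sum>j\<in>UNIV. B j y * partial j \<psi> y)) = c * (LINT y|lborel. w \<delta> y * \<psi> y)"
        unfolding w_def by (intro weak[OF \<delta>]) auto
    next
      fix y a :: "real^3" assume "a \<in> {y. cyl_r y \<le> \<delta>}" "norm (a - y) < \<delta>"
      \<comment> \<open>Points within \<delta> of the excluded cylinder have r \<le> 2 \<delta>,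
        where the axis cutoff is 0.\<close>
      then have "cyl_r y \<le> 2 * \<delta>" using cyl_r_shift[of y a] by simp
      then show "\<phi> y = 0" by (simp add: \<phi>_def axis_cutoff_zero[OF \<delta>])
    qed (use p in simp)
    moreover have "(\<lambda>x. \<phi> x * w \<delta> x ^ p) = h \<delta>" by (simp add: \<phi>_def h_def fun_eq_iff)
    ultimately have "K * (LINT y|lborel. h \<delta> y) = (LINT x|lborel. (\<Sum>j\<in>UNIV. B j x * partial j \<phi> x) * w \<delta> x ^ p)"
      by simp
    also have "\<dots> \<le> (LINT x|lborel. step 2 * (3 * MB / \<delta>) * MQ ^ p * indicator ?c x)"
    proof (rule integral_mono)
      show "integrable lborel (\<lambda>x. step 2 * (3 * MB / \<delta>) * MQ ^ p * indicator ?c x)"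
        by (intro integrable_mult_right thin_cylinder_volume(1)[OF \<delta> R(1)])
      have "integrable lborel (\<lambda>x. (B j x * partial j \<phi> x) * w \<delta> x ^ p)" for j
        by (intro integrable_csupp continuous_intros B cw[OF \<delta>] smooth_continuous[OF smooth_partial[OF \<phi>(1)]]
            csupp_mono[OF csupp_partial[OF \<phi>(2), of j]]) simp
      then show "integrable lborel (\<lambda>x. (\<Sum>j\<in>UNIV. B j x * partial j \<phi> x) * w \<delta> x ^ p)"
        by (simp add: sum_distrib_right)
      fix x
      have nn: "0 \<le> step 2 * (3 * MB / \<delta>) * MQ ^ p * indicator ?c x"
        using \<delta> MB(1) by (simp add: step_nonneg MQ_def)
      show "(\<Sum>j\<in>UNIV. B j x * partial j \<phi> x) * w \<delta> x ^ p \<le> step 2 * (3 * MB / \<delta>) * MQ ^ p * indicator ?c x"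
      \<comment> \<open>Derivatives are known to vanish on open sets only, so the boundary values
        |x| = 2 R and r = 2 \<delta> fall into the second case.\<close>
      proof (cases "2 * R < norm x \<or> cyl_r x < 2 * \<delta>")
        case True
        have "partial j \<phi> x = 0" for j
        proof (cases "2 * R < norm x")
          case True
          then show ?thesis
            by (intro partial_zero_outside[of "2 * R"]) (simp_all add: \<phi>_def f_def radial_cutoff_outside[OF R(1)])
        next
          case False
          have "open {y. cyl_r y < 2 * \<delta>}"
            by (intro open_Collect_less continuous_on_cyl_r continuous_intros)
          then show ?thesis
            by (rule partial_zero_open) (use True False in \<open>auto simp: \<phi>_def axis_cutoff_zero[OF \<delta>]\<close>)
        qed
        then show ?thesis using nn by simp
      next
        case False
        then have x: "norm x \<le> 2 * R" "2 * \<delta> \<le> cyl_r x" by auto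
        have w0: "0 \<le> w \<delta> x ^ p" by (intro zero_le_even_power p)
        have "w \<delta> x = \<omega> x / cyl_r x" using x(2) \<delta> by (simp add: w_def max_def)
        then have "\<bar>w \<delta> x\<bar> \<le> MQ" using MQ0[of x] x \<delta> by (simp add: MQ_def)
        then have wp: "w \<delta> x ^ p \<le> MQ ^ p"
          using power_mono[of "\<bar>w \<delta> x\<bar>" MQ p] p(1) by (simp add: power_even_abs)
        define I where "I = (indicator {y. cyl_r y \<le> 3 * \<delta>} x :: real)"
        have I: "I \<le> indicator ?c x"
        proof (cases "cyl_r x \<le> 3 * \<delta>")
          case True
          have "\<bar>x $ 1\<bar> \<le> 3 * \<delta>" "\<bar>x $ 2\<bar> \<le> 3 * \<delta>"
            using True abs_component_le_cyl_r[of x]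
            by simp_all
          moreover have "\<bar>x $ 3\<bar> \<le> 2 * R" using component_le_norm_cart[of x 3] x(1) by linarith
          ultimately have "x \<in> ?c" by (simp add: mem_box_cart forall_3 vector_3 abs_le_iff)
          then show ?thesis by (simp add: I_def indicator_def)
        qed (simp add: I_def)
        \<comment> \<open>The radial part of the gradient has the favourable sign and is dropped;
          only the part from the axis cutoff is estimated.\<close>
        have "(\<Sum>j\<in>UNIV. B j x * partial j \<phi> x)
            = axis_cutoff \<delta> x * (\<Sum>j\<in>UNIV. B j x * partial j f x) + f x * (\<Sum>j\<in>UNIV. B j x * partial j (axis_cutoff \<delta>) x)"
          unfolding \<phi>_def partial_mult[OF f(1) smooth_axis_cutoff] by (simp add: sum_3 algebra_simps)
        moreover have "(\<Sum>j\<in>UNIV. B j x * partial j f x) \<le> 0"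
          unfolding f_def by (rule drift_radial_cutoff[OF R(1)]) (use out R in auto)
        then have "axis_cutoff \<delta> x * (\<Sum>j\<in>UNIV. B j x * partial j f x) \<le> 0"
          by (intro mult_nonneg_nonpos) (simp add: axis_cutoff_def step_nonneg)
        moreover have "f x * (\<Sum>j\<in>UNIV. B j x * partial j (axis_cutoff \<delta>) x) \<le> step 2 * (3 * MB / \<delta> * I)"
        proof -
          have "f x * (\<Sum>j\<in>UNIV. B j x * partial j (axis_cutoff \<delta>) x)
              \<le> f x * \<bar>\<Sum>j\<in>UNIV. B j x * partial j (axis_cutoff \<delta>) x\<bar>"
            by (intro mult_left_mono f0) simp
          also have "\<dots> \<le> step 2 * (3 * MB / \<delta> * I)"
            unfolding I_def using f0 step_nonneg[of 2]
            by (intro mult_mono drift_axis_cutoff[OF \<delta>] MB(2) x(1)) auto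
          finally show ?thesis .
        qed
        ultimately have S: "(\<Sum>j\<in>UNIV. B j x * partial j \<phi> x) \<le> step 2 * (3 * MB / \<delta>) * I"
          by (simp add: mult.assoc)
        have k0: "0 \<le> step 2 * (3 * MB / \<delta>)" using step_nonneg[of 2] MB(1) \<delta> by simp
        have "(\<Sum>j\<in>UNIV. B j x * partial j \<phi> x) * w \<delta> x ^ p \<le> (step 2 * (3 * MB / \<delta>) * I) * w \<delta> x ^ p"
          using S w0 by (rule mult_right_mono)
        also have "\<dots> \<le> (step 2 * (3 * MB / \<delta>) * indicator ?c x) * MQ ^ p"
          by (rule mult_mono[OF mult_left_mono[OF I k0] wp mult_nonneg_nonneg[OF k0] w0]) simp
        finally show ?thesis by (simp add: mult_ac)
      qed
    qed
    also have "\<dots> = step 2 * (3 * MB / \<delta>) * MQ ^ p * (144 * R * \<delta>\<^sup>2)"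
      using thin_cylinder_volume(2)[OF \<delta> R(1)] by (simp only: integral_mult_right_zero)
    also have "\<dots> = C * \<delta>" using \<delta> by (simp add: C_def power2_eq_square)
    finally show ?thesis .
  qed
  \<comment> \<open>Any positive value below half the distance of \<open>y0\<close> from the axis
    would make the axis cutoff positive at \<open>y0\<close>.\<close>
  define \<delta>0 where "\<delta>0 = cyl_r y0 / 3"
  have \<delta>0: "\<delta>0 > 0" "2 * \<delta>0 < cyl_r y0" using y0 by (simp_all add: \<delta>0_def)
  have "K * (LINT y|lborel. h \<delta>0 y) \<le> C * \<delta>" if \<delta>: "0 < \<delta>" "\<delta> \<le> \<delta>0" for \<delta>
  proof -
    \<comment> \<open>The integrand grows as \<delta> decreases: for r > 2 \<delta>0 both quotients
      equal Q, and the cutoffs increase. So the bound C \<delta> for small \<delta> applies to the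
      fixed \<delta>0.\<close>
    have "h \<delta>0 y \<le> h \<delta> y" for y
    proof (cases "cyl_r y \<le> 2 * \<delta>0")
      case True
      then show ?thesis using ch(3)[OF \<delta>(1), of y] axis_cutoff_zero[OF \<delta>0(1) True] by (simp add: h_def)
    next
      case False
      then have "w \<delta> y = w \<delta>0 y" using \<delta> by (simp add: w_def max_def)
      then show ?thesis
        unfolding h_def using f0 by (intro mult_mono axis_cutoff_mono \<delta> mult_nonneg_nonneg)
          (auto simp: axis_cutoff_def step_nonneg p zero_le_even_power)
    qed
    then have "(LINT y|lborel. h \<delta>0 y) \<le> (LINT y|lborel. h \<delta> y)"
      using ch[OF \<delta>(1)] ch[OF \<delta>0(1)] by (intro integral_mono integrable_csupp) auto
    then have "K * (LINT y|lborel. h \<delta>0 y) \<le> K * (LINT y|lborel. h \<delta> y)"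
      using K by (intro mult_left_mono) auto
    then show ?thesis using small[OF \<delta>(1)] by linarith
  qed
  then have "\<forall>\<^sub>F \<delta> in at_right 0. K * (LINT y|lborel. h \<delta>0 y) \<le> C * \<delta>"
    using \<delta>0(1) by (auto simp: eventually_at_right_field intro!: exI[of _ \<delta>0])
  moreover have "((\<lambda>\<delta>. C * \<delta>) \<longlongrightarrow> C * 0) (at_right 0)" by (intro tendsto_intros)
  ultimately have "K * (LINT y|lborel. h \<delta>0 y) \<le> C * 0"
    by (intro tendsto_lowerbound) (auto simp: trivial_limit_at_right_real)
  then have "(LINT y|lborel. h \<delta>0 y) \<le> 0" using K by (simp add: mult_le_0_iff)
  then have "h \<delta>0 y0 = 0"
    using ch[OF \<delta>0(1)] by (intro integral_nonpos_imp_zero)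
  then have "w \<delta>0 y0 ^ p = 0"
    using radial_cutoff_pos[OF R(1,3)] axis_cutoff_pos[OF \<delta>0] by (simp add: h_def f_def)
  then have "w \<delta>0 y0 = 0" by simp
  then show ?thesis using \<delta>0 by (simp add: w_def max_def split: if_splits)
qed

text \<open>Compare \<open>y\<close> with its foot on the axis, which lies at distance r and where
  \<omega> vanishes.\<close>

lemma lipschitz_potential_vorticity_bounded:
  assumes \<omega>: "locally_hoelder 1 \<omega>" and zero: "\<And>y. cyl_r y = 0 \<Longrightarrow> \<omega> y = 0"
  shows "potential_vorticity_locally_bounded \<omega>"
  unfolding potential_vorticity_locally_bounded_def
proof (intro allI impI)
  fix \<rho> :: real assume "0 < \<rho>"
  obtain C where C: "\<forall>x\<in>cball 0 \<rho>. \<forall>y\<in>cball 0 \<rho>. \<bar>\<omega> x - \<omega> y\<bar> \<le> C * dist x y powr 1"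
    using \<omega> compact_cball unfolding locally_hoelder_def by blast
  have "\<bar>\<omega> y / cyl_r y\<bar> \<le> C" if y: "norm y < \<rho>" "0 < cyl_r y" for y
  proof -
    define a :: "real^3" where "a = vector [0, 0, y $ 3]"
    have a: "a $ 1 = 0" "a $ 2 = 0" "a $ 3 = y $ 3" by (simp_all add: a_def vector_3)
    have "norm a = \<bar>y $ 3\<bar>"
      by (simp add: norm_eq_sqrt_inner inner_real3 a)
    then have "norm a \<le> norm y"
      using component_le_norm_cart[of y 3] by simp
    then have "\<bar>\<omega> y - \<omega> a\<bar> \<le> C * dist y a powr 1"
      using C y by (simp add: mem_cball_0)
    moreover have "dist y a = cyl_r y"
      by (simp add: dist_norm norm_eq_sqrt_inner inner_real3 a cyl_r_def power2_eq_square)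
    moreover have "\<omega> a = 0" by (rule zero) (simp add: cyl_r_def a)
    ultimately show ?thesis using y(2) by (simp add: abs_divide divide_le_eq)
  qed
  then show "bounded ((\<lambda>y. \<omega> y / cyl_r y) ` (ball 0 \<rho> \<inter> {y. 0 < cyl_r y}))"
    unfolding bounded_iff by (intro exI[of _ C]) auto
qed

lemma sublinear_growth:
  fixes U :: "real^3 \<Rightarrow> real^3"
  assumes lim: "((\<lambda>y. norm (U y) / norm y) \<longlongrightarrow> 0) at_infinity" and \<eta>: "\<eta> > 0"
  obtains R where "\<And>y. R \<le> norm y \<Longrightarrow> norm (U y) \<le> \<eta> * norm y"
proof -
  have "\<forall>\<^sub>F y in at_infinity. norm (U y) / norm y < \<eta>"
    using order_tendstoD(2)[OF lim \<eta>] .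
  then obtain R where R: "\<And>y. R \<le> norm y \<Longrightarrow> norm (U y) / norm y < \<eta>"
    unfolding eventually_at_infinity by blast
  \<comment> \<open>The bound \<open>max R 1\<close> excludes the origin, where the quotient is 0 by
    convention and says nothing about \<open>U\<close>.\<close>
  have "norm (U y) \<le> \<eta> * norm y" if "max R 1 \<le> norm y" for y
    using R[of y] that by (simp add: divide_less_eq split: if_splits)
  then show thesis by (rule that)
qed

theorem proposition6p1:
  fixes \<gamma> \<alpha> :: real
    and U :: "real^3 \<Rightarrow> real^3"
    and \<omega> :: "real^3 \<Rightarrow> real"
  assumes "0 < \<gamma>"
    and "continuous_on UNIV U"
    and "axisym_vector U"
    and "distr_div_free U"
    and "U 0 = 0"
    and "((\<lambda>y. norm (U y) / norm y) \<longlongrightarrow> 0) at_infinity"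
    and "\<And>\<Xi> :: real^3 \<Rightarrow> real^3. test_function \<Xi> \<Longrightarrow> (\<forall>y. divergence \<Xi> y = 0) \<Longrightarrow>
           integral\<^sup>L lborel (\<lambda>y. (1 - 4 * \<gamma>) * (U y \<bullet> \<Xi> y)
             - \<gamma> * tensor_grad y (U y) \<Xi> y - tensor_grad (U y) (U y) \<Xi> y) = 0"
    and "0 < \<alpha>" and "\<alpha> \<le> 1"
    and "distr_curl_eq (swirl_free_part U) (\<lambda>y. \<omega> y *\<^sub>R e_\<theta> y)"
    and "axisym_scalar \<omega>"
    and "\<forall>y. cyl_r y = 0 \<longrightarrow> \<omega> y = 0"
    and "locally_hoelder \<alpha> \<omega>"
  shows "(\<alpha> = 1 \<longrightarrow> potential_vorticity_locally_bounded \<omega>) \<and>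
         (potential_vorticity_locally_bounded \<omega> \<longrightarrow>
            ((\<exists>y. U y \<noteq> 0) \<longrightarrow> 1 / 2 \<le> \<gamma>) \<and>
            ((\<forall>y. comp_\<theta> U y = 0) \<longrightarrow> (\<forall>y. U y = 0)))"
proof -
  note \<gamma> = assms(1) and U = assms(2) and ax = assms(3) and eq = assms(7) and curl = assms(10)
  define b where "b = swirl_free_part U"
  define W where "W y = \<omega> y *\<^sub>R e_\<theta> y" for y
  define B where "B j y = \<gamma> * y $ j + b y $ j" for j y
  define Om where "Om i j y = cross3 (axis i 1) (axis j 1) \<bullet> W y" for i j :: 3 and y
  have zero: "\<omega> y = 0" if "cyl_r y = 0" for y using assms(12) that by blast
  have \<omega>: "continuous_on UNIV \<omega>" by (rule locally_hoelder_continuous[OF assms(13,8)])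
  have W: "continuous_on UNIV W" unfolding W_def by (rule continuous_azimuthal[OF \<omega> zero])
  have Om: "continuous_on UNIV (Om i j)" for i j
    unfolding Om_def by (intro continuous_intros W)
  have b: "continuous_on UNIV b" unfolding b_def by (rule continuous_swirl_free_part[OF U ax])
  have divU: "weak_div (\<lambda>j y. U y $ j) 0" by (rule weak_div_of_distr[OF assms(4)])
  have divb: "weak_div (\<lambda>j y. b y $ j) 0" unfolding b_def by (rule weak_div_swirl_free_part[OF U ax divU])
  have curlb: "distr_curl_eq b W" using curl unfolding b_def W_def .
  have B: "continuous_on UNIV (B j)" for j unfolding B_def by (intro continuous_intros b)
  have divB: "weak_div B (3 * \<gamma>)" using weak_div_drift[OF b divb] unfolding B_def .
  have curlB: "weak_curl B Om"
    using weak_curl_drift[OF b weak_curl_of_distr[OF curlb]] unfolding B_def Om_def .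
  obtain R0 where R0: "\<And>y. R0 \<le> norm y \<Longrightarrow> norm (U y) \<le> \<gamma> * norm y"
    using sublinear_growth[OF assms(6) \<gamma>] by blast
  \<comment> \<open>The swirl is perpendicular to y, so the outward component of the drift is that
    of \<gamma> y + U, nonnegative once |U| \<le> \<gamma> |y|.\<close>
  have out: "0 \<le> (\<Sum>j\<in>UNIV. B j y * y $ j)" if "R0 \<le> norm y" for y
  proof -
    obtain s where s: "U y - b y = s *\<^sub>R vector [- (y $ 2), y $ 1, 0]"
      using swirl_part_tangential[OF ax] unfolding b_def by blast
    have "(U y - b y) \<bullet> y = 0" unfolding s by (simp add: inner_real3 vector_3)
    then have "(\<Sum>j\<in>UNIV. B j y * y $ j) = \<gamma> * (y \<bullet> y) + U y \<bullet> y"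
      unfolding B_def by (simp add: sum_3 inner_real3 algebra_simps)
    moreover have "\<bar>U y \<bullet> y\<bar> \<le> norm (U y) * norm y" by (rule Cauchy_Schwarz_ineq2)
    moreover have "norm (U y) * norm y \<le> \<gamma> * norm y * norm y"
      by (intro mult_right_mono R0 that) simp
    ultimately show ?thesis by (simp add: dot_square_norm power2_eq_square)
  qed
  \<comment> \<open>Here c + d = (1 - 5 \<gamma>) + 3 \<gamma> = 1 - 2 \<gamma>, positive exactly
    below the threshold 1/2.\<close>
  have noswirl: "y $ 1 * U y $ 2 - y $ 2 * U y $ 1 = 0" if "\<gamma> < 1 / 2" for y
  proof (rule transport_vanishes[OF B divB curlB Om out,
        where w = "\<lambda>y. y $ 1 * U y $ 2 - y $ 2 * U y $ 1" and c = "1 - 5 * \<gamma>"])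
    show "continuous_on UNIV (\<lambda>y. y $ 1 * U y $ 2 - y $ 2 * U y $ 1)"
      by (intro continuous_intros U)
    show "axisym_scalar (\<lambda>y. y $ 1 * U y $ 2 - y $ 2 * U y $ 1)"
      unfolding axisym_scalar_def
    proof (intro allI)
      fix t and y :: "real^3"
      \<comment> \<open>The circulation is the determinant of the horizontal parts of y and U, hence
        invariant under a common rotation.\<close>
      have rot_id: "(c * p - s * q) * (s * u + c * v) - (s * p + c * q) * (c * u - s * v)
          = (s\<^sup>2 + c\<^sup>2) * (p * v - q * u)" for c s p q u v :: real
        by algebra
      have "U (rot_z t y) = rot_z t (U y)" using ax unfolding axisym_vector_def by blast
      moreover have "rot_z t v $ 1 = cos t * v $ 1 - sin t * v $ 2" "rot_z t v $ 2 = sin t * v $ 1 + cos t * v $ 2" for v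
        by (simp_all add: rot_z_def vector_3)
      ultimately have "rot_z t y $ 1 * U (rot_z t y) $ 2 - rot_z t y $ 2 * U (rot_z t y) $ 1
          = ((sin t)\<^sup>2 + (cos t)\<^sup>2) * (y $ 1 * U y $ 2 - y $ 2 * U y $ 1)"
        by (simp only: rot_id)
      then show "rot_z t y $ 1 * U (rot_z t y) $ 2 - rot_z t y $ 2 * U (rot_z t y) $ 1
          = y $ 1 * U y $ 2 - y $ 2 * U y $ 1" by (simp only: sin_cos_squared_add mult_1)
    qed
    show "(LINT y|lborel. (y $ 1 * U y $ 2 - y $ 2 * U y $ 1) * (\<Sum>j\<in>UNIV. B j y * partial j \<psi> y))
        = (1 - 5 * \<gamma>) * (LINT y|lborel. (y $ 1 * U y $ 2 - y $ 2 * U y $ 1) * \<psi> y)"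
      if "smooth \<psi>" "csupp \<psi>" "axisym_scalar \<psi>" for \<psi>
      unfolding B_def
      by (rule circulation_equation[OF U b _ eq that])
         (use swirl_part_tangential[OF ax] in \<open>auto simp: b_def\<close>)
    show "0 < 1 - 5 * \<gamma> + 3 * \<gamma>" using that by simp
  qed
  \<comment> \<open>This is the second claim, for every \<gamma>; the first one reduces to it, since
    the swirl vanishes for \<gamma> < 1/2.\<close>
  have main: "U y = 0" if pv: "potential_vorticity_locally_bounded \<omega>" and ns: "\<And>y. comp_\<theta> U y = 0" for y
  proof -
    have Ub: "b = U"
      using cylindrical_decomposition[OF ax] ns unfolding b_def by (intro ext) simp
    have ns': "y $ 1 * U y $ 2 = y $ 2 * U y $ 1" for y
    proof (cases "cyl_r y = 0")
      case True
      then have "y $ 1 = 0" "y $ 2 = 0" by (simp_all add: cyl_r_def sum_power2_eq_zero_iff)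
      then show ?thesis by simp
    next
      case False
      then show ?thesis
        using ns[of y] by (simp add: comp_\<theta>_def e_\<theta>_def inner_real3 vector_3 field_simps)
    qed
    have "\<omega> y = 0" for y
    proof (cases "cyl_r y = 0")
      case False
      show ?thesis
      proof (rule potential_vorticity_vanishes[OF B divB curlB Om out \<omega> assms(11)])
        show "\<exists>M. \<forall>y. norm y < R \<longrightarrow> 0 < cyl_r y \<longrightarrow> \<bar>\<omega> y / cyl_r y\<bar> \<le> M" if "R > 0" for R
        proof -
          have "bounded ((\<lambda>y. \<omega> y / cyl_r y) ` (ball 0 R \<inter> {y. 0 < cyl_r y}))"
            using pv that unfolding potential_vorticity_locally_bounded_def by blast
          then obtain M where "\<forall>z\<in>(\<lambda>y. \<omega> y / cyl_r y) ` (ball 0 R \<inter> {y. 0 < cyl_r y}). norm z \<le> M"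
            unfolding bounded_iff ..
          then show ?thesis by (intro exI[of _ M]) auto
        qed
        show "(LINT y|lborel. \<omega> y / max (cyl_r y) \<delta> * (\<Sum>j\<in>UNIV. B j y * partial j \<psi> y))
            = (1 - 2 * \<gamma>) * (LINT y|lborel. \<omega> y / max (cyl_r y) \<delta> * \<psi> y)"
          if "\<delta> > 0" "smooth \<psi>" "csupp \<psi>" "\<And>y. cyl_r y \<le> \<delta> \<Longrightarrow> \<psi> y = 0" for \<delta> \<psi>
          unfolding B_def Ub
        proof (rule potential_vorticity_equation[OF U divU curlb[unfolded Ub] W ns' that(1) _ _ eq that(2-4)])
          have "max (cyl_r y) \<delta> \<noteq> 0" for y using that(1) by simp
          then show "continuous_on UNIV (\<lambda>y. \<omega> y / max (cyl_r y) \<delta>)"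
            by (intro continuous_intros \<omega> continuous_on_cyl_r) simp
          show "W y = (\<omega> y / max (cyl_r y) \<delta>) *\<^sub>R vector [- (y $ 2), y $ 1, 0]" if "\<delta> \<le> cyl_r y" for y
            using that by (simp add: W_def e_\<theta>_def max_def vec_eq_iff forall_3 vector_3)
        qed
        \<comment> \<open>The rate 1 + \<gamma> is positive for every \<gamma> > 0, so no threshold
          appears without swirl.\<close>
        show "0 < 1 - 2 * \<gamma> + 3 * \<gamma>" using \<gamma> by simp
        show "0 < cyl_r y" using False cyl_r_nonneg[of y] by simp
      qed
    qed (rule zero)
    then have "Om = (\<lambda>i j y. 0)" unfolding Om_def W_def by simp
    then have curl0: "weak_curl (\<lambda>j y. U y $ j) (\<lambda>i j y. 0)"
      using weak_curl_of_distr[OF curlb, folded Om_def] unfolding Ub by simp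
    have growth: "\<exists>M. \<forall>j y. \<bar>U y $ j\<bar> \<le> \<eta> * norm y + M" if \<eta>: "\<eta> > 0" for \<eta>
    proof -
      obtain R where R: "\<And>y. R \<le> norm y \<Longrightarrow> norm (U y) \<le> \<eta> * norm y"
        using sublinear_growth[OF assms(6) \<eta>] by blast
      have "continuous_on UNIV (\<lambda>y. U y $ j)" for j by (intro continuous_intros U)
      then obtain M where M: "M \<ge> 0" "\<And>j y. norm y \<le> R \<Longrightarrow> \<bar>U y $ j\<bar> \<le> M"
        using continuous_bounded_on_cball[of "\<lambda>j y. U y $ j" R] by blast
      have "\<bar>U y $ j\<bar> \<le> \<eta> * norm y + M" for j y
      proof (cases "R \<le> norm y")
        case True
        then show ?thesis using R[OF True] component_le_norm_cart[of "U y" j] M(1) by linarith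
      next
        case False
        then have "\<bar>U y $ j\<bar> \<le> M" by (intro M(2)) simp
        moreover have "0 \<le> \<eta> * norm y" using \<eta> by simp
        ultimately show ?thesis by linarith
      qed
      then show ?thesis by blast
    qed
    \<comment> \<open>The constant supplied by Liouville's theorem is identified by U(0) =
      0.\<close>
    have "U y $ k = U 0 $ k" for k
      by (rule liouville[OF _ divU curl0 growth]) (intro continuous_intros U)
    then show ?thesis by (simp add: vec_eq_iff assms(5))
  qed
  have comp0: "comp_\<theta> U y = 0" if "\<gamma> < 1 / 2" for y
  proof -
    \<comment> \<open>The swirl component is \<Gamma> / r; on the axis both sides are 0 by the
      convention for division by zero.\<close>
    have "comp_\<theta> U y = (y $ 1 * U y $ 2 - y $ 2 * U y $ 1) / cyl_r y"
      by (simp add: comp_\<theta>_def e_\<theta>_def inner_real3 vector_3 diff_divide_distrib mult.commute)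
    then show ?thesis by (simp only: noswirl[OF that] div_0)
  qed
  show ?thesis
  proof (intro conjI impI)
    assume "\<alpha> = 1"
    then show "potential_vorticity_locally_bounded \<omega>"
      using assms(13) by (intro lipschitz_potential_vorticity_bounded zero) simp
  next
    assume pv: "potential_vorticity_locally_bounded \<omega>" and "\<exists>y. U y \<noteq> 0"
    then show "1 / 2 \<le> \<gamma>"
      using main[OF pv comp0] by (meson not_le)
  next
    assume "potential_vorticity_locally_bounded \<omega>" "\<forall>y. comp_\<theta> U y = 0"
    then show "\<forall>y. U y = 0"
      by (intro allI main) simp_all
  qed
qed

end
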